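(* Let $(\mathcal{A},\varphi)$ be a non-commutative probability space, let $t\in[0,1]$, and let $\{b_n:\mathcal{A}^n\to\mathbb{C}\}_{n\ge1}$ and $\{h_n^{(t)}:\mathcal{A}^n\to\mathbb{C}\}_{n\ge1}$ be the Boolean and $t$-monotone cumulants of $(\mathcal{A},\varphi)$, respectively. Then, for any $n\ge1$ and $a_1,\ldots,a_n\in\mathcal{A}$, $$b_n(a_1,\ldots,a_n)=\sum_{\pi\in\mathrm{NC}^{\mathrm{irr}}(n)}\frac{t^{|\pi|-1}}{t(\pi)!}\,h^{(t)}_\pi(a_1,\ldots,a_n),$$ $$\varphi(a_1\cdots a_n)=\sum_{\pi\in\mathrm{NC}(n)}\frac{t^{\mathrm{inner}(\pi)}}{t(\pi)!}\,h^{(t)}_\pi(a_1,\ldots,a_n),$$ where $t(\pi)!$ denotes the tree factorial of the nesting forest of $\pi$ and $\mathrm{inner}(\pi)$ the number of inner blocks of $\pi$.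
   Context: **Probability space.** A non-commutative probability space $(\mathcal{A},\varphi)$ is an associative unital complex algebra $\mathcal{A}$ with a linear functional $\varphi:\mathcal{A}\to\mathbb{C}$, $\varphi(1_{\mathcal{A}})=1$. **Partitions.** $\mathrm{NC}(n)$ is the set of non-crossing partitions of $[n]=\{1,\dots,n\}$; $|\pi|$ is the number of blocks; $\mathrm{NC}^{\mathrm{irr}}(n)$ consists of those in which $1$ and $n$ lie in the same block; $\mathrm{I}(n)$ consists of those all of whose blocks are intervals. For blocks, $\pi_j<\pi_i$ iff there are $a,b\in\pi_j$ with $a<c<b$ for all $c\in\pi_i$ ($\pi_i$ nested in $\pi_j$). A block is outer if minimal for this order, inner otherwise. The nesting forest $t(\pi)$ (not to be confused with the parameter $t$) is the forest of rooted trees whose vertices are the blocks of $\pi$, encoding the nesting order (roots are the outer blocks). Tree factorial: $\tau!=1$ for a single vertex, $\tau!=|\tau|\,\tau_1!\cdots\tau_s!$ if $\tau$ is obtained by attaching trees $\tau_1,\dots,\tau_s$ to a new root ($|\tau|$ = number of vertices); for a forest, take the product over its trees. For multilinear functionals $f_m:\mathcal{A}^m\to\mathbb{C}$, $f_\pi(a_1,\dots,a_n)=\prod_{V\in\pi}f_{|V|}(a_{i_1},\dots,a_{i_m})$, where $V=\{i_1<\dots<i_m\}$. **Boolean cumulants.** $\{b_n\}$ are recursively defined by $\varphi(a_1\cdots a_n)=\sum_{\pi\in\mathrm{I}(n)}b_\pi(a_1,\dots,a_n)$. **Double tensor Hopf algebra.** $T_+(\mathcal{A})=\bigoplus_{n\ge1}\mathcal{A}^{\otimes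 n}$ and $T(T_+(\mathcal{A}))=\bigoplus_{n\ge0}T_+(\mathcal{A})^{\otimes n}$. A word $a_1\cdots a_n$ in $T_+(\mathcal{A})$ denotes $a_1\otimes\cdots\otimes a_n$; pure tensors in $T(T_+(\mathcal{A}))$ are written $w_1|\cdots|w_m$. The product is concatenation with $|$, with unit the empty word $\mathbf{1}$. For $w=a_1\cdots a_n$ and $S=\{s_1<\dots<s_l\}\subseteq[n]$ let $w_S=a_{s_1}\cdots a_{s_l}$ ($w_\emptyset=\mathbf{1}$), and let $J_1,\dots,J_r$ be the connected components (maximal intervals of consecutive integers) of $[n]\setminus S$, ordered by minimal elements. The coproduct is $\Delta(w)=\sum_{S\subseteq[n]}w_S\otimes w_{J_1}|\cdots|w_{J_r}$, extended multiplicatively; the counit $\epsilon$ is the unital algebra morphism vanishing on $T_+(\mathcal{A})$. Split $\Delta=\Delta_\prec+\Delta_\succ$ on the augmentation ideal, where $\Delta_\prec(w)=\sum_{1\in S\subseteq[n]}w_S\otimes w_{J_1}|\cdots|w_{J_r}$ on words and $\Delta_\prec(w_1|w_2|\cdots|w_m)=\Delta_\prec(w_1)\Delta(w_2|\cdots|w_m)$, and likewise for $\Delta_\succ$. **Products on the dual.** For linear forms $f,g$: $f*g=m_{\mathbb{C}}(f\otimes g)\Delta$ (associative, unit $\epsilon$), $f\prec g=m_{\mathbb{C}}(f\otimes g)\Delta_\prec$, $f\succ g=m_{\mathbb{C}}(f\otimes g)\Delta_\succ$, with $f\prec\epsilon=f=\epsilon\succ f$ and $\epsilon\prec f=0=f\succ\epsilon$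 for $f\ne\epsilon$; half-shuffle products are only used when at least one factor vanishes on $\mathbf{1}$, and then they vanish on $\mathbf{1}$. They satisfy $(f\prec g)\prec h=f\prec(g*h)$, $(f\succ g)\prec h=f\succ(g\prec h)$, $f\succ(g\succ h)=(f*g)\succ h$. **Characters.** $G$ is the group (for $*$) of characters, i.e. unital algebra morphisms $T(T_+(\mathcal{A}))\to\mathbb{C}$. $\mathfrak{g}$ is the space of infinitesimal characters: linear forms $\alpha$ with $\alpha(\mathbf{1})=0$ and $\alpha(w_1|\cdots|w_k)=0$ for all $k\ge2$, $w_i\in T_+(\mathcal{A})$. The maps $\exp^*(\alpha)=\sum_{n\ge0}\alpha^{*n}/n!$ and $\mathcal{E}_\succ(\alpha)=\sum_{n\ge0}\alpha^{\succ n}$ ($\alpha^{\succ0}=\epsilon$, $\alpha^{\succ n}=\alpha^{\succ(n-1)}\succ\alpha$) are bijections $\mathfrak{g}\to G$. The character extending $\varphi$ is the $\Phi\in G$ with $\Phi(w)=\varphi(a_1\cdots a_n)$ (product in $\mathcal{A}$) for every word $w=a_1\cdots a_n$. **c-monotone infinitesimal character.** On $\mathfrak{g}$, $\alpha\lhd\gamma=\alpha\prec\gamma-\gamma\succ\alpha$; $r^{(0)}_{\lhd\gamma}(\alpha)=\alpha$, $r^{(n+1)}_{\lhd\gamma}(\alpha)=r^{(n)}_{\lhd\gamma}(\alpha)\lhd\gamma$; $W_\gamma(\alpha)=\sum_{n\ge0}\frac1{(n+1)!}r^{(n)}_{\lhd\gamma}(\alpha)$, which is an invertible linear operator in $\alpha$.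 For characters $\Phi=\mathcal{E}_\succ(\beta)$ and $\Psi=\exp^*(\rho')$, $\mathsf{P}(\Phi,\Psi)\in\mathfrak{g}$ is the unique element with $W_{\rho'}(\mathsf{P}(\Phi,\Psi))=\beta$. **$t$-monotone cumulants.** For $t\in[0,1]$, with $\Phi=\mathcal{E}_\succ(\beta)$ the character extending $\varphi$ and $\Phi_t=\mathcal{E}_\succ(t\beta)$, put $\rho^{(t)}=\mathsf{P}(\Phi,\Phi_t)$; the $t$-monotone cumulants are $h_n^{(t)}(a_1,\dots,a_n)=\rho^{(t)}(a_1\otimes\cdots\otimes a_n)$. Convention: $0^0=1$. *)

theory Defs
  imports Complex_Main "HOL-Library.Multiset" "HOL-Library.Disjoint_Sets"
begin

section \<open>Non-commutative probability spaces\<close>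

text \<open>
  The class \<open>ring_1\<close> demands \<open>0 \<noteq> 1\<close>; this is no restriction here, because it follows from
  \<open>\<phi> 1 = 1\<close> and the linearity of \<open>\<phi>\<close>.  That the algebra is a complex vector space under
  \<open>scale\<close> is part of \<open>Vector_Spaces.linear\<close>.
\<close>

locale nc_prob_space =
  fixes scale :: "complex \<Rightarrow> 'a::ring_1 \<Rightarrow> 'a" and \<phi> :: "'a \<Rightarrow> complex"
  assumes linear_\<phi>: "Vector_Spaces.linear scale (*) \<phi>"
    and scale_mult_left: "scale c x * y = scale c (x * y)"
    and scale_mult_right: "x * scale c y = scale c (x * y)"
    and unital: "\<phi> 1 = 1"

section \<open>Non-crossing partitions and their nesting forests\<close>

text \<open>
  Positions are numbered from 0, so \<open>{..<n}\<close> replaces \<open>{1..n}\<close>, and \<open>nths xs V\<close> is the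
  subword of \<open>xs\<close> with positions in \<open>V\<close>.
\<close>

definition noncrossing :: "nat set set \<Rightarrow> bool" where
  "noncrossing \<pi> \<longleftrightarrow>
     (\<forall>V\<in>\<pi>. \<forall>W\<in>\<pi>. V \<noteq> W \<longrightarrow>
        \<not> (\<exists>a\<in>V. \<exists>b\<in>W. \<exists>c\<in>V. \<exists>d\<in>W. a < b \<and> b < c \<and> c < d))"

definition NC :: "nat \<Rightarrow> nat set set set" where
  "NC n = {\<pi>. partition_on {..<n} \<pi> \<and> noncrossing \<pi>}"

definition NC_irr :: "nat \<Rightarrow> nat set set set" where
  "NC_irr n = {\<pi> \<in> NC n. \<exists>V\<in>\<pi>. 0 \<in> V \<and> n - 1 \<in> V}"

definition interval_partitions :: "nat \<Rightarrow> nat set set set" where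
  "interval_partitions n = {\<pi> \<in> NC n. \<forall>V\<in>\<pi>. \<exists>i j. V = {i..j}}"

text \<open>\<open>nests V W\<close>: the block \<open>W\<close> is nested in the block \<open>V\<close>.\<close>

definition nests :: "nat set \<Rightarrow> nat set \<Rightarrow> bool" where
  "nests V W \<longleftrightarrow> (\<exists>a\<in>V. \<exists>b\<in>V. \<forall>c\<in>W. a < c \<and> c < b)"

definition outer_blocks :: "nat set set \<Rightarrow> nat set set" where
  "outer_blocks \<pi> = {V \<in> \<pi>. \<not> (\<exists>W\<in>\<pi>. nests W V)}"

definition inner_blocks :: "nat set set \<Rightarrow> nat set set" where
  "inner_blocks \<pi> = \<pi> - outer_blocks \<pi>"

text \<open>Non-plane rooted trees with labelled vertices; a forest is a multiset of trees.\<close>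

datatype 'b rtree = Node 'b "'b rtree multiset"

primrec num_vertices :: "'b rtree \<Rightarrow> nat" where
  "num_vertices (Node v ts) = Suc (\<Sum>\<^sub># (image_mset num_vertices ts))"

primrec tree_factorial :: "'b rtree \<Rightarrow> nat" where
  "tree_factorial (Node v ts) =
     num_vertices (Node v ts) * \<Prod>\<^sub># (image_mset tree_factorial ts)"

definition forest_factorial :: "'b rtree multiset \<Rightarrow> nat" where
  "forest_factorial F = \<Prod>\<^sub># (image_mset tree_factorial F)"

text \<open>
  The roots are the outer blocks; the trees attached to the root \<open>V\<close> form the nesting forest
  of the blocks nested in \<open>V\<close>.
\<close>

function nesting_forest :: "nat set set \<Rightarrow> nat set rtree multiset" where
  "nesting_forest \<pi> =
     (if finite \<pi>
      then image_mset (\<lambda>V. Node V (nesting_forest {W \<in> \<pi>. nests V W}))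
             (mset_set (outer_blocks \<pi>))
      else {#})"
  by auto
termination
proof (relation "measure card")
  fix \<pi> :: "nat set set" and V
  assume "finite \<pi>" and "V \<in># mset_set (outer_blocks \<pi>)"
  then have "V \<in> \<pi>"
    by (auto simp: outer_blocks_def)
  moreover have "\<not> nests V V"
    by (auto simp: nests_def)
  ultimately have "{W \<in> \<pi>. nests V W} \<subset> \<pi>"
    by blast
  then show "({W \<in> \<pi>. nests V W}, \<pi>) \<in> measure card"
    using \<open>finite \<pi>\<close> by (simp add: psubset_card_mono)
qed simp

declare nesting_forest.simps [simp del]

text \<open>
  A family of functionals \<open>f\<^sub>m : A\<^sup>m \<rightarrow> \<complex>\<close> is a function on lists;
  \<open>part_ext f \<pi>\<close> is \<open>f\<^sub>\<pi>\<close>.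
\<close>

definition part_ext :: "('a list \<Rightarrow> complex) \<Rightarrow> nat set set \<Rightarrow> 'a list \<Rightarrow> complex" where
  "part_ext f \<pi> xs = (\<Prod>V\<in>\<pi>. f (nths xs V))"

text \<open>The value at the empty list is immaterial; it is fixed only to make the family unique.\<close>

definition boolean_cumulant :: "('a::ring_1 \<Rightarrow> complex) \<Rightarrow> 'a list \<Rightarrow> complex" where
  "boolean_cumulant \<phi> =
     (THE b. b [] = 0 \<and>
        (\<forall>xs. xs \<noteq> [] \<longrightarrow>
           \<phi> (prod_list xs) = (\<Sum>\<pi>\<in>interval_partitions (length xs). part_ext b \<pi> xs)))"

section \<open>The double tensor Hopf algebra and its dual\<close>

text \<open>
  A list of words \<open>[w\<^sub>1, \<dots>, w\<^sub>m]\<close> stands for the pure tensor \<open>w\<^sub>1|\<dots>|w\<^sub>m\<close>, so \<open>[]\<close> is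
  the unit and \<open>@\<close> the product.  Words are elements of \<open>T\<^sub>+(A)\<close> and hence nonempty: a list
  containing the empty word stands for no tensor, all linear forms are set to 0 there, and its
  coproduct is the empty sum.

  By the universal property of tensor products, a linear form on the double tensor algebra is
  the same as a function on pure tensors which is linear in every letter; linear forms are
  represented in this way.
\<close>

type_synonym 'a form = "'a list list \<Rightarrow> complex"

definition linear_form :: "(complex \<Rightarrow> 'a::ring_1 \<Rightarrow> 'a) \<Rightarrow> 'a form \<Rightarrow> bool" where
  "linear_form scale f \<longleftrightarrow>
     (\<forall>ws. [] \<in> set ws \<longrightarrow> f ws = 0) \<and>
     (\<forall>us xs ys vs. Vector_Spaces.linear scale (*) (\<lambda>x. f (us @ [xs @ [x] @ ys] @ vs)))"

text \<open>
  \<open>gaps w S\<close> lists the subwords \<open>w\<^sub>J\<close> for the connected components \<open>J\<close> of the complement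
  of \<open>S\<close>, in increasing order of their least elements \<open>i\<close>.
\<close>

definition gaps :: "'a list \<Rightarrow> nat set \<Rightarrow> 'a list list" where
  "gaps w S =
     (let C = {..<length w} - S
      in map (\<lambda>i. nths w {j. i \<le> j \<and> {i..j} \<subseteq> C})
           (sorted_list_of_set {i \<in> C. i = 0 \<or> i - 1 \<notin> C}))"

definition word_tensor :: "'a list \<Rightarrow> 'a list list" where
  "word_tensor w = (if w = [] then [] else [w])"

text \<open>
  An element of the tensor square with nonnegative integer coefficients is a multiset of pairs
  of pure tensors, read as their sum.
\<close>

type_synonym 'a tensor_square = "('a list list \<times> 'a list list) multiset"

definition tensor_mult :: "'a tensor_square \<Rightarrow> 'a tensor_square \<Rightarrow> 'a tensor_square" where
  "tensor_mult M N = (\<Sum>(u, v)\<in>#M. image_mset (\<lambda>(u', v'). (u @ u', v @ v')) N)"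

definition coprod_over :: "nat set set \<Rightarrow> 'a list \<Rightarrow> 'a tensor_square" where
  "coprod_over \<S> w =
     (if w = [] then {#}
      else image_mset (\<lambda>S. (word_tensor (nths w S), gaps w S))
             (mset_set {S \<in> \<S>. S \<subseteq> {..<length w}}))"

primrec coprod :: "'a list list \<Rightarrow> 'a tensor_square" where
  "coprod [] = {#([], [])#}"
| "coprod (w # ws) = tensor_mult (coprod_over UNIV w) (coprod ws)"

text \<open>
  The half-coproducts live on the augmentation ideal; the value at the unit is set to 0, so that
  half-shuffle products vanish there.
\<close>

primrec coprod_prec :: "'a list list \<Rightarrow> 'a tensor_square" where
  "coprod_prec [] = {#}"
| "coprod_prec (w # ws) = tensor_mult (coprod_over {S. 0 \<in> S} w) (coprod ws)"

primrec coprod_succ :: "'a list list \<Rightarrow> 'a tensor_square" where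
  "coprod_succ [] = {#}"
| "coprod_succ (w # ws) = tensor_mult (coprod_over {S. 0 \<notin> S} w) (coprod ws)"

definition counit :: "'a form" where
  "counit ws = (if ws = [] then 1 else 0)"

definition conv :: "'a form \<Rightarrow> 'a form \<Rightarrow> 'a form" where
  "conv f g ws = (\<Sum>(u, v)\<in>#coprod ws. f u * g v)"

text \<open>
  For \<open>f\<close> vanishing at the unit, the conventions \<open>f \<prec> \<epsilon> = f = \<epsilon> \<succ> f\<close> and
  \<open>\<epsilon> \<prec> f = 0 = f \<succ> \<epsilon>\<close> are instances of the following formulas.
\<close>

definition half_prec :: "'a form \<Rightarrow> 'a form \<Rightarrow> 'a form" where
  "half_prec f g ws = (\<Sum>(u, v)\<in>#coprod_prec ws. f u * g v)"

definition half_succ :: "'a form \<Rightarrow> 'a form \<Rightarrow> 'a form" where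
  "half_succ f g ws = (\<Sum>(u, v)\<in>#coprod_succ ws. f u * g v)"

definition characters :: "(complex \<Rightarrow> 'a::ring_1 \<Rightarrow> 'a) \<Rightarrow> 'a form set" where
  "characters scale =
     {f. linear_form scale f \<and> f [] = 1 \<and> (\<forall>us vs. f (us @ vs) = f us * f vs)}"

definition inf_characters :: "(complex \<Rightarrow> 'a::ring_1 \<Rightarrow> 'a) \<Rightarrow> 'a form set" where
  "inf_characters scale =
     {f. linear_form scale f \<and> f [] = 0 \<and> (\<forall>ws. 2 \<le> length ws \<longrightarrow> f ws = 0)}"

text \<open>
  The exponentials and the operator \<open>W_op \<gamma>\<close> are pointwise sums; on infinitesimal characters
  only finitely many terms are nonzero at each pure tensor.
\<close>

primrec conv_power :: "'a form \<Rightarrow> nat \<Rightarrow> 'a form" where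
  "conv_power \<alpha> 0 = counit"
| "conv_power \<alpha> (Suc n) = conv (conv_power \<alpha> n) \<alpha>"

definition exp_conv :: "'a form \<Rightarrow> 'a form" where
  "exp_conv \<alpha> ws = (\<Sum>n. conv_power \<alpha> n ws / fact n)"

primrec succ_power :: "'a form \<Rightarrow> nat \<Rightarrow> 'a form" where
  "succ_power \<alpha> 0 = counit"
| "succ_power \<alpha> (Suc n) = half_succ (succ_power \<alpha> n) \<alpha>"

definition exp_succ :: "'a form \<Rightarrow> 'a form" where
  "exp_succ \<alpha> ws = (\<Sum>n. succ_power \<alpha> n ws)"

definition pre_lie :: "'a form \<Rightarrow> 'a form \<Rightarrow> 'a form" where
  "pre_lie \<alpha> \<gamma> ws = half_prec \<alpha> \<gamma> ws - half_succ \<gamma> \<alpha> ws"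

primrec pre_lie_iter :: "'a form \<Rightarrow> nat \<Rightarrow> 'a form \<Rightarrow> 'a form" where
  "pre_lie_iter \<gamma> 0 \<alpha> = \<alpha>"
| "pre_lie_iter \<gamma> (Suc n) \<alpha> = pre_lie (pre_lie_iter \<gamma> n \<alpha>) \<gamma>"

definition W_op :: "'a form \<Rightarrow> 'a form \<Rightarrow> 'a form" where
  "W_op \<gamma> \<alpha> ws = (\<Sum>n. pre_lie_iter \<gamma> n \<alpha> ws / fact (n + 1))"

definition log_conv :: "(complex \<Rightarrow> 'a::ring_1 \<Rightarrow> 'a) \<Rightarrow> 'a form \<Rightarrow> 'a form" where
  "log_conv scale = the_inv_into (inf_characters scale) exp_conv"

definition log_succ :: "(complex \<Rightarrow> 'a::ring_1 \<Rightarrow> 'a) \<Rightarrow> 'a form \<Rightarrow> 'a form" where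
  "log_succ scale = the_inv_into (inf_characters scale) exp_succ"

definition c_monotone_inf_character ::
  "(complex \<Rightarrow> 'a::ring_1 \<Rightarrow> 'a) \<Rightarrow> 'a form \<Rightarrow> 'a form \<Rightarrow> 'a form" where
  "c_monotone_inf_character scale \<Phi> \<Psi> =
     the_inv_into (inf_characters scale) (W_op (log_conv scale \<Psi>)) (log_succ scale \<Phi>)"

definition character_of ::
  "(complex \<Rightarrow> 'a::ring_1 \<Rightarrow> 'a) \<Rightarrow> ('a \<Rightarrow> complex) \<Rightarrow> 'a form" where
  "character_of scale \<phi> =
     (THE \<Phi>. \<Phi> \<in> characters scale \<and> (\<forall>w. w \<noteq> [] \<longrightarrow> \<Phi> [w] = \<phi> (prod_list w)))"

definition t_monotone_cumulant ::
  "(complex \<Rightarrow> 'a::ring_1 \<Rightarrow> 'a) \<Rightarrow> ('a \<Rightarrow> complex) \<Rightarrow> real \<Rightarrow> 'a list \<Rightarrow> complex" where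
  "t_monotone_cumulant scale \<phi> t w =
     (let \<Phi> = character_of scale \<phi>;
          \<Phi>\<^sub>t = exp_succ (\<lambda>ws. complex_of_real t * log_succ scale \<Phi> ws)
      in c_monotone_inf_character scale \<Phi> \<Phi>\<^sub>t [w])"

end

theory Submission
  imports Defs
begin

text \<open>
  An infinitesimal character \<open>\<alpha>\<close> is determined by its values on words, and in a product with
  \<open>\<alpha>\<close> on the right the coproduct of a word only contributes the sets \<open>S\<close> whose complement is
  one interval, or empty.  On words, the products with infinitesimal characters are therefore sums
  over ways of cutting an interval out of a word: right convolution with \<open>\<gamma>\<close>
  (\<open>right_conv\<close>) cuts out an arbitrary interval and evaluates \<open>\<gamma>\<close> on it; the pre-Lie product
  \<open>\<alpha> \<lhd> \<gamma>\<close> (\<open>insertion\<close>) only cuts out intervals strictly inside the word, because the boundary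
  terms of \<open>\<alpha> \<prec> \<gamma>\<close> and \<open>\<gamma> \<succ> \<alpha>\<close> cancel.  The exponential \<open>\<E>\<^sub>\<succ>(\<beta>)\<close> repeatedly splits off an
  initial segment and evaluates \<open>\<beta>\<close> on it, so the Boolean cumulants of \<open>\<phi>\<close> are the values of
  \<open>\<beta>\<close> for \<open>\<Phi> = \<E>\<^sub>\<succ>(\<beta>)\<close>.

  Two facts about these sums carry the proof.

  First, \<open>exp\<^sup>*(\<gamma>) = \<E>\<^sub>\<succ>(W\<^sub>\<gamma>(\<gamma>))\<close> (\<open>exp_conv_eq_exp_succ\<close>).  Let \<open>f \<bullet> g\<close> sum \<open>f(u) g(v)\<close> over the
  factorizations \<open>w = uv\<close> with \<open>u\<close> nonempty.  If an interval is cut out of \<open>w\<close> and the remaining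
  word is factorized as \<open>uv\<close>, the interval came from the front of \<open>u\<close>, from strictly inside
  \<open>u\<close>, or from behind \<open>u\<close>.  This is a Leibniz rule for right convolution on \<open>f \<bullet> g\<close>
  (\<open>right_conv_concat_prod\<close>), and by Pascal's rule it expands \<open>\<gamma>\<^sup>*\<^sup>n\<close> as a binomial sum of
  products of an iterated pre-Lie power and a smaller convolution power.

  Second, \<open>r\<^sup>m(h)(w) = (m + 1)! \<Sum> h\<^sub>\<pi>(w) / t(\<pi>)!\<close>, where \<open>r = r\<^bsub>\<lhd>h\<^esub>\<close> and \<open>\<pi>\<close> ranges over the irreducible
  non-crossing partitions with \<open>m + 1\<close> blocks (\<open>insertion_pow_eq_irr_sum\<close>).  Cutting out an inner
  interval amounts to removing a leaf of the nesting forest, and the inverse tree factorials obey the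
  hook recursion: \<open>|\<pi>| / t(\<pi>)!\<close> is the sum of \<open>1 / t(\<pi> - {U})!\<close> over the leaves \<open>U\<close>.

  Now define \<open>h\<close> from the Boolean cumulants \<open>b\<close> by solving the first formula of the theorem
  recursively (\<open>t_cumulant\<close>).  The second fact says \<open>W\<^bsub>th\<^esub>(h) = b\<close>; hence \<open>W\<^bsub>th\<^esub>(th) = tb\<close>, and the
  first fact gives \<open>exp\<^sup>*(th) = \<E>\<^sub>\<succ>(tb) = \<Phi>\<^sub>t\<close>.  Both exponentials and \<open>W\<^sub>\<gamma>\<close> are injective on infinitesimal
  characters, because they are triangular with respect to word length, so \<open>th\<close> is the
  logarithm of \<open>\<Phi>\<^sub>t\<close> and \<open>h = P(\<Phi>, \<Phi>\<^sub>t)\<close>: the function \<open>h\<close> gives the \<open>t\<close>-monotone cumulants.  The second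
  formula follows from the first, since \<open>\<phi> = b \<bullet> \<phi>\<close>, every non-crossing partition
  consists of a first irreducible component and a non-crossing partition of the rest, and the
  weight \<open>t\<^bsup>inner\<^esup> / t(\<pi>)!\<close> is multiplicative in this decomposition.
\<close>

section \<open>Forest induction for families of non-crossing blocks\<close>

text \<open>
  The nesting forest is also needed for parts of a partition, whose blocks no longer cover an
  initial segment of the natural numbers.
\<close>

definition nc_family :: "nat set set \<Rightarrow> bool" where
  "nc_family \<pi> \<longleftrightarrow> finite \<pi> \<and> noncrossing \<pi> \<and> disjoint \<pi> \<and> (\<forall>V\<in>\<pi>. finite V \<and> V \<noteq> {})"

lemma noncrossingD:
  assumes "noncrossing \<pi>" "V \<in> \<pi>" "W \<in> \<pi>" "V \<noteq> W"
    "a \<in> V" "b \<in> W" "c \<in> V" "d \<in> W" "a < b" "b < c" "c < d"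
  shows False
  using assms unfolding noncrossing_def by metis

lemma nc_family_subset: "nc_family \<pi> \<Longrightarrow> \<sigma> \<subseteq> \<pi> \<Longrightarrow> nc_family \<sigma>"
  unfolding nc_family_def noncrossing_def
  by (meson disjoint_def finite_subset subsetD)

lemma NC_imp_nc_family:
  assumes "\<pi> \<in> NC n" shows "nc_family \<pi>"
proof -
  have p: "partition_on {..<n} \<pi>" and nc: "noncrossing \<pi>"
    using assms by (auto simp: NC_def)
  have "finite V" if "V \<in> \<pi>" for V
    using p that by (metis finite_lessThan finite_subset partition_onD1 Union_upper)
  then show ?thesis
    using nc p finite_elements[OF _ p] partition_onD2[OF p] partition_onD3[OF p]
    unfolding nc_family_def by auto
qed

lemma nests_irrefl [simp]: "\<not> nests V V"
  by (auto simp: nests_def)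

lemma nests_trans: "nests U V \<Longrightarrow> nests V W \<Longrightarrow> nests U W"
  unfolding nests_def by (meson less_trans)

lemma nests_iff_Min_Max:
  assumes "finite V" "V \<noteq> {}" "finite W" "W \<noteq> {}"
  shows "nests V W \<longleftrightarrow> Min V < Min W \<and> Max W < Max V"
proof
  assume "nests V W"
  then obtain a b where ab: "a \<in> V" "b \<in> V" "\<And>c. c \<in> W \<Longrightarrow> a < c \<and> c < b"
    by (auto simp: nests_def)
  have "Min W \<in> W" "Max W \<in> W" "Min V \<le> a" "b \<le> Max V"
    using assms ab by auto
  then show "Min V < Min W \<and> Max W < Max V"
    using ab(3) by (meson le_less_trans less_le_trans)
next
  assume *: "Min V < Min W \<and> Max W < Max V"
  have "Min V < c \<and> c < Max V" if "c \<in> W" for c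
    using * that assms by (meson Max_ge Min_le le_less_trans less_le_trans)
  moreover have "Min V \<in> V" "Max V \<in> V"
    using assms by auto
  ultimately show "nests V W"
    unfolding nests_def by blast
qed

text \<open>
  Convex hulls of blocks that overlap without being nested would produce a crossing of the four
  end points.
\<close>

lemma not_crossing_hulls:
  assumes "nc_family \<pi>" "V \<in> \<pi>" "W \<in> \<pi>" "Min V < Min W" "Min W < Max V"
  shows "nests V W"
proof -
  have ne: "V \<noteq> W" using assms by auto
  have fin: "finite V" "V \<noteq> {}" "finite W" "W \<noteq> {}" and nc: "noncrossing \<pi>"
    and disj: "V \<inter> W = {}"
    using assms ne unfolding nc_family_def disjoint_def by auto
  have mem: "Min V \<in> V" "Max V \<in> V" "Min W \<in> W" "Max W \<in> W"
    using fin by auto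
  have "\<not> Max V < Max W"
    using noncrossingD[OF nc assms(2,3) ne mem(1,3,2,4) assms(4,5)] by blast
  moreover have "Max V \<noteq> Max W"
    using disj mem by auto
  ultimately show ?thesis
    using nests_iff_Min_Max[OF fin] assms(4) by auto
qed

text \<open>
  The blocks above a given block form a chain; this is what makes nesting a forest.
\<close>

lemma nests_common_descendant:
  assumes "nc_family \<pi>" "U \<in> \<pi>" "V \<in> \<pi>" "W \<in> \<pi>" "nests U W" "nests V W"
  shows "U = V \<or> nests U V \<or> nests V U"
proof -
  have fin: "\<And>X. X \<in> \<pi> \<Longrightarrow> finite X \<and> X \<noteq> {}"
    using assms by (auto simp: nc_family_def)
  have U: "Min U < Min W" "Max W < Max U" and V: "Min V < Min W" "Max W < Max V"
    using nests_iff_Min_Max assms fin by blast+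
  have le: "Min W \<le> Max W" using fin assms by auto
  consider "Min U < Min V" | "Min V < Min U" | "Min U = Min V" by linarith
  then show ?thesis
  proof cases
    case 1 then show ?thesis
      using not_crossing_hulls[OF assms(1,2,3)] U V le by auto
  next
    case 2 then show ?thesis
      using not_crossing_hulls[OF assms(1,3,2)] U V le by auto
  next
    case 3
    have "Min U \<in> U \<inter> V"
      using 3 fin assms by (metis IntI Min_in)
    then show ?thesis
      using assms unfolding nc_family_def disjoint_def by blast
  qed
qed

text \<open>
  The induction principle for forests: a forest is empty, or a tree obtained by adding a root, or
  a union of two smaller forests.  A block with least minimum is outer, and its descendants can be
  separated from the other blocks.
\<close>

lemma nc_family_induct [consumes 1, case_names empty root union]:
  assumes "nc_family \<pi>" and "P {}"
    and root: "\<And>V \<sigma>. nc_family (insert V \<sigma>) \<Longrightarrow> V \<notin> \<sigma> \<Longrightarrow> \<forall>W\<in>\<sigma>. nests V W \<Longrightarrow>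
               P \<sigma> \<Longrightarrow> P (insert V \<sigma>)"
    and union: "\<And>\<sigma> \<tau>. nc_family (\<sigma> \<union> \<tau>) \<Longrightarrow> \<sigma> \<inter> \<tau> = {} \<Longrightarrow>
               \<forall>V\<in>\<sigma>. \<forall>W\<in>\<tau>. \<not> nests V W \<and> \<not> nests W V \<Longrightarrow> P \<sigma> \<Longrightarrow> P \<tau> \<Longrightarrow> P (\<sigma> \<union> \<tau>)"
  shows "P \<pi>"
  using assms(1)
proof (induction "card \<pi>" arbitrary: \<pi> rule: less_induct)
  case less
  have fin: "finite \<pi>" and bl: "\<And>X. X \<in> \<pi> \<Longrightarrow> finite X \<and> X \<noteq> {}"
    using less.prems by (auto simp: nc_family_def)
  show ?case
  proof (cases "\<pi> = {}")
    case True then show ?thesis using assms(2) by simp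
  next
    case False
    \<comment> \<open>Nothing can surround the block whose first element is the least of all.\<close>
    define m where "m = Min (Min ` \<pi>)"
    have "m \<in> Min ` \<pi>" using fin False by (auto simp: m_def)
    then obtain V where V: "V \<in> \<pi>" "Min V = m" by auto
    have outer: "\<not> nests W V" if "W \<in> \<pi>" for W
    proof -
      have "m \<le> Min W" using fin that by (auto simp: m_def)
      then show ?thesis
        using V nests_iff_Min_Max[of W V] bl that by (metis not_le)
    qed
    define \<sigma> where "\<sigma> = {W\<in>\<pi>. nests V W}"
    define \<tau> where "\<tau> = \<pi> - insert V \<sigma>"
    have dec: "\<pi> = insert V \<sigma> \<union> \<tau>" "insert V \<sigma> \<inter> \<tau> = {}" "V \<notin> \<sigma>"
      using V by (auto simp: \<sigma>_def \<tau>_def)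
    show ?thesis
    proof (cases "\<tau> = {}")
      case True
      then have eq: "\<pi> = insert V \<sigma>" using dec by simp
      have "card \<sigma> < card \<pi>"
        using eq dec(3) fin by (metis card_insert_disjoint finite_insert lessI)
      then have "P \<sigma>"
        using less.hyps nc_family_subset[OF less.prems, of \<sigma>] eq by blast
      then show ?thesis
        using root less.prems dec(3) unfolding eq by (simp add: \<sigma>_def)
    next
      case False
      have sub: "insert V \<sigma> \<subset> \<pi>" "\<tau> \<subset> \<pi>"
        using dec False V by auto
      have "\<not> nests X W \<and> \<not> nests W X" if X: "X \<in> insert V \<sigma>" and W: "W \<in> \<tau>" for X W
      proof -
        have nV: "\<not> nests V W" "W \<noteq> V" "W \<in> \<pi>" using W by (auto simp: \<tau>_def \<sigma>_def)
        show ?thesis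
        proof (cases "X = V")
          case True then show ?thesis using nV outer by auto
        next
          case False
          then have VX: "nests V X" "X \<in> \<pi>" using X by (auto simp: \<sigma>_def)
          then show ?thesis
            using nV nests_trans outer nests_common_descendant[OF less.prems, of V W X] V by blast
        qed
      qed
      moreover have "P (insert V \<sigma>)" "P \<tau>"
        using less.hyps sub fin nc_family_subset[OF less.prems]
        by (meson psubset_card_mono psubset_imp_subset)+
      ultimately have "P (insert V \<sigma> \<union> \<tau>)"
        using union[OF _ dec(2)] less.prems unfolding dec(1)[symmetric] by blast
      then show ?thesis using dec(1) by simp
    qed
  qed
qed

section \<open>The hook recursion for forest factorials\<close>

abbreviation forest_fact :: "nat set set \<Rightarrow> nat" where
  "forest_fact \<pi> \<equiv> forest_factorial (nesting_forest \<pi>)"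

lemma nesting_forest_empty [simp]: "nesting_forest {} = {#}"
  by (subst nesting_forest.simps) (simp add: outer_blocks_def)

lemma nesting_forest_root:
  assumes "finite \<sigma>" "V \<notin> \<sigma>" "\<forall>W\<in>\<sigma>. nests V W"
  shows "nesting_forest (insert V \<sigma>) = {#Node V (nesting_forest \<sigma>)#}"
proof -
  have "\<not> nests W V" if "W \<in> \<sigma>" for W
    using assms that nests_trans nests_irrefl by blast
  then have "outer_blocks (insert V \<sigma>) = {V}"
    using assms by (auto simp: outer_blocks_def)
  moreover have "{W \<in> insert V \<sigma>. nests V W} = \<sigma>"
    using assms by auto
  ultimately show ?thesis
    using assms by (subst nesting_forest.simps) simp
qed

lemma outer_blocks_Un:
  assumes "\<forall>V\<in>\<sigma>. \<forall>W\<in>\<tau>. \<not> nests V W \<and> \<not> nests W V"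
  shows "outer_blocks (\<sigma> \<union> \<tau>) = outer_blocks \<sigma> \<union> outer_blocks \<tau>"
  using assms by (auto simp: outer_blocks_def)

lemma nesting_forest_Un:
  assumes "finite \<sigma>" "finite \<tau>" "\<sigma> \<inter> \<tau> = {}"
    and "\<forall>V\<in>\<sigma>. \<forall>W\<in>\<tau>. \<not> nests V W \<and> \<not> nests W V"
  shows "nesting_forest (\<sigma> \<union> \<tau>) = nesting_forest \<sigma> + nesting_forest \<tau>"
proof -
  let ?T = "\<lambda>\<pi> V. Node V (nesting_forest {W \<in> \<pi>. nests V W})"
  have fin: "finite (outer_blocks \<sigma>)" "finite (outer_blocks \<tau>)"
    and disj: "outer_blocks \<sigma> \<inter> outer_blocks \<tau> = {}"
    using assms by (auto simp: outer_blocks_def)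
  have s: "{W \<in> \<sigma> \<union> \<tau>. nests V W} = {W \<in> \<sigma>. nests V W}" if "V \<in> outer_blocks \<sigma>" for V
    using that assms by (auto simp: outer_blocks_def)
  have t: "{W \<in> \<sigma> \<union> \<tau>. nests V W} = {W \<in> \<tau>. nests V W}" if "V \<in> outer_blocks \<tau>" for V
    using that assms by (auto simp: outer_blocks_def)
  have "nesting_forest (\<sigma> \<union> \<tau>) = image_mset (?T (\<sigma> \<union> \<tau>))
      (mset_set (outer_blocks \<sigma>) + mset_set (outer_blocks \<tau>))"
    using assms mset_set_Union[OF fin disj] outer_blocks_Un[OF assms(4)]
    by (subst nesting_forest.simps) simp
  also have "\<dots> = image_mset (?T \<sigma>) (mset_set (outer_blocks \<sigma>)) +
      image_mset (?T \<tau>) (mset_set (outer_blocks \<tau>))"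
    unfolding image_mset_union
    using fin by (intro arg_cong2[where f="(+)"] image_mset_cong) (simp_all only: s t finite_set_mset_mset_set)
  also have "\<dots> = nesting_forest \<sigma> + nesting_forest \<tau>"
    using assms by (simp add: nesting_forest.simps[of \<sigma>] nesting_forest.simps[of \<tau>])
  finally show ?thesis .
qed

lemma sum_num_vertices_nesting_forest:
  assumes "nc_family \<pi>"
  shows "(\<Sum>\<^sub># (image_mset num_vertices (nesting_forest \<pi>))) = card \<pi>"
  using assms
proof (induction rule: nc_family_induct)
  case (root V \<sigma>)
  then have "finite \<sigma>" by (auto simp: nc_family_def)
  then show ?case using root by (simp add: nesting_forest_root)
next
  case (union \<sigma> \<tau>)
  then have "finite \<sigma>" "finite \<tau>" by (auto simp: nc_family_def)
  then show ?case using union by (simp add: nesting_forest_Un card_Un_disjoint)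
qed simp

lemma forest_factorial_empty [simp]: "forest_factorial {#} = 1"
  by (simp add: forest_factorial_def)

text \<open>
  Together with multiplicativity over unions, this computes the forest factorial along forest
  induction, without mention of the multisets of trees.
\<close>

lemma forest_fact_root:
  assumes "nc_family (insert V \<sigma>)" "V \<notin> \<sigma>" "\<forall>W\<in>\<sigma>. nests V W"
  shows "forest_fact (insert V \<sigma>) = Suc (card \<sigma>) * forest_fact \<sigma>"
proof -
  have "finite \<sigma>" "nc_family \<sigma>"
    using assms nc_family_subset[OF assms(1), of \<sigma>] by (auto simp: nc_family_def)
  then show ?thesis
    using assms by (simp add: nesting_forest_root forest_factorial_def sum_num_vertices_nesting_forest)
qed

lemma forest_fact_Un:
  assumes "finite \<sigma>" "finite \<tau>" "\<sigma> \<inter> \<tau> = {}"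
    and "\<forall>V\<in>\<sigma>. \<forall>W\<in>\<tau>. \<not> nests V W \<and> \<not> nests W V"
  shows "forest_fact (\<sigma> \<union> \<tau>) = forest_fact \<sigma> * forest_fact \<tau>"
  using nesting_forest_Un[OF assms] by (simp add: forest_factorial_def)

lemma forest_fact_singleton [simp]: "finite V \<Longrightarrow> V \<noteq> {} \<Longrightarrow> forest_fact {V} = 1"
  using nesting_forest_root[of "{}" V] by (simp add: forest_factorial_def)

definition leaf_blocks :: "nat set set \<Rightarrow> nat set set" where
  "leaf_blocks \<pi> = {U \<in> \<pi>. \<not> (\<exists>W\<in>\<pi>. nests U W)}"

text \<open>
  With \<open>n = |\<pi>|\<close>, the number \<open>n! / t(\<pi>)!\<close> counts the orders in which the blocks can be
  listed with every block after its ancestors, and the last block of such a list is a leaf; hence the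
  identity.  It also follows directly by forest induction.  Adding a root over \<open>\<sigma> \<noteq> {}\<close> divides the left-hand
  side by \<open>|\<sigma>|\<close>, because each \<open>\<sigma> - {U}\<close> acquires a root of a tree with \<open>|\<sigma>|\<close> vertices;
  for a union, both sides satisfy the product rule.
\<close>

lemma hook_recursion:
  assumes "nc_family \<pi>"
  shows "(\<Sum>U\<in>leaf_blocks \<pi>. 1 / of_nat (forest_fact (\<pi> - {U}))) =
          (of_nat (card \<pi>) / of_nat (forest_fact \<pi>) :: complex) \<and> forest_fact \<pi> \<noteq> 0"
  using assms
proof (induction rule: nc_family_induct)
  case empty
  show ?case by (simp add: leaf_blocks_def)
next
  case (root V \<sigma>)
  note fam = nc_family_subset[OF root(1)]
  have fin: "finite \<sigma>" "finite V" "V \<noteq> {}" using root by (auto simp: nc_family_def)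
  have ff: "forest_fact (insert V \<sigma>) = Suc (card \<sigma>) * forest_fact \<sigma>"
    using forest_fact_root root by blast
  show ?case
  proof (cases "\<sigma> = {}")
    case True
    have "leaf_blocks {V} = {V}" by (auto simp: leaf_blocks_def)
    then show ?thesis using True fin by simp
  next
    case False
    have "\<not> nests W V" if "W \<in> \<sigma>" for W
      using root that nests_trans nests_irrefl by blast
    then have lv: "leaf_blocks (insert V \<sigma>) = leaf_blocks \<sigma>"
      using False root(3) by (auto simp: leaf_blocks_def)
    have "forest_fact (insert V \<sigma> - {U}) = card \<sigma> * forest_fact (\<sigma> - {U})"
      if "U \<in> leaf_blocks \<sigma>" for U
    proof -
      have U: "U \<in> \<sigma>" "U \<noteq> V" using that root by (auto simp: leaf_blocks_def)
      then have "insert V \<sigma> - {U} = insert V (\<sigma> - {U})" by auto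
      moreover have "Suc (card (\<sigma> - {U})) = card \<sigma>"
        using U fin by (meson card_Suc_Diff1)
      ultimately show ?thesis
        using forest_fact_root[of V "\<sigma> - {U}"] root fam[of "insert V (\<sigma> - {U})"] by auto
    qed
    then have "(\<Sum>U\<in>leaf_blocks (insert V \<sigma>). 1 / of_nat (forest_fact (insert V \<sigma> - {U})))
      = (1 / of_nat (card \<sigma>)) * (\<Sum>U\<in>leaf_blocks \<sigma>. 1 / of_nat (forest_fact (\<sigma> - {U})) :: complex)"
      unfolding lv sum_distrib_left by (intro sum.cong) auto
    also have "\<dots> = of_nat (card (insert V \<sigma>)) / of_nat (forest_fact (insert V \<sigma>))"
      using root.IH ff root(2) fin False by (simp del: of_nat_Suc mult_Suc)
    finally show ?thesis using ff root.IH by simp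
  qed
next
  case (union \<sigma> \<tau>)
  have fin: "finite \<sigma>" "finite \<tau>" using union by (auto simp: nc_family_def)
  have ff: "forest_fact (\<sigma>' \<union> \<tau>') = forest_fact \<sigma>' * forest_fact \<tau>'"
    if "\<sigma>' \<subseteq> \<sigma>" "\<tau>' \<subseteq> \<tau>" for \<sigma>' \<tau>'
    by (rule forest_fact_Un) (use that fin union finite_subset in blast)+
  have lv: "leaf_blocks (\<sigma> \<union> \<tau>) = leaf_blocks \<sigma> \<union> leaf_blocks \<tau>"
    "leaf_blocks \<sigma> \<inter> leaf_blocks \<tau> = {}" "finite (leaf_blocks \<sigma>)" "finite (leaf_blocks \<tau>)"
    using union fin by (auto simp: leaf_blocks_def)
  have s: "\<sigma> \<union> \<tau> - {U} = (\<sigma> - {U}) \<union> \<tau>" if "U \<in> leaf_blocks \<sigma>" for U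
    using that union by (auto simp: leaf_blocks_def)
  have t: "\<sigma> \<union> \<tau> - {U} = \<sigma> \<union> (\<tau> - {U})" if "U \<in> leaf_blocks \<tau>" for U
    using that union by (auto simp: leaf_blocks_def)
  have "(\<Sum>U\<in>leaf_blocks (\<sigma> \<union> \<tau>). 1 / of_nat (forest_fact (\<sigma> \<union> \<tau> - {U}))) =
     (\<Sum>U\<in>leaf_blocks \<sigma>. 1 / of_nat (forest_fact (\<sigma> - {U}))) / of_nat (forest_fact \<tau>) +
     (\<Sum>U\<in>leaf_blocks \<tau>. 1 / of_nat (forest_fact (\<tau> - {U}))) / (of_nat (forest_fact \<sigma>) :: complex)"
    using lv by (simp add: sum.union_disjoint sum_divide_distrib s t ff mult.commute)
  also have "\<dots> = of_nat (card (\<sigma> \<union> \<tau>)) / of_nat (forest_fact (\<sigma> \<union> \<tau>))"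
    using union.IH ff[of \<sigma> \<tau>] union(2) fin by (simp add: card_Un_disjoint field_simps)
  finally show ?case using ff[of \<sigma> \<tau>] union.IH by simp
qed

section \<open>Transport along monotone maps\<close>

lemma nests_image_strict_mono:
  assumes "strict_mono e"
  shows "nests (e ` V) (e ` W) \<longleftrightarrow> nests V W"
  using assms by (auto simp: nests_def strict_mono_less)

lemma inj_image_strict_mono: "strict_mono (e::nat \<Rightarrow> nat) \<Longrightarrow> inj_on ((`) e) A"
  by (meson inj_image_eq_iff inj_onI strict_mono_imp_inj_on)

lemma noncrossing_image_strict_mono:
  assumes "strict_mono e"
  shows "noncrossing ((`) e ` \<pi>) \<longleftrightarrow> noncrossing \<pi>"
  using assms strict_mono_imp_inj_on[OF assms]
  by (auto simp: noncrossing_def strict_mono_less inj_image_eq_iff)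

lemma nc_family_image_strict_mono:
  assumes "strict_mono e" "nc_family \<pi>"
  shows "nc_family ((`) e ` \<pi>)"
proof -
  have inj: "inj e" using assms strict_mono_imp_inj_on by blast
  show ?thesis
    using assms noncrossing_image_strict_mono[OF assms(1)] inj
    unfolding nc_family_def disjoint_def by (auto simp: image_Int[symmetric] inj_image_eq_iff)
qed

lemma forest_fact_image_strict_mono:
  assumes "strict_mono e" "nc_family \<pi>"
  shows "forest_fact ((`) e ` \<pi>) = forest_fact \<pi>"
  using assms(2)
proof (induction rule: nc_family_induct)
  case (root V \<sigma>)
  have "e ` V \<notin> (`) e ` \<sigma>"
    using root inj_image_strict_mono[OF assms(1), of UNIV] by (auto dest: inj_onD)
  moreover have "card ((`) e ` \<sigma>) = card \<sigma>"
    using inj_image_strict_mono[OF assms(1)] by (rule card_image)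
  ultimately show ?case
    using root forest_fact_root[of "e ` V" "(`) e ` \<sigma>"] forest_fact_root[of V \<sigma>]
      nc_family_image_strict_mono[OF assms(1) root(1)]
    by (simp add: nests_image_strict_mono[OF assms(1)])
next
  case (union \<sigma> \<tau>)
  have fin: "finite \<sigma>" "finite \<tau>" using union by (auto simp: nc_family_def)
  have "(`) e ` \<sigma> \<inter> (`) e ` \<tau> = {}"
    using union(2) inj_image_strict_mono[OF assms(1), of UNIV] by (auto dest: inj_onD)
  then show ?case
    using union fin
    by (simp add: image_Un forest_fact_Un nests_image_strict_mono[OF assms(1)])
qed simp

lemma inner_blocks_image_strict_mono:
  assumes "strict_mono e"
  shows "card (inner_blocks ((`) e ` \<pi>)) = card (inner_blocks \<pi>)"
proof -
  have "inner_blocks ((`) e ` \<pi>) = (`) e ` inner_blocks \<pi>"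
    by (auto simp: inner_blocks_def outer_blocks_def nests_image_strict_mono[OF assms])
  then show ?thesis
    using card_image[OF inj_image_strict_mono[OF assms]] by simp
qed

text \<open>
  \<open>expand i j\<close> makes room for the interval \<open>{i..<j}\<close>, and \<open>collapse i j\<close> closes the gap again.
  The case \<open>i = 0\<close> is a shift by \<open>j\<close>, so the two maps serve both for removing an inner
  block and for splitting off an initial segment.
\<close>

definition expand :: "nat \<Rightarrow> nat \<Rightarrow> nat \<Rightarrow> nat" where
  "expand i j x = (if x < i then x else x + (j - i))"

definition collapse :: "nat \<Rightarrow> nat \<Rightarrow> nat \<Rightarrow> nat" where
  "collapse i j x = (if x < i then x else x - (j - i))"

abbreviation expand_blocks :: "nat \<Rightarrow> nat \<Rightarrow> nat set set \<Rightarrow> nat set set" where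
  "expand_blocks i j \<sigma> \<equiv> (`) (expand i j) ` \<sigma>"

abbreviation collapse_blocks :: "nat \<Rightarrow> nat \<Rightarrow> nat set set \<Rightarrow> nat set set" where
  "collapse_blocks i j \<sigma> \<equiv> (`) (collapse i j) ` \<sigma>"

lemma strict_mono_expand: "strict_mono (expand i j)"
  by (auto simp: strict_mono_def expand_def)

lemma collapse_expand [simp]: "i \<le> j \<Longrightarrow> collapse i j (expand i j x) = x"
  by (auto simp: collapse_def expand_def)

lemma expand_collapse: "i \<le> j \<Longrightarrow> x \<notin> {i..<j} \<Longrightarrow> expand i j (collapse i j x) = x"
  by (auto simp: collapse_def expand_def)

lemma expand_notin_gap: "expand i j x \<notin> {i..<j}"
  by (auto simp: expand_def)

lemma image_expand_lessThan:
  assumes "i \<le> j" "j \<le> m"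
  shows "expand i j ` {..<m - (j - i)} = {..<m} - {i..<j}"
proof (intro equalityI subsetI)
  fix x assume "x \<in> {..<m} - {i..<j}"
  then have "expand i j (collapse i j x) = x" "collapse i j x \<in> {..<m - (j - i)}"
    using assms by (auto simp: collapse_def expand_def)
  then show "x \<in> expand i j ` {..<m - (j - i)}"
    by (metis imageI)
qed (use assms in \<open>auto simp: expand_def split: if_splits\<close>)

lemma image_collapse_compl:
  assumes "i \<le> j" "j \<le> m"
  shows "collapse i j ` ({..<m} - {i..<j}) = {..<m - (j - i)}"
  using assms by (simp add: image_expand_lessThan[symmetric] image_image)

lemma collapse_expand_blocks [simp]:
  "i \<le> j \<Longrightarrow> collapse_blocks i j (expand_blocks i j \<sigma>) = \<sigma>"
  by (simp add: image_image)

lemma expand_collapse_blocks: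
  assumes "i \<le> j" "\<And>V. V \<in> \<sigma> \<Longrightarrow> V \<inter> {i..<j} = {}"
  shows "expand_blocks i j (collapse_blocks i j \<sigma>) = \<sigma>"
proof -
  have "expand i j ` collapse i j ` V = V" if "V \<in> \<sigma>" for V
    using assms(2)[OF that] expand_collapse[OF assms(1)] by (force simp: image_image)
  then show ?thesis by (auto simp: image_image)
qed

lemma partition_on_expand_blocks:
  assumes "partition_on {..<m - (j - i)} \<sigma>" "i \<le> j" "j \<le> m"
  shows "partition_on ({..<m} - {i..<j}) (expand_blocks i j \<sigma>)"
proof -
  have "inj_on (expand i j) {..<m - (j - i)}"
    using strict_mono_expand strict_mono_imp_inj_on by (metis inj_on_subset subset_UNIV)
  from partition_on_inj_image[OF assms(1) this]
  have "partition_on ({..<m} - {i..<j}) (expand_blocks i j \<sigma> - {{}})"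
    unfolding image_expand_lessThan[OF assms(2,3)] .
  moreover have "{} \<notin> expand_blocks i j \<sigma>"
    using partition_onD3[OF assms(1)] by auto
  ultimately show ?thesis by simp
qed

lemma partition_on_collapse_blocks:
  assumes "partition_on ({..<m} - {i..<j}) \<sigma>" "i \<le> j" "j \<le> m"
  shows "partition_on {..<m - (j - i)} (collapse_blocks i j \<sigma>)"
proof -
  have "inj_on (collapse i j) ({..<m} - {i..<j})"
    by (rule inj_on_inverseI[of _ "expand i j"]) (use expand_collapse[OF assms(2)] in auto)
  from partition_on_inj_image[OF assms(1) this]
  have "partition_on {..<m - (j - i)} (collapse_blocks i j \<sigma> - {{}})"
    unfolding image_collapse_compl[OF assms(2,3)] .
  moreover have "{} \<notin> collapse_blocks i j \<sigma>"
    using partition_onD3[OF assms(1)] by auto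
  ultimately show ?thesis by simp
qed

lemma noncrossing_collapse_blocks:
  assumes "noncrossing \<sigma>" "i \<le> j" "\<And>V. V \<in> \<sigma> \<Longrightarrow> V \<inter> {i..<j} = {}"
  shows "noncrossing (collapse_blocks i j \<sigma>)"
proof -
  have "expand_blocks i j (collapse_blocks i j \<sigma>) = \<sigma>"
    by (rule expand_collapse_blocks) (use assms in auto)
  then have "noncrossing (expand_blocks i j (collapse_blocks i j \<sigma>))"
    using assms(1) by simp
  then show ?thesis
    unfolding noncrossing_image_strict_mono[OF strict_mono_expand] .
qed

lemma noncrossing_subset: "noncrossing \<pi> \<Longrightarrow> \<sigma> \<subseteq> \<pi> \<Longrightarrow> noncrossing \<sigma>"
  unfolding noncrossing_def by (meson subsetD)

lemma finite_NC: "finite (NC n)"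
proof (rule finite_subset)
  show "NC n \<subseteq> Pow (Pow {..<n})"
    by (auto simp: NC_def partition_on_def)
qed simp

lemma finite_NC_irr [simp]: "finite (NC_irr n)"
  using finite_NC by (auto simp: NC_irr_def)

lemma NC_irr_imp_NC: "\<pi> \<in> NC_irr n \<Longrightarrow> \<pi> \<in> NC n"
  by (auto simp: NC_irr_def)

lemma NC_disjoint: "\<pi> \<in> NC n \<Longrightarrow> V \<in> \<pi> \<Longrightarrow> W \<in> \<pi> \<Longrightarrow> x \<in> V \<Longrightarrow> x \<in> W \<Longrightarrow> V = W"
  by (auto simp: NC_def partition_on_def disjoint_def)

lemma NC_block: "\<pi> \<in> NC n \<Longrightarrow> V \<in> \<pi> \<Longrightarrow> V \<subseteq> {..<n} \<and> V \<noteq> {} \<and> finite V"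
  by (auto simp: NC_def partition_on_def intro: finite_subset[of _ "{..<n}"])

lemma NC_cover: "\<pi> \<in> NC n \<Longrightarrow> x < n \<Longrightarrow> \<exists>V\<in>\<pi>. x \<in> V"
  by (auto simp: NC_def partition_on_def)

lemma NC_0 [simp]: "NC 0 = {{}}"
  by (auto simp: NC_def partition_on_empty noncrossing_def)

lemma single_block_NC_irr: "0 < n \<Longrightarrow> {{..<n}} \<in> NC_irr n"
  by (auto simp: NC_irr_def NC_def noncrossing_def partition_on_space lessThan_empty_iff)

section \<open>Removing a leaf from an irreducible partition\<close>

lemma insert_interval_NC:
  assumes "\<sigma> \<in> NC (m - (j - i))" "i < j" "j \<le> m"
  shows "insert {i..<j} (expand_blocks i j \<sigma>) \<in> NC m" and "{i..<j} \<notin> expand_blocks i j \<sigma>"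
proof -
  have p: "partition_on ({..<m} - {i..<j}) (expand_blocks i j \<sigma>)"
    and nc: "noncrossing (expand_blocks i j \<sigma>)"
    using assms partition_on_expand_blocks noncrossing_image_strict_mono[OF strict_mono_expand]
    by (auto simp: NC_def)
  have disj: "disjnt {i..<j} (\<Union>(expand_blocks i j \<sigma>))"
    using partition_onD1[OF p] by (auto simp: disjnt_def)
  show "{i..<j} \<notin> expand_blocks i j \<sigma>"
  proof
    assume "{i..<j} \<in> expand_blocks i j \<sigma>"
    then have "i \<in> \<Union>(expand_blocks i j \<sigma>)"
      using assms(2) by (intro UnionI[of "{i..<j}"]) simp_all
    then show False
      using disj assms(2) by (auto simp: disjnt_iff)
  qed
  have out: "x \<notin> {i..<j}" if "V \<in> expand_blocks i j \<sigma>" "x \<in> V" for V x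
    using disj UnionI[OF that] unfolding disjnt_def by blast
  have "partition_on {..<m} (insert {i..<j} (expand_blocks i j \<sigma>))"
    using partition_on_insert[OF disj] p assms by auto
  moreover have "noncrossing (insert {i..<j} (expand_blocks i j \<sigma>))"
    unfolding noncrossing_def
  proof (intro ballI impI notI)
    fix V W
    assume V: "V \<in> insert {i..<j} (expand_blocks i j \<sigma>)"
      and W: "W \<in> insert {i..<j} (expand_blocks i j \<sigma>)" and "V \<noteq> W"
      and "\<exists>a\<in>V. \<exists>b\<in>W. \<exists>c\<in>V. \<exists>d\<in>W. a < b \<and> b < c \<and> c < d"
    then obtain a b c d where *: "a \<in> V" "b \<in> W" "c \<in> V" "d \<in> W" "a < b" "b < c" "c < d"
      by blast
    consider "V = {i..<j}" "W \<in> expand_blocks i j \<sigma>" | "W = {i..<j}" "V \<in> expand_blocks i j \<sigma>"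
      | "V \<in> expand_blocks i j \<sigma>" "W \<in> expand_blocks i j \<sigma>"
      using V W \<open>V \<noteq> W\<close> by blast
    then show False
    proof cases
      case 1 then show False using out[of W b] * by auto
    next
      case 2 then show False using out[of V c] * by auto
    next
      case 3 then show False using noncrossingD[OF nc _ _ \<open>V \<noteq> W\<close> *] by blast
    qed
  qed
  ultimately show "insert {i..<j} (expand_blocks i j \<sigma>) \<in> NC m"
    by (simp add: NC_def)
qed

lemma remove_interval_NC:
  assumes "\<pi> \<in> NC m" "{i..<j} \<in> \<pi>" "i < j"
  shows "collapse_blocks i j (\<pi> - {{i..<j}}) \<in> NC (m - (j - i))"
    and "expand_blocks i j (collapse_blocks i j (\<pi> - {{i..<j}})) = \<pi> - {{i..<j}}"
    and "j \<le> m"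
proof -
  have "j - 1 \<in> {i..<j}" using assms(3) by auto
  then have "j - 1 < m" using NC_block[OF assms(1,2)] by blast
  then show jm: "j \<le> m" by simp
  have ij: "i \<le> j" using assms(3) by simp
  have out: "V \<inter> {i..<j} = {}" if "V \<in> \<pi> - {{i..<j}}" for V
    using NC_disjoint[OF assms(1) _ assms(2), of V] that by blast
  show "expand_blocks i j (collapse_blocks i j (\<pi> - {{i..<j}})) = \<pi> - {{i..<j}}"
    by (rule expand_collapse_blocks[OF ij out])
  have "disjnt {i..<j} (\<Union>(\<pi> - {{i..<j}}))"
    using out unfolding disjnt_def by blast
  from partition_on_insert[OF this, of "{..<m}"]
  have "partition_on ({..<m} - {i..<j}) (\<pi> - {{i..<j}})"
    using assms by (simp add: NC_def insert_absorb)
  moreover have "noncrossing (\<pi> - {{i..<j}})"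
    using assms noncrossing_subset by (auto simp: NC_def)
  ultimately show "collapse_blocks i j (\<pi> - {{i..<j}}) \<in> NC (m - (j - i))"
    using partition_on_collapse_blocks[OF _ ij jm] noncrossing_collapse_blocks[OF _ ij out]
    unfolding NC_def by blast
qed

lemma NC_irr_root:
  assumes "\<pi> \<in> NC n" "V \<in> \<pi>" "0 \<in> V" "n - 1 \<in> V" "W \<in> \<pi>" "W \<noteq> V"
  shows "nests V W"
proof -
  have "0 < c \<and> c < n - 1" if "c \<in> W" for c
  proof -
    have "c < n" using NC_block[OF assms(1,5)] that by auto
    moreover have "c \<noteq> 0" "c \<noteq> n - 1"
      using NC_disjoint[OF assms(1,2,5)] assms that by metis+
    ultimately show ?thesis by linarith
  qed
  then show ?thesis using assms unfolding nests_def by blast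
qed

text \<open>
  A block \<open>W\<close> meeting the convex hull of \<open>U\<close> outside \<open>U\<close> would be nested in \<open>U\<close>, as it may not
  cross \<open>U\<close>.
\<close>

lemma leaf_block_interval:
  assumes "\<pi> \<in> NC n" "U \<in> leaf_blocks \<pi>"
  shows "U = {Min U..<Suc (Max U)}"
proof -
  have U: "U \<in> \<pi>" and leaf: "\<And>W. W \<in> \<pi> \<Longrightarrow> \<not> nests U W"
    using assms by (auto simp: leaf_blocks_def)
  have fin: "finite U" "U \<noteq> {}" "U \<subseteq> {..<n}"
    using NC_block[OF assms(1) U] by auto
  then have mem: "Min U \<in> U" "Max U \<in> U" by auto
  have "c \<in> U" if c: "Min U < c" "c < Max U" for c
  proof (rule ccontr)
    assume "c \<notin> U"
    moreover obtain W where W: "W \<in> \<pi>" "c \<in> W"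
      using NC_cover[OF assms(1), of c] c(2) mem(2) fin(3) by (meson lessThan_iff less_trans subsetD)
    ultimately have ne: "U \<noteq> W" by auto
    have nc: "noncrossing \<pi>" using assms by (auto simp: NC_def)
    have "Min U < d \<and> d < Max U" if "d \<in> W" for d
    proof -
      have "d \<noteq> Min U" "d \<noteq> Max U"
        using NC_disjoint[OF assms(1) U W(1)] mem that ne by auto
      moreover have "\<not> d < Min U" "\<not> Max U < d"
        using noncrossingD[OF nc W(1) U ne[symmetric] that mem(1) W(2) mem(2)]
        noncrossingD[OF nc U W(1) ne mem(1) W(2) mem(2) that] c by blast+
      ultimately show ?thesis by linarith
    qed
    then show False
      using leaf[OF W(1)] mem unfolding nests_def by blast
  qed
  moreover have "Min U \<le> c \<and> c \<le> Max U" if "c \<in> U" for c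
    using that fin by simp
  ultimately show ?thesis
    using mem by (auto simp: less_Suc_eq_le) (metis le_neq_implies_less)
qed

text \<open>
  Half-open intervals \<open>{i..<j}\<close> of positions that avoid the first and the last position.
\<close>

definition inner_cuts :: "nat \<Rightarrow> (nat \<times> nat) set" where
  "inner_cuts n = {(i, j). 1 \<le> i \<and> i < j \<and> j < n}"

lemma finite_inner_cuts [simp]: "finite (inner_cuts n)"
  by (rule finite_subset[of _ "{..<n} \<times> {..<n}"]) (auto simp: inner_cuts_def)

text \<open>
  In an irreducible partition with at least two blocks, the block containing both end
  points is not a leaf, so a leaf is an interval avoiding both end points.  Removing it
  leaves an irreducible partition of the remaining positions, and every interval
  avoiding the end points can be added as a leaf.
\<close>

lemma leaf_removal:
  fixes F :: "nat set set \<Rightarrow> nat set \<Rightarrow> 'c::comm_monoid_add"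
  shows "(\<Sum>\<pi>\<in>{\<pi>\<in>NC_irr n. card \<pi> = Suc (Suc m)}. \<Sum>U\<in>leaf_blocks \<pi>. F \<pi> U) =
    (\<Sum>(i,j)\<in>inner_cuts n. \<Sum>\<sigma>\<in>{\<sigma>\<in>NC_irr (n - (j - i)). card \<sigma> = Suc m}.
        F (insert {i..<j} (expand_blocks i j \<sigma>)) {i..<j})"
proof -
  let ?P = "{\<pi>\<in>NC_irr n. card \<pi> = Suc (Suc m)}"
  let ?Q = "\<lambda>(i,j). {\<sigma>\<in>NC_irr (n - (j - i)). card \<sigma> = Suc m}"
  have fin: "finite (leaf_blocks \<pi>)" if "\<pi> \<in> ?P" for \<pi>
    using that finite_subset[of "leaf_blocks \<pi>" \<pi>] card_ge_0_finite[of \<pi>]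
    by (auto simp: leaf_blocks_def)
  have "(\<Sum>\<pi>\<in>?P. \<Sum>U\<in>leaf_blocks \<pi>. F \<pi> U) = (\<Sum>(\<pi>,U)\<in>Sigma ?P leaf_blocks. F \<pi> U)"
    by (rule sum.Sigma) (use fin in auto)
  also have "\<dots> = (\<Sum>(p,\<sigma>)\<in>Sigma (inner_cuts n) ?Q.
      F (insert {fst p..<snd p} (expand_blocks (fst p) (snd p) \<sigma>)) {fst p..<snd p})"
  proof (rule sum.reindex_bij_witness[where
      j = "\<lambda>(\<pi>,U). ((Min U, Suc (Max U)), collapse_blocks (Min U) (Suc (Max U)) (\<pi> - {U}))" and
      i = "\<lambda>((i,j),\<sigma>). (insert {i..<j} (expand_blocks i j \<sigma>), {i..<j})"])
    fix a assume "a \<in> Sigma ?P leaf_blocks"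
    then obtain \<pi> U where a: "a = (\<pi>,U)" and \<pi>: "\<pi> \<in> NC_irr n" "card \<pi> = Suc (Suc m)"
      and U: "U \<in> leaf_blocks \<pi>" by auto
    define i j where "i = Min U" and "j = Suc (Max U)"
    have nc: "\<pi> \<in> NC n" using \<pi>(1) by (rule NC_irr_imp_NC)
    have U\<pi>: "U \<in> \<pi>" using U by (auto simp: leaf_blocks_def)
    have fU: "finite U" "U \<noteq> {}" using NC_block[OF nc U\<pi>] by auto
    have Ueq: "U = {i..<j}" using leaf_block_interval[OF nc U] by (simp add: i_def j_def)
    have ij: "i < j" using fU by (simp add: i_def j_def less_Suc_eq_le)
    note rem = remove_interval_NC[OF nc U\<pi>[unfolded Ueq] ij]
    obtain V where V: "V \<in> \<pi>" "0 \<in> V" "n - 1 \<in> V" using \<pi> by (auto simp: NC_irr_def)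
    have "\<exists>W\<in>\<pi>. W \<noteq> V"
    proof (rule ccontr)
      assume "\<not> ?thesis"
      then have "\<pi> = {V}" using V(1) by blast
      then show False using \<pi>(2) by simp
    qed
    then have VU: "V \<noteq> U"
      using NC_irr_root[OF nc V] U by (auto simp: leaf_blocks_def)
    then have no: "0 \<notin> {i..<j}" "n - 1 \<notin> {i..<j}"
      using NC_disjoint[OF nc V(1) U\<pi>] V Ueq by auto
    then have cut: "(i, j) \<in> inner_cuts n"
      using ij rem(3) by (auto simp: inner_cuts_def)
    have "card (collapse_blocks i j (\<pi> - {U})) = card (\<pi> - {U})"
      using rem(2) card_image[OF inj_image_strict_mono[OF strict_mono_expand],
          of i j "collapse_blocks i j (\<pi> - {U})"] Ueq by simp
    also have "\<dots> = Suc m"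
      using U\<pi> \<pi>(2) card_ge_0_finite[of \<pi>] by simp
    finally have c: "card (collapse_blocks i j (\<pi> - {U})) = Suc m" .
    have "collapse i j ` V \<in> collapse_blocks i j (\<pi> - {U})"
      using V VU by auto
    moreover have "0 \<in> collapse i j ` V"
      using V(2) no(1) ij by (intro image_eqI[of _ _ 0]) (auto simp: collapse_def)
    moreover have "n - (j - i) - 1 \<in> collapse i j ` V"
      using V(3) cut by (intro image_eqI[of _ _ "n - 1"]) (auto simp: collapse_def inner_cuts_def)
    ultimately have irr: "collapse_blocks i j (\<pi> - {U}) \<in> NC_irr (n - (j - i))"
      using rem(1) unfolding NC_irr_def Ueq by blast
    have ins: "insert U (\<pi> - {U}) = \<pi>" using U\<pi> by auto
    show "(\<lambda>((i,j),\<sigma>). (insert {i..<j} (expand_blocks i j \<sigma>), {i..<j}))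
        ((\<lambda>(\<pi>,U). ((Min U, Suc (Max U)), collapse_blocks (Min U) (Suc (Max U)) (\<pi> - {U}))) a) = a"
      using rem(2) ins unfolding a by (simp flip: i_def j_def Ueq)
    show "(\<lambda>(\<pi>,U). ((Min U, Suc (Max U)), collapse_blocks (Min U) (Suc (Max U)) (\<pi> - {U}))) a
        \<in> Sigma (inner_cuts n) ?Q"
      using cut irr c unfolding a by (simp flip: i_def j_def)
    show "(case (\<lambda>(\<pi>,U). ((Min U, Suc (Max U)), collapse_blocks (Min U) (Suc (Max U)) (\<pi> - {U}))) a of
        (p, \<sigma>) \<Rightarrow> F (insert {fst p..<snd p} (expand_blocks (fst p) (snd p) \<sigma>)) {fst p..<snd p})
        = (case a of (\<pi>, U) \<Rightarrow> F \<pi> U)"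
      using rem(2) ins unfolding a by (simp flip: i_def j_def Ueq)
  next
    fix b assume "b \<in> Sigma (inner_cuts n) ?Q"
    then obtain i j \<sigma> where b: "b = ((i,j),\<sigma>)" and ij: "1 \<le> i" "i < j" "j < n"
      and \<sigma>: "\<sigma> \<in> NC_irr (n - (j - i))" "card \<sigma> = Suc m" by (auto simp: inner_cuts_def)
    have nc: "\<sigma> \<in> NC (n - (j - i))" using \<sigma> by (simp add: NC_irr_def)
    note ins = insert_interval_NC[OF nc ij(2) less_imp_le[OF ij(3)]]
    have mm: "Min {i..<j} = i" "Suc (Max {i..<j}) = j"
    proof -
      have "Max {i..<j} = j - 1" by (rule Max_eqI) (use ij in auto)
      then show "Suc (Max {i..<j}) = j" using ij by simp
      show "Min {i..<j} = i" by (rule Min_eqI) (use ij in auto)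
    qed
    have diff: "insert {i..<j} (expand_blocks i j \<sigma>) - {{i..<j}} = expand_blocks i j \<sigma>"
      using ins(2) by auto
    show "(\<lambda>(\<pi>,U). ((Min U, Suc (Max U)), collapse_blocks (Min U) (Suc (Max U)) (\<pi> - {U})))
       ((\<lambda>((i,j),\<sigma>). (insert {i..<j} (expand_blocks i j \<sigma>), {i..<j})) b) = b"
      unfolding b prod.case mm diff using ij by simp
    obtain V where V: "V \<in> \<sigma>" "0 \<in> V" "n - (j - i) - 1 \<in> V"
      using \<sigma> by (auto simp: NC_irr_def)
    have "0 \<in> expand i j ` V"
      using V(2) ij by (intro image_eqI[of _ _ 0]) (auto simp: expand_def)
    moreover have "n - 1 \<in> expand i j ` V"
      using V(3) ij by (intro image_eqI[of _ _ "n - (j - i) - 1"]) (auto simp: expand_def)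
    ultimately have irr: "insert {i..<j} (expand_blocks i j \<sigma>) \<in> NC_irr n"
      using ins(1) V(1) unfolding NC_irr_def by blast
    have "finite \<sigma>" using \<sigma>(2) card_ge_0_finite[of \<sigma>] by simp
    then have "card (insert {i..<j} (expand_blocks i j \<sigma>)) = Suc (Suc m)"
      using ins(2) \<sigma>(2) card_image[OF inj_image_strict_mono[OF strict_mono_expand], of i j \<sigma>]
      by simp
    moreover have "\<not> nests {i..<j} W" if W: "W \<in> insert {i..<j} (expand_blocks i j \<sigma>)" for W
    proof
      assume n: "nests {i..<j} W"
      then obtain W' where W': "W = expand i j ` W'" using W by auto
      obtain x where x: "x \<in> W" using NC_block[OF ins(1) W] by auto
      have "i \<le> x \<and> x < j" using n x unfolding nests_def by fastforce
      then show False
        using x expand_notin_gap[of i j] unfolding W' by auto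
    qed
    ultimately show "(\<lambda>((i,j),\<sigma>). (insert {i..<j} (expand_blocks i j \<sigma>), {i..<j})) b
        \<in> Sigma ?P leaf_blocks"
      using irr unfolding b by (auto simp: leaf_blocks_def)
  qed
  also have "\<dots> = (\<Sum>p\<in>inner_cuts n. \<Sum>\<sigma>\<in>?Q p.
      F (insert {fst p..<snd p} (expand_blocks (fst p) (snd p) \<sigma>)) {fst p..<snd p})"
    by (rule sum.Sigma[symmetric]) auto
  finally show ?thesis by (simp add: case_prod_unfold)
qed

section \<open>The first irreducible component of a partition\<close>

text \<open>
  The length of the first irreducible component, which ends with the last element of the block
  that contains 0.
\<close>

definition first_end :: "nat set set \<Rightarrow> nat" where
  "first_end \<pi> = Suc (Max (\<Union>{V\<in>\<pi>. 0 \<in> V}))"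

lemma first_end_eq:
  assumes "\<pi> \<in> NC n" "V \<in> \<pi>" "0 \<in> V"
  shows "first_end \<pi> = Suc (Max V)"
proof -
  have "{V\<in>\<pi>. 0 \<in> V} = {V}" using assms NC_disjoint by blast
  then show ?thesis by (simp add: first_end_def)
qed

lemma partition_on_Un:
  assumes "partition_on A P" "partition_on B Q" "A \<inter> B = {}"
  shows "partition_on (A \<union> B) (P \<union> Q)"
proof (rule partition_onI)
  show "\<Union>(P \<union> Q) = A \<union> B"
    using assms by (simp add: partition_on_def)
  show "{} \<notin> P \<union> Q"
    using partition_onD3 assms(1,2) by blast
  fix p q assume pq: "p \<in> P \<union> Q" "q \<in> P \<union> Q" "p \<noteq> q"
  have PA: "x \<subseteq> A" if "x \<in> P" for x using that partition_onD1[OF assms(1)] by blast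
  have QB: "x \<subseteq> B" if "x \<in> Q" for x using that partition_onD1[OF assms(2)] by blast
  have d: "disjoint P" "disjoint Q" using partition_onD2 assms(1,2) by auto
  consider "p \<in> P" "q \<in> P" | "p \<in> Q" "q \<in> Q" | "p \<in> P" "q \<in> Q" | "p \<in> Q" "q \<in> P"
    using pq by blast
  then show "disjnt p q"
  proof cases
    case 1 then show ?thesis using d(1) pq(3) by (simp add: disjoint_def disjnt_def)
  next
    case 2 then show ?thesis using d(2) pq(3) by (simp add: disjoint_def disjnt_def)
  next
    case 3 then show ?thesis using PA[of p] QB[of q] assms(3) unfolding disjnt_def by blast
  next
    case 4 then show ?thesis using PA[of q] QB[of p] assms(3) unfolding disjnt_def by blast
  qed
qed

lemma append_components_NC:
  assumes "\<sigma> \<in> NC k" "\<tau> \<in> NC (n - k)" "k \<le> n"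
  shows "\<sigma> \<union> expand_blocks 0 k \<tau> \<in> NC n"
    and "\<And>V. V \<in> expand_blocks 0 k \<tau> \<Longrightarrow> V \<subseteq> {k..} \<and> V \<noteq> {}"
proof -
  have "partition_on {..<k} \<sigma>" "partition_on ({..<n} - {0..<k}) (expand_blocks 0 k \<tau>)"
    using assms partition_on_expand_blocks[of n k 0 \<tau>] by (auto simp: NC_def)
  have p: "partition_on {..<n} (\<sigma> \<union> expand_blocks 0 k \<tau>)"
  proof -
    have "{..<k} \<union> ({..<n} - {0..<k}) = {..<n}" "{..<k} \<inter> ({..<n} - {0..<k}) = {}"
      using assms(3) by auto
    then show ?thesis
      using partition_on_Un \<open>partition_on {..<k} \<sigma>\<close> \<open>partition_on ({..<n} - {0..<k}) (expand_blocks 0 k \<tau>)\<close>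
      by metis
  qed
  show hi: "\<And>V. V \<in> expand_blocks 0 k \<tau> \<Longrightarrow> V \<subseteq> {k..} \<and> V \<noteq> {}"
    using NC_block[OF assms(2)] by (auto simp: expand_def)
  have nc: "noncrossing \<sigma>" "noncrossing (expand_blocks 0 k \<tau>)"
    using assms noncrossing_image_strict_mono[OF strict_mono_expand] by (auto simp: NC_def)
  have "noncrossing (\<sigma> \<union> expand_blocks 0 k \<tau>)"
    unfolding noncrossing_def
  proof (intro ballI impI notI)
    fix V W
    assume V: "V \<in> \<sigma> \<union> expand_blocks 0 k \<tau>" and W: "W \<in> \<sigma> \<union> expand_blocks 0 k \<tau>" and "V \<noteq> W"
      and "\<exists>a\<in>V. \<exists>b\<in>W. \<exists>c\<in>V. \<exists>d\<in>W. a < b \<and> b < c \<and> c < d"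
    then obtain a b c d where *: "a \<in> V" "b \<in> W" "c \<in> V" "d \<in> W" "a < b" "b < c" "c < d"
      by blast
    consider "V \<in> \<sigma>" "W \<in> \<sigma>" | "V \<in> expand_blocks 0 k \<tau>" "W \<in> expand_blocks 0 k \<tau>"
      | "V \<in> \<sigma>" "W \<in> expand_blocks 0 k \<tau>" | "W \<in> \<sigma>" "V \<in> expand_blocks 0 k \<tau>"
      using V W by blast
    then show False
    proof cases
      case 1 then show False using noncrossingD[OF nc(1) _ _ \<open>V \<noteq> W\<close> *] by blast
    next
      case 2 then show False using noncrossingD[OF nc(2) _ _ \<open>V \<noteq> W\<close> *] by blast
    next
      case 3
      then have "c < k" "k \<le> b" using NC_block[OF assms(1), of V] hi[of W] * by auto
      then show False using * by simp
    next
      case 4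
      then have "d < k" "k \<le> c" using NC_block[OF assms(1), of W] hi[of V] * by auto
      then show False using * by simp
    qed
  qed
  then show "\<sigma> \<union> expand_blocks 0 k \<tau> \<in> NC n" using p by (simp add: NC_def)
qed

text \<open>
  A block with elements on both sides of the end of the first component would cross the block of 0.
\<close>

lemma first_component:
  assumes "\<pi> \<in> NC n" "0 < n"
  defines "k \<equiv> first_end \<pi>"
  defines "\<sigma> \<equiv> {V\<in>\<pi>. V \<subseteq> {..<k}}" and "\<tau> \<equiv> {V\<in>\<pi>. \<not> V \<subseteq> {..<k}}"
  shows "k \<in> {1..n}" "\<sigma> \<in> NC_irr k" "collapse_blocks 0 k \<tau> \<in> NC (n - k)"
    "expand_blocks 0 k (collapse_blocks 0 k \<tau>) = \<tau>"
proof -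
  have p: "partition_on {..<n} \<pi>" and nc: "noncrossing \<pi>" using assms by (auto simp: NC_def)
  obtain V0 where V0: "V0 \<in> \<pi>" "0 \<in> V0" using NC_cover[OF assms(1,2)] by auto
  have k: "k = Suc (Max V0)" unfolding k_def using first_end_eq[OF assms(1) V0] .
  have fin: "finite V0" "V0 \<subseteq> {..<n}" using NC_block[OF assms(1) V0(1)] by auto
  have km: "k - 1 \<in> V0" using fin V0(2) unfolding k by (auto intro: Max_in)
  show kn: "k \<in> {1..n}" using km fin unfolding k by auto
  have V0\<sigma>: "V0 \<in> \<sigma>" using V0 fin by (auto simp: \<sigma>_def k less_Suc_eq_le)
  have hi: "V \<inter> {0..<k} = {}" if "V \<in> \<tau>" for V
  proof (rule ccontr)
    assume "V \<inter> {0..<k} \<noteq> {}"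
    then obtain x where x: "x \<in> V" "x < k" by auto
    have "\<not> V \<subseteq> {..<k}" using that by (simp add: \<tau>_def)
    then obtain y where y: "y \<in> V" "k \<le> y" by (metis lessThan_iff not_less subsetI)
    have V: "V \<in> \<pi>" "V \<noteq> V0" using that V0\<sigma> by (auto simp: \<tau>_def \<sigma>_def)
    have "x \<noteq> 0" "x \<noteq> k - 1"
      using NC_disjoint[OF assms(1) V(1) V0(1)] V0(2) km x V by auto
    then have "0 < x" "x < k - 1" "k - 1 < y" using x y kn by auto
    then show False
      using noncrossingD[OF nc V0(1) V(1) V(2)[symmetric] V0(2) x(1) km y(1)] by blast
  qed
  then show "expand_blocks 0 k (collapse_blocks 0 k \<tau>) = \<tau>"
    using expand_collapse_blocks[of 0 k \<tau>] by auto
  have un: "\<pi> = \<sigma> \<union> \<tau>" by (auto simp: \<sigma>_def \<tau>_def)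
  have cover: "\<Union>\<pi> = {..<n}" using partition_onD1[OF p] by simp
  have lo: "\<Union>\<sigma> \<subseteq> {..<k}" by (auto simp: \<sigma>_def)
  have hi': "\<Union>\<tau> \<inter> {0..<k} = {}" using hi by blast
  have "A = C \<and> B = D - C" if "A \<union> B = D" "A \<subseteq> C" "B \<inter> C = {}" "C \<subseteq> D" for A B C D :: "nat set"
    using that by blast
  moreover have "\<Union>\<sigma> \<union> \<Union>\<tau> = {..<n}" using cover unfolding un by simp
  moreover have "{..<k} \<subseteq> {..<n}" using kn by auto
  ultimately have "\<Union>\<sigma> = {..<k}" "\<Union>\<tau> = {..<n} - {0..<k}"
    using lo hi' unfolding atLeast0LessThan by metis+
  moreover have "disjoint \<sigma>" "disjoint \<tau>" "{} \<notin> \<sigma>" "{} \<notin> \<tau>"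
    using p unfolding partition_on_def un disjoint_def by auto
  ultimately have pp: "partition_on {..<k} \<sigma>" "partition_on ({..<n} - {0..<k}) \<tau>"
    by (auto simp: partition_on_def)
  have ncs: "noncrossing \<sigma>" "noncrossing \<tau>" using nc noncrossing_subset un by auto
  show "\<sigma> \<in> NC_irr k"
    using pp ncs V0\<sigma> V0 km by (auto simp: NC_irr_def NC_def)
  show "collapse_blocks 0 k \<tau> \<in> NC (n - k)"
    using partition_on_collapse_blocks[OF pp(2)] noncrossing_collapse_blocks[OF ncs(2), of 0 k] hi kn
    by (simp add: NC_def)
qed

lemma sum_NC_first_component:
  fixes F :: "nat set set \<Rightarrow> 'c::comm_monoid_add"
  assumes "0 < n"
  shows "(\<Sum>\<pi>\<in>NC n. F \<pi>) =
    (\<Sum>k=1..n. \<Sum>\<sigma>\<in>NC_irr k. \<Sum>\<tau>\<in>NC (n - k). F (\<sigma> \<union> expand_blocks 0 k \<tau>))"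
proof -
  let ?S = "SIGMA k:{1..n}. NC_irr k \<times> NC (n - k)"
  have "(\<Sum>\<pi>\<in>NC n. F \<pi>) = (\<Sum>(k,\<sigma>,\<tau>)\<in>?S. F (\<sigma> \<union> expand_blocks 0 k \<tau>))"
  proof (rule sum.reindex_bij_witness[where
      j = "\<lambda>\<pi>. (first_end \<pi>, {V\<in>\<pi>. V \<subseteq> {..<first_end \<pi>}},
                  collapse_blocks 0 (first_end \<pi>) {V\<in>\<pi>. \<not> V \<subseteq> {..<first_end \<pi>}})" and
      i = "\<lambda>(k,\<sigma>,\<tau>). \<sigma> \<union> expand_blocks 0 k \<tau>"])
    fix \<pi> assume \<pi>: "\<pi> \<in> NC n"
    note fc = first_component[OF \<pi> assms]
    have "{V\<in>\<pi>. V \<subseteq> {..<first_end \<pi>}} \<union> {V\<in>\<pi>. \<not> V \<subseteq> {..<first_end \<pi>}} = \<pi>" by blast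
    then show "(case (first_end \<pi>, {V\<in>\<pi>. V \<subseteq> {..<first_end \<pi>}},
                  collapse_blocks 0 (first_end \<pi>) {V\<in>\<pi>. \<not> V \<subseteq> {..<first_end \<pi>}}) of
         (k,\<sigma>,\<tau>) \<Rightarrow> \<sigma> \<union> expand_blocks 0 k \<tau>) = \<pi>"
      and "(case (first_end \<pi>, {V\<in>\<pi>. V \<subseteq> {..<first_end \<pi>}},
                  collapse_blocks 0 (first_end \<pi>) {V\<in>\<pi>. \<not> V \<subseteq> {..<first_end \<pi>}}) of
         (k,\<sigma>,\<tau>) \<Rightarrow> F (\<sigma> \<union> expand_blocks 0 k \<tau>)) = F \<pi>"
      using fc(4) by simp_all
    show "(first_end \<pi>, {V\<in>\<pi>. V \<subseteq> {..<first_end \<pi>}},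
                  collapse_blocks 0 (first_end \<pi>) {V\<in>\<pi>. \<not> V \<subseteq> {..<first_end \<pi>}}) \<in> ?S"
      using fc(1-3) by auto
  next
    fix b assume "b \<in> ?S"
    then obtain k \<sigma> \<tau> where b: "b = (k,\<sigma>,\<tau>)" and k: "1 \<le> k" "k \<le> n"
      and \<sigma>: "\<sigma> \<in> NC_irr k" and \<tau>: "\<tau> \<in> NC (n - k)" by auto
    have \<sigma>': "\<sigma> \<in> NC k" using \<sigma> by (simp add: NC_irr_def)
    note ap = append_components_NC[OF \<sigma>' \<tau> k(2)]
    show "(case b of (k,\<sigma>,\<tau>) \<Rightarrow> \<sigma> \<union> expand_blocks 0 k \<tau>) \<in> NC n"
      using ap(1) by (simp add: b)
    obtain V where V: "V \<in> \<sigma>" "0 \<in> V" "k - 1 \<in> V" using \<sigma> by (auto simp: NC_irr_def)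
    have lo: "\<And>W. W \<in> \<sigma> \<Longrightarrow> W \<subseteq> {..<k}" using NC_block[OF \<sigma>'] by blast
    have "Max V = k - 1"
      by (rule Max_eqI) (use V NC_block[OF \<sigma>' V(1)] in \<open>auto dest!: subsetD\<close>)
    then have fe: "first_end (\<sigma> \<union> expand_blocks 0 k \<tau>) = k"
      using first_end_eq[OF ap(1), of V] V k by simp
    have nl: "\<not> W \<subseteq> {..<k}" if W: "W \<in> expand_blocks 0 k \<tau>" for W
      using ap(2)[OF W] by (auto simp: subset_iff) (meson not_le)
    have "{W\<in>\<sigma> \<union> expand_blocks 0 k \<tau>. W \<subseteq> {..<k}} = \<sigma>"
      "{W\<in>\<sigma> \<union> expand_blocks 0 k \<tau>. \<not> W \<subseteq> {..<k}} = expand_blocks 0 k \<tau>"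
      using lo nl by blast+
    then show "(\<lambda>\<pi>. (first_end \<pi>, {V\<in>\<pi>. V \<subseteq> {..<first_end \<pi>}},
          collapse_blocks 0 (first_end \<pi>) {V\<in>\<pi>. \<not> V \<subseteq> {..<first_end \<pi>}}))
          (case b of (k,\<sigma>,\<tau>) \<Rightarrow> \<sigma> \<union> expand_blocks 0 k \<tau>) = b"
      unfolding b prod.case fe by simp
  qed
  also have "\<dots> = (\<Sum>k=1..n. \<Sum>(\<sigma>,\<tau>)\<in>NC_irr k \<times> NC (n - k). F (\<sigma> \<union> expand_blocks 0 k \<tau>))"
    by (subst sum.Sigma) (auto simp: finite_NC case_prod_unfold)
  also have "\<dots> = (\<Sum>k=1..n. \<Sum>\<sigma>\<in>NC_irr k. \<Sum>\<tau>\<in>NC (n - k). F (\<sigma> \<union> expand_blocks 0 k \<tau>))"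
    by (intro sum.cong refl) (simp add: sum.cartesian_product)
  finally show ?thesis .
qed

section \<open>Cutting intervals out of words\<close>

text \<open>
  \<open>excise i j w\<close> is what remains of \<open>w\<close> when \<open>slice i j w\<close>, the subword in the positions
  \<open>{i..<j}\<close>, is cut out.
\<close>

definition excise :: "nat \<Rightarrow> nat \<Rightarrow> 'a list \<Rightarrow> 'a list" where
  "excise i j w = take i w @ drop j w"

definition slice :: "nat \<Rightarrow> nat \<Rightarrow> 'a list \<Rightarrow> 'a list" where
  "slice i j w = take (j - i) (drop i w)"

lemma length_excise: "i \<le> j \<Longrightarrow> j \<le> length w \<Longrightarrow> length (excise i j w) = length w - (j - i)"
  by (simp add: excise_def)

lemma nths_cong:
  assumes "\<And>l. l < length xs \<Longrightarrow> l \<in> A \<longleftrightarrow> l \<in> B"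
  shows "nths xs A = nths xs B"
proof -
  have "filter (\<lambda>p. snd p \<in> A) (zip xs [0..<length xs]) = filter (\<lambda>p. snd p \<in> B) (zip xs [0..<length xs])"
    by (rule filter_cong) (use assms in \<open>auto dest!: set_zip_rightD\<close>)
  then show ?thesis by (simp add: nths_def)
qed

lemma nths_eq_Nil: "(\<And>l. l < length xs \<Longrightarrow> l \<notin> A) \<Longrightarrow> nths xs A = []"
  using nths_cong[of xs A "{}"] by simp

lemma nths_interval:
  assumes "i \<le> j" "j \<le> length w"
  shows "nths w {i..<j} = slice i j w"
proof -
  have "nths w {i..<j} = nths (take i w @ drop i w) {i..<j}" by simp
  also have "\<dots> = nths (drop i w) {l. l + i \<in> {i..<j}}"
    using assms nths_eq_Nil[of "take i w" "{i..<j}"] by (subst nths_append) simp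
  also have "{l. l + i \<in> {i..<j}} = {..<j - i}" by auto
  finally show ?thesis by (simp add: slice_def)
qed

lemma nths_expand:
  assumes "i \<le> j" "j \<le> length w"
  shows "nths w (expand i j ` V) = nths (excise i j w) V"
proof -
  have w: "w = take i w @ (slice i j w @ drop j w)"
    using assms by (metis append_take_drop_id drop_drop slice_def le_add_diff_inverse2)
  have ls: "length (slice i j w) = j - i" "length (take i w) = i"
    using assms by (simp_all add: slice_def)
  have low: "l \<in> expand i j ` V \<longleftrightarrow> l \<in> V" if "l < i" for l
    using that by (auto simp: expand_def image_iff)
  have high: "l + j \<in> expand i j ` V \<longleftrightarrow> l + i \<in> V" for l
  proof
    assume "l + j \<in> expand i j ` V"
    then obtain x where x: "x \<in> V" "l + j = expand i j x" by auto
    then have "x = l + i" using assms by (auto simp: expand_def split: if_splits)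
    then show "l + i \<in> V" using x by simp
  next
    assume "l + i \<in> V"
    moreover have "l + j = expand i j (l + i)" using assms by (simp add: expand_def)
    ultimately show "l + j \<in> expand i j ` V" by simp
  qed
  have mid: "l + i \<notin> expand i j ` V" if "l < j - i" for l
    using that by (auto simp: expand_def)
  have "nths w (expand i j ` V) = nths (take i w @ (slice i j w @ drop j w)) (expand i j ` V)"
    using w by simp
  also have "\<dots> = nths (take i w) (expand i j ` V) @ nths (slice i j w) {l. l + i \<in> expand i j ` V}
      @ nths (drop j w) {l. l + (j - i) + i \<in> expand i j ` V}"
    unfolding nths_append ls by simp
  also have "nths (take i w) (expand i j ` V) = nths (take i w) V"
    by (rule nths_cong) (use low ls in auto)
  also have "nths (slice i j w) {l. l + i \<in> expand i j ` V} = []"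
    by (rule nths_eq_Nil) (use mid ls in auto)
  also have "{l. l + (j - i) + i \<in> expand i j ` V} = {l. l + i \<in> V}"
    using high assms by simp
  finally show ?thesis
    unfolding excise_def nths_append ls by simp
qed

definition all_cuts :: "nat \<Rightarrow> (nat \<times> nat) set" where
  "all_cuts n = {(i, j). i < j \<and> j \<le> n}"

lemma finite_all_cuts [simp]: "finite (all_cuts n)"
  by (rule finite_subset[of _ "{..n} \<times> {..n}"]) (auto simp: all_cuts_def)

text \<open>
  On words, \<open>right_conv c f\<close> is \<open>f * c\<close> and \<open>insertion c f\<close> is \<open>f \<lhd> c\<close>, for \<open>c\<close> (and in
  the second case also \<open>f\<close>) the restriction of an infinitesimal character.
\<close>

definition right_conv :: "('a list \<Rightarrow> complex) \<Rightarrow> ('a list \<Rightarrow> complex) \<Rightarrow> 'a list \<Rightarrow> complex" where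
  "right_conv c f w = (\<Sum>(i,j)\<in>all_cuts (length w). f (excise i j w) * c (slice i j w))"

definition insertion :: "('a list \<Rightarrow> complex) \<Rightarrow> ('a list \<Rightarrow> complex) \<Rightarrow> 'a list \<Rightarrow> complex" where
  "insertion c f w = (\<Sum>(i,j)\<in>inner_cuts (length w). f (excise i j w) * c (slice i j w))"

text \<open>
  The recursion \<open>m = concat_prod b m\<close> on nonempty words is the moment recursion of the Boolean
  cumulants.  The left factor is never evaluated at the empty word.
\<close>

definition concat_prod :: "('a list \<Rightarrow> complex) \<Rightarrow> ('a list \<Rightarrow> complex) \<Rightarrow> 'a list \<Rightarrow> complex" where
  "concat_prod f g w = (\<Sum>k=1..length w. f (take k w) * g (drop k w))"

definition word_unit :: "'a list \<Rightarrow> complex" where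
  "word_unit w = (if w = [] then 1 else 0)"

lemma take_beyond_excise:
  assumes "i < j" "i < k"
  shows "take k (excise i j w) = excise i j (take (k + (j - i)) w)"
    and "drop k (excise i j w) = drop (k + (j - i)) w"
    and "slice i j (take (k + (j - i)) w) = slice i j w"
proof -
  have "j + (k - i) = k + (j - i)" "i \<le> k + (j - i)" using assms by simp_all
  then show "take k (excise i j w) = excise i j (take (k + (j - i)) w)"
    using assms by (cases "length w \<le> i") (simp_all add: excise_def drop_take min_def)
  show "drop k (excise i j w) = drop (k + (j - i)) w"
  proof (cases "length w \<le> i")
    case False
    moreover have "k - i + j = k + (j - i)" using assms by simp
    ultimately show ?thesis using assms by (simp only: excise_def drop_append length_take drop_drop min_def) simp
  qed (use assms in \<open>simp add: excise_def\<close>)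
  show "slice i j (take (k + (j - i)) w) = slice i j w"
    using assms by (simp add: slice_def drop_take min_def)
qed

lemma take_before_excise:
  assumes "k \<le> i" "i < j"  "j \<le> length w"
  shows "take k (excise i j w) = take k w"
    and "drop k (excise i j w) = excise (i - k) (j - k) (drop k w)"
    and "slice i j w = slice (i - k) (j - k) (drop k w)"
  using assms by (simp_all add: excise_def slice_def drop_take min_def)

text \<open>
  The three summands collect the intervals cut out in front of the left factor, strictly inside
  it, and behind it.  An interval at the border of the two factors is counted once,
  as lying behind the left factor.
\<close>

lemma right_conv_concat_prod:
  "right_conv c (concat_prod f g) w =
     concat_prod c (concat_prod f g) w + concat_prod (insertion c f) g w
     + concat_prod f (right_conv c g) w"
proof -
  let ?n = "length w"
  let ?t = "\<lambda>i j k. f (take k (excise i j w)) * g (drop k (excise i j w)) * c (slice i j w)"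
  \<comment> \<open>Cuts at the front of the word are treated apart; \<open>?A\<close> contains the others.\<close>
  let ?A = "{(i,j). 1 \<le> i \<and> i < j \<and> j \<le> ?n}"
  let ?T = "SIGMA p:?A. {1..?n - (snd p - fst p)}"
  have finA: "finite ?A"
    by (rule finite_subset[OF _ finite_all_cuts[of ?n]]) (auto simp: all_cuts_def)
  have finT: "finite ?T" using finA by auto
  have "all_cuts ?n = (\<lambda>k. (0,k)) ` {1..?n} \<union> ?A"
    by (auto simp: all_cuts_def image_iff)
  then have "right_conv c (concat_prod f g) w =
     (\<Sum>p\<in>(\<lambda>k. (0,k)) ` {1..?n}. concat_prod f g (excise (fst p) (snd p) w) * c (slice (fst p) (snd p) w))
     + (\<Sum>p\<in>?A. concat_prod f g (excise (fst p) (snd p) w) * c (slice (fst p) (snd p) w))"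
    unfolding right_conv_def case_prod_unfold
    using finA by (subst sum.union_disjoint[symmetric]) (auto simp: case_prod_unfold)
  also have "(\<Sum>p\<in>(\<lambda>k. (0,k)) ` {1..?n}. concat_prod f g (excise (fst p) (snd p) w) * c (slice (fst p) (snd p) w))
      = concat_prod c (concat_prod f g) w"
    unfolding concat_prod_def[of c]
    by (subst sum.reindex) (auto simp: inj_on_def excise_def slice_def mult.commute)
  also have "(\<Sum>p\<in>?A. concat_prod f g (excise (fst p) (snd p) w) * c (slice (fst p) (snd p) w))
      = (\<Sum>p\<in>?A. \<Sum>k\<in>{1..?n - (snd p - fst p)}. ?t (fst p) (snd p) k)"
    by (intro sum.cong refl) (auto simp: concat_prod_def length_excise sum_distrib_right)
  also have "\<dots> = (\<Sum>(p,k)\<in>?T. ?t (fst p) (snd p) k)"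
    by (rule sum.Sigma) (use finA in auto)
  also have "?T = {(p,k)\<in>?T. fst p < k} \<union> {(p,k)\<in>?T. k \<le> fst p}" by auto
  also have "(\<Sum>(p,k)\<in>\<dots>. ?t (fst p) (snd p) k) =
      (\<Sum>(p,k)\<in>{(p,k)\<in>?T. fst p < k}. ?t (fst p) (snd p) k)
      + (\<Sum>(p,k)\<in>{(p,k)\<in>?T. k \<le> fst p}. ?t (fst p) (snd p) k)"
    by (rule sum.union_disjoint) (auto intro: finite_subset[OF _ finT])
  also have "(\<Sum>(p,k)\<in>{(p,k)\<in>?T. fst p < k}. ?t (fst p) (snd p) k) =
      (\<Sum>(l,p)\<in>(SIGMA l:{1..?n}. inner_cuts l).
         f (excise (fst p) (snd p) (take l w)) * c (slice (fst p) (snd p) (take l w)) * g (drop l w))"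
  proof (rule sum.reindex_bij_witness[where i = "\<lambda>(l,p). (p, l - (snd p - fst p))" and
          j = "\<lambda>(p,k). (k + (snd p - fst p), p)"])
    fix a assume "a \<in> {(p,k)\<in>?T. fst p < k}"
    then obtain i j k where a: "a = ((i,j),k)" and ijk: "1 \<le> i" "i < j" "j \<le> ?n" "i < k" "k \<le> ?n - (j - i)"
      by auto
    show "(case case a of (p, k) \<Rightarrow> (k + (snd p - fst p), p) of (l, p) \<Rightarrow> (p, l - (snd p - fst p))) = a"
      by (simp add: a)
    show "(case a of (p, k) \<Rightarrow> (k + (snd p - fst p), p)) \<in> (SIGMA l:{1..?n}. inner_cuts l)"
      using ijk by (auto simp: a inner_cuts_def)
    show "(case case a of (p, k) \<Rightarrow> (k + (snd p - fst p), p) of (l, p) \<Rightarrow>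
        f (excise (fst p) (snd p) (take l w)) * c (slice (fst p) (snd p) (take l w)) * g (drop l w)) =
      (case a of (p, k) \<Rightarrow> ?t (fst p) (snd p) k)"
      using take_beyond_excise[OF ijk(2,4), of w] by (simp add: a)
  next
    fix b assume "b \<in> (SIGMA l:{1..?n}. inner_cuts l)"
    then obtain l i j where b: "b = (l,(i,j))" "1 \<le> i" "i < j" "j < l" "l \<le> ?n"
      by (auto simp: inner_cuts_def)
    then show "(case case b of (l, p) \<Rightarrow> (p, l - (snd p - fst p)) of (p, k) \<Rightarrow> (k + (snd p - fst p), p)) = b"
      "(case b of (l, p) \<Rightarrow> (p, l - (snd p - fst p))) \<in> {(p,k)\<in>?T. fst p < k}"
      by auto
  qed
  also have "\<dots> = concat_prod (insertion c f) g w"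
    unfolding concat_prod_def
    by (subst sum.Sigma[symmetric])
       (auto simp: insertion_def case_prod_unfold sum_distrib_right intro!: sum.cong)
  also have "(\<Sum>(p,k)\<in>{(p,k)\<in>?T. k \<le> fst p}. ?t (fst p) (snd p) k) =
      (\<Sum>(k,p)\<in>(SIGMA k:{1..?n}. all_cuts (?n - k)).
         f (take k w) * (g (excise (fst p) (snd p) (drop k w)) * c (slice (fst p) (snd p) (drop k w))))"
  proof (rule sum.reindex_bij_witness[where i = "\<lambda>(k,p). ((fst p + k, snd p + k), k)" and
          j = "\<lambda>(p,k). (k, (fst p - k, snd p - k))"])
    fix a assume "a \<in> {(p,k)\<in>?T. k \<le> fst p}"
    then obtain i j k where a: "a = ((i,j),k)" and ijk: "1 \<le> k" "k \<le> i" "i < j" "j \<le> ?n"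
      by auto
    show "(case case a of (p,k) \<Rightarrow> (k, (fst p - k, snd p - k)) of (k,p) \<Rightarrow> ((fst p + k, snd p + k), k)) = a"
      "(case a of (p,k) \<Rightarrow> (k, (fst p - k, snd p - k))) \<in> (SIGMA k:{1..?n}. all_cuts (?n - k))"
      using ijk by (auto simp: a all_cuts_def)
    show "(case case a of (p,k) \<Rightarrow> (k, (fst p - k, snd p - k)) of (k,p) \<Rightarrow>
        f (take k w) * (g (excise (fst p) (snd p) (drop k w)) * c (slice (fst p) (snd p) (drop k w)))) =
      (case a of (p, k) \<Rightarrow> ?t (fst p) (snd p) k)"
      using take_before_excise[OF ijk(2-4)] by (simp add: a)
  next
    fix b assume "b \<in> (SIGMA k:{1..?n}. all_cuts (?n - k))"
    then obtain k i j where b: "b = (k,(i,j))" "1 \<le> k" "k \<le> ?n" "i < j" "j \<le> ?n - k"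
      by (auto simp: all_cuts_def)
    then show "(case case b of (k,p) \<Rightarrow> ((fst p + k, snd p + k), k) of (p,k) \<Rightarrow> (k, (fst p - k, snd p - k))) = b"
      "(case b of (k,p) \<Rightarrow> ((fst p + k, snd p + k), k)) \<in> {(p,k)\<in>?T. k \<le> fst p}"
      by auto
  qed
  also have "\<dots> = concat_prod f (right_conv c g) w"
    unfolding concat_prod_def
    by (subst sum.Sigma[symmetric])
       (auto simp: right_conv_def case_prod_unfold sum_distrib_left intro!: sum.cong)
  finally show ?thesis by (simp add: add.assoc)
qed

lemma right_conv_sum:
  "right_conv c (\<lambda>w. \<Sum>m\<in>M. a m * f m w) w = (\<Sum>m\<in>M. a m * right_conv c (f m) w)"
  unfolding right_conv_def case_prod_unfold sum_distrib_right sum_distrib_left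
  by (subst sum.swap) (simp add: mult.assoc)

lemma concat_prod_sum:
  "concat_prod c (\<lambda>w. \<Sum>m\<in>M. a m * f m w) w = (\<Sum>m\<in>M. a m * concat_prod c (f m) w)"
  unfolding concat_prod_def sum_distrib_right sum_distrib_left
  by (subst sum.swap) (simp add: mult_ac)

section \<open>Exponentials of functionals on words\<close>

abbreviation conv_pow_word :: "('a list \<Rightarrow> complex) \<Rightarrow> nat \<Rightarrow> 'a list \<Rightarrow> complex" where
  "conv_pow_word c n \<equiv> (right_conv c ^^ n) word_unit"

lemma right_conv_word_unit:
  "right_conv c word_unit = concat_prod c word_unit"
proof
  fix w :: "'a list"
  have "right_conv c word_unit w = (\<Sum>p\<in>{p\<in>all_cuts (length w). p = (0, length w)}. c (slice 0 (length w) w))"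
    unfolding right_conv_def case_prod_unfold
    by (rule sum.mono_neutral_cong_right[OF finite_all_cuts])
       (auto simp: all_cuts_def word_unit_def excise_def)
  also have "\<dots> = (\<Sum>k\<in>{k\<in>{1..length w}. k = length w}. c w)"
  proof (cases "w = []")
    case False
    then have "{p \<in> all_cuts (length w). p = (0, length w)} = {(0, length w)}"
      "{k\<in>{1..length w}. k = length w} = {length w}"
      by (auto simp: all_cuts_def Suc_le_eq)
    then show ?thesis by (simp add: slice_def)
  qed (simp add: all_cuts_def)
  also have "\<dots> = concat_prod c word_unit w"
    unfolding concat_prod_def
    by (rule sum.mono_neutral_cong_left) (auto simp: word_unit_def)
  finally show "right_conv c word_unit w = concat_prod c word_unit w" .
qed

text \<open>
  Induction on \<open>n\<close>: apply the Leibniz rule to each summand.  The terms with the interval in front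
  add up, by the induction hypothesis, to the missing summand for \<open>m = 0\<close>, and Pascal's rule
  combines the rest.
\<close>

lemma conv_pow_word_Suc:
  "conv_pow_word c (Suc n) =
     (\<lambda>w. \<Sum>m\<le>n. of_nat (Suc n choose Suc m) * concat_prod ((insertion c ^^ m) c) (conv_pow_word c (n - m)) w)"
proof (induction n)
  case 0
  then show ?case by (simp add: right_conv_word_unit)
next
  case (Suc n)
  define X where "X m k w = concat_prod ((insertion c ^^ m) c) (conv_pow_word c k) w" for m k w
  show ?case
  proof
    fix w
    have top: "Suc n choose Suc (Suc n) = 0" by (rule binomial_eq_0) simp
    have "conv_pow_word c (Suc (Suc n)) w =
      right_conv c (\<lambda>w. \<Sum>m\<le>n. of_nat (Suc n choose Suc m) * X m (n - m) w) w"
      using Suc.IH by (simp add: X_def)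
    also have "\<dots> = (\<Sum>m\<le>n. of_nat (Suc n choose Suc m) *
        (concat_prod c (X m (n - m)) w + X (Suc m) (n - m) w + X m (Suc (n - m)) w))"
      unfolding right_conv_sum X_def right_conv_concat_prod by simp
    also have "\<dots> = (\<Sum>m\<le>n. of_nat (Suc n choose Suc m) * concat_prod c (X m (n - m)) w)
       + (\<Sum>m\<le>n. of_nat (Suc n choose Suc m) * X (Suc m) (n - m) w)
       + (\<Sum>m\<le>n. of_nat (Suc n choose Suc m) * X m (Suc (n - m)) w)"
      by (simp add: distrib_left sum.distrib)
    also have "(\<Sum>m\<le>n. of_nat (Suc n choose Suc m) * concat_prod c (X m (n - m)) w) = X 0 (Suc n) w"
      using Suc.IH unfolding concat_prod_sum[symmetric] by (simp add: X_def)
    also have "X 0 (Suc n) w + (\<Sum>m\<le>n. of_nat (Suc n choose Suc m) * X (Suc m) (n - m) w)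
       = (\<Sum>m\<le>Suc n. of_nat (Suc n choose m) * X m (Suc n - m) w)"
      by (subst sum.atMost_Suc_shift) simp
    also have "(\<Sum>m\<le>n. of_nat (Suc n choose Suc m) * X m (Suc (n - m)) w)
       = (\<Sum>m\<le>Suc n. of_nat (Suc n choose Suc m) * X m (Suc n - m) w)"
      by (simp add: Suc_diff_le top del: binomial_Suc_Suc)
    also have "(\<Sum>m\<le>Suc n. of_nat (Suc n choose m) * X m (Suc n - m) w) + \<dots>
       = (\<Sum>m\<le>Suc n. of_nat (Suc (Suc n) choose Suc m) * X m (Suc n - m) w)"
      unfolding sum.distrib[symmetric] distrib_right[symmetric] of_nat_add[symmetric]
      by (simp only: binomial_Suc_Suc)
    finally show "conv_pow_word c (Suc (Suc n)) w =
      (\<Sum>m\<le>Suc n. of_nat (Suc (Suc n) choose Suc m) *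
          concat_prod ((insertion c ^^ m) c) (conv_pow_word c (Suc n - m)) w)"
      by (simp add: X_def)
  qed
qed

lemma conv_pow_word_vanish: "length w < n \<Longrightarrow> (right_conv c ^^ n) f w = 0"
proof (induction n arbitrary: w)
  case (Suc n)
  have "(right_conv c ^^ n) f (excise i j w) = 0" if "(i,j) \<in> all_cuts (length w)" for i j
    using that Suc.prems by (intro Suc.IH) (auto simp: all_cuts_def length_excise)
  then show ?case
    unfolding funpow.simps o_apply
    by (subst right_conv_def) (auto intro!: sum.neutral)
qed simp

lemma insertion_pow_vanish: "length w < n \<Longrightarrow> (insertion c ^^ n) f w = 0"
proof (induction n arbitrary: w)
  case (Suc n)
  have "(insertion c ^^ n) f (excise i j w) = 0" if "(i,j) \<in> inner_cuts (length w)" for i j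
    using that Suc.prems by (intro Suc.IH) (auto simp: inner_cuts_def length_excise)
  then show ?case
    unfolding funpow.simps o_apply
    by (subst insertion_def) (auto intro!: sum.neutral)
qed simp

lemma binomial_convolution_sums:
  fixes a b :: "nat \<Rightarrow> complex"
  assumes "\<And>n. N < n \<Longrightarrow> a n = 0" "\<And>n. N < n \<Longrightarrow> b n = 0"
  shows "(\<lambda>n. \<Sum>m\<le>n. a m * b (n - m)) sums ((\<Sum>n. a n) * (\<Sum>n. b n))"
proof -
  have "summable (\<lambda>n. norm (a n))"
    by (rule summable_finite[of "{..N}"]) (use assms in \<open>auto simp: not_le\<close>)
  moreover have "summable (\<lambda>n. norm (b n))"
    by (rule summable_finite[of "{..N}"]) (use assms in \<open>auto simp: not_le\<close>)
  ultimately show ?thesis by (rule Cauchy_product_sums)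
qed

definition word_exp :: "('a list \<Rightarrow> complex) \<Rightarrow> 'a list \<Rightarrow> complex" where
  "word_exp c w = (\<Sum>n. conv_pow_word c n w / fact n)"

definition word_W :: "('a list \<Rightarrow> complex) \<Rightarrow> ('a list \<Rightarrow> complex) \<Rightarrow> 'a list \<Rightarrow> complex" where
  "word_W c a w = (\<Sum>n. (insertion c ^^ n) a w / fact (n + 1))"

lemma conv_pow_word_sums: "(\<lambda>n. conv_pow_word c n w / fact n) sums word_exp c w"
  unfolding word_exp_def
  by (rule summable_sums, rule summable_finite[of "{..length w}"])
     (auto simp: conv_pow_word_vanish not_le)

lemma word_W_sums: "(\<lambda>n. (insertion c ^^ n) a w / fact (n + 1)) sums word_W c a w"
  unfolding word_W_def
  by (rule summable_sums, rule summable_finite[of "{..length w}"])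
     (auto simp: insertion_pow_vanish not_le)

lemma word_exp_Nil: "word_exp c [] = 1"
proof -
  have "conv_pow_word c n [] / fact n = (if n = 0 then 1 else 0)" for n
    by (cases n) (auto simp: word_unit_def conv_pow_word_vanish simp del: funpow.simps(2))
  then have "(\<lambda>n. conv_pow_word c n [] / fact n) sums 1"
    using sums_single[of 0 "\<lambda>_. 1"] by simp
  then show ?thesis using conv_pow_word_sums sums_unique2 by blast
qed

text \<open>
  The expansion of the convolution powers, summed over \<open>n\<close>: the coefficients satisfy
  \<open>binom(n + 1, m + 1) / (n + 1)! = 1 / ((m + 1)! (n - m)!)\<close>, so the sum is a Cauchy product.
\<close>

lemma word_exp_recursion:
  assumes "w \<noteq> []"
  shows "word_exp c w = concat_prod (word_W c c) (word_exp c) w"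
proof -
  let ?a = "\<lambda>k m. (insertion c ^^ m) c (take k w) / fact (m + 1)"
  let ?b = "\<lambda>k m. conv_pow_word c m (drop k w) / fact m"
  have "(\<lambda>n. \<Sum>m\<le>n. ?a k m * ?b k (n - m)) sums (word_W c c (take k w) * word_exp c (drop k w))" for k
    unfolding word_W_def word_exp_def
    by (rule binomial_convolution_sums[of "length w"])
       (simp_all add: insertion_pow_vanish conv_pow_word_vanish)
  then have "(\<lambda>n. \<Sum>k=1..length w. \<Sum>m\<le>n. ?a k m * ?b k (n - m)) sums
       concat_prod (word_W c c) (word_exp c) w"
    unfolding concat_prod_def by (intro sums_sum)
  moreover have "conv_pow_word c (Suc n) w / fact (Suc n) =
     (\<Sum>k=1..length w. \<Sum>m\<le>n. ?a k m * ?b k (n - m))" for n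
  proof -
    have bin: "of_nat (Suc n choose Suc m) / fact (Suc n) = (1 / (fact (m + 1) * fact (n - m)) :: complex)"
      if "m \<le> n" for m
      using that by (subst binomial_fact) (simp_all del: fact_Suc)
    have "conv_pow_word c (Suc n) w / fact (Suc n) =
      (\<Sum>m\<le>n. of_nat (Suc n choose Suc m) / fact (Suc n) *
          concat_prod ((insertion c ^^ m) c) (conv_pow_word c (n - m)) w)"
      unfolding conv_pow_word_Suc by (simp add: sum_divide_distrib)
    also have "\<dots> = (\<Sum>m\<le>n. \<Sum>k=1..length w. ?a k m * ?b k (n - m))"
      by (intro sum.cong refl)
         (simp only: bin atMost_iff concat_prod_def sum_distrib_left, simp)
    finally show ?thesis by (subst sum.swap) 
  qed
  ultimately have "(\<lambda>n. conv_pow_word c (Suc n) w / fact (Suc n)) sums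
       concat_prod (word_W c c) (word_exp c) w" by simp
  then have "(\<lambda>n. conv_pow_word c n w / fact n) sums
       (concat_prod (word_W c c) (word_exp c) w + conv_pow_word c 0 w / fact 0)"
    by (rule sums_Suc)
  moreover have "conv_pow_word c 0 w = 0" using assms by (simp add: word_unit_def)
  ultimately show ?thesis using conv_pow_word_sums[of c w] sums_unique2 by auto
qed

section \<open>Iterated insertions as sums over irreducible partitions\<close>

lemma part_ext_insert_interval:
  assumes "\<sigma> \<in> NC (length w - (j - i))" "i < j" "j \<le> length w"
  shows "part_ext h (insert {i..<j} (expand_blocks i j \<sigma>)) w = part_ext h \<sigma> (excise i j w) * h (slice i j w)"
proof -
  have ij: "i \<le> j" using assms by simp
  have "finite \<sigma>" using NC_imp_nc_family[OF assms(1)] by (simp add: nc_family_def)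
  then show ?thesis
    using insert_interval_NC(2)[OF assms] nths_interval[OF ij assms(3)] nths_expand[OF ij assms(3)]
    by (simp add: part_ext_def prod.reindex[OF inj_image_strict_mono[OF strict_mono_expand]] mult.commute)
qed

text \<open>
  The part of the right-hand side of the first formula that comes from partitions with \<open>m + 1\<close>
  blocks, without the power of \<open>t\<close>.
\<close>

definition irr_sum :: "('a list \<Rightarrow> complex) \<Rightarrow> nat \<Rightarrow> 'a list \<Rightarrow> complex" where
  "irr_sum h m w = (\<Sum>\<pi>\<in>{\<pi>\<in>NC_irr (length w). card \<pi> = Suc m}. part_ext h \<pi> w / of_nat (forest_fact \<pi>))"

lemma NC_irr_single_block:
  assumes "0 < n"
  shows "{\<pi>\<in>NC_irr n. card \<pi> = Suc 0} = {{{..<n}}}"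
proof
  show "{{{..<n}}} \<subseteq> {\<pi>\<in>NC_irr n. card \<pi> = Suc 0}"
    using single_block_NC_irr[OF assms] by simp
  show "{\<pi>\<in>NC_irr n. card \<pi> = Suc 0} \<subseteq> {{{..<n}}}"
  proof
    fix \<pi> assume \<pi>: "\<pi> \<in> {\<pi>\<in>NC_irr n. card \<pi> = Suc 0}"
    then obtain V where V: "\<pi> = {V}" by (auto simp: card_1_singleton_iff)
    have "partition_on {..<n} \<pi>"
      using NC_irr_imp_NC[of \<pi> n] \<pi> by (simp add: NC_def)
    from partition_onD1[OF this] have "{..<n} = V" unfolding V by simp
    then show "\<pi> \<in> {{{..<n}}}" unfolding V by simp
  qed
qed

text \<open>
  Induction on \<open>m\<close>.  One factor \<open>m + 2 = |\<pi>|\<close> of the factorial turns \<open>1 / t(\<pi>)!\<close> into the sum of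
  \<open>1 / t(\<pi> - {U})!\<close> over the leaves \<open>U\<close>, and \<open>leaf_removal\<close> turns pairs \<open>(\<pi>, U)\<close> into an
  inner interval and a smaller partition.
\<close>

lemma insertion_pow_eq_irr_sum:
  assumes "w \<noteq> []"
  shows "(insertion h ^^ m) h w = fact (Suc m) * irr_sum h m w"
  using assms
proof (induction m arbitrary: w)
  case 0
  then show ?case
    by (simp add: irr_sum_def NC_irr_single_block part_ext_def lessThan_empty_iff)
next
  case (Suc m)
  let ?n = "length w"
  let ?P = "{\<pi>\<in>NC_irr ?n. card \<pi> = Suc (Suc m)}"
  let ?F = "\<lambda>\<pi> U. part_ext h \<pi> w / of_nat (forest_fact (\<pi> - {U}))"
  have "fact (Suc (Suc m)) * irr_sum h (Suc m) w =
      fact (Suc m) * (\<Sum>\<pi>\<in>?P. part_ext h \<pi> w * (of_nat (card \<pi>) / of_nat (forest_fact \<pi>)))"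
    unfolding irr_sum_def by (subst fact_Suc) (simp add: sum_distrib_left sum_distrib_right mult_ac)
  also have "(\<Sum>\<pi>\<in>?P. part_ext h \<pi> w * (of_nat (card \<pi>) / of_nat (forest_fact \<pi>))) =
     (\<Sum>\<pi>\<in>?P. \<Sum>U\<in>leaf_blocks \<pi>. ?F \<pi> U)"
  proof (rule sum.cong[OF refl])
    fix \<pi> assume "\<pi> \<in> ?P"
    then have "nc_family \<pi>" using NC_irr_imp_NC NC_imp_nc_family by blast
    then have hook: "of_nat (card \<pi>) / of_nat (forest_fact \<pi>) =
        (\<Sum>U\<in>leaf_blocks \<pi>. 1 / of_nat (forest_fact (\<pi> - {U})) :: complex)"
      using hook_recursion by simp
    show "part_ext h \<pi> w * (of_nat (card \<pi>) / of_nat (forest_fact \<pi>)) = (\<Sum>U\<in>leaf_blocks \<pi>. ?F \<pi> U)"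
      unfolding hook sum_distrib_left by simp
  qed
  also have "\<dots> = (\<Sum>(i,j)\<in>inner_cuts ?n. \<Sum>\<sigma>\<in>{\<sigma>\<in>NC_irr (?n - (j - i)). card \<sigma> = Suc m}.
        ?F (insert {i..<j} (expand_blocks i j \<sigma>)) {i..<j})"
    by (rule leaf_removal)
  also have "\<dots> = (\<Sum>(i,j)\<in>inner_cuts ?n. irr_sum h m (excise i j w) * h (slice i j w))"
  proof (intro sum.cong refl, clarify)
    fix i j assume "(i,j) \<in> inner_cuts ?n"
    then have ij: "i < j" "j \<le> ?n" by (auto simp: inner_cuts_def)
    have "?F (insert {i..<j} (expand_blocks i j \<sigma>)) {i..<j} =
        part_ext h \<sigma> (excise i j w) / of_nat (forest_fact \<sigma>) * h (slice i j w)"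
      if "\<sigma> \<in> NC_irr (?n - (j - i))" for \<sigma>
    proof -
      have \<sigma>: "\<sigma> \<in> NC (?n - (j - i))" using that by (rule NC_irr_imp_NC)
      have "insert {i..<j} (expand_blocks i j \<sigma>) - {{i..<j}} = expand_blocks i j \<sigma>"
        using insert_interval_NC(2)[OF \<sigma> ij] by auto
      then show ?thesis
        using part_ext_insert_interval[OF \<sigma> ij]
          forest_fact_image_strict_mono[OF strict_mono_expand NC_imp_nc_family[OF \<sigma>]] by simp
    qed
    then show "(\<Sum>\<sigma>\<in>{\<sigma>\<in>NC_irr (?n - (j - i)). card \<sigma> = Suc m}.
        ?F (insert {i..<j} (expand_blocks i j \<sigma>)) {i..<j}) =
        irr_sum h m (excise i j w) * h (slice i j w)"
      using ij by (simp add: irr_sum_def length_excise sum_distrib_right)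
  qed
  also have "fact (Suc m) * \<dots> = insertion h ((insertion h ^^ m) h) w"
    unfolding insertion_def[of h "(insertion h ^^ m) h" w] sum_distrib_left
  proof (intro sum.cong refl, clarify)
    fix i j assume "(i,j) \<in> inner_cuts ?n"
    then have "excise i j w \<noteq> []" by (auto simp: inner_cuts_def excise_def)
    from Suc.IH[OF this]
    show "fact (Suc m) * (irr_sum h m (excise i j w) * h (slice i j w)) =
      (insertion h ^^ m) h (excise i j w) * h (slice i j w)"
      by (simp only: mult.assoc)
  qed
  finally show ?case by simp
qed

text \<open>
  The first formula of the theorem, solved for the summand of the one-block partition, whose
  coefficient is 1.
\<close>

function t_cumulant :: "complex \<Rightarrow> ('a list \<Rightarrow> complex) \<Rightarrow> 'a list \<Rightarrow> complex" where
  "t_cumulant t b w =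
     (if w = [] then 0
      else b w - (\<Sum>\<pi>\<in>NC_irr (length w) - {{{..<length w}}}.
             t ^ (card \<pi> - 1) / of_nat (forest_fact \<pi>) * (\<Prod>V\<in>\<pi>. t_cumulant t b (nths w V))))"
  by auto

lemma proper_block_shorter:
  assumes "\<pi> \<in> NC (length w)" "\<pi> \<noteq> {{..<length w}}" "V \<in> \<pi>"
  shows "length (nths w V) < length w" "nths w V \<noteq> []"
proof -
  have sub: "V \<subseteq> {..<length w}" "V \<noteq> {}" "finite V" using NC_block[OF assms(1,3)] by auto
  have eq: "{i. i < length w \<and> i \<in> V} = V" using sub by auto
  have "V \<noteq> {..<length w}"
  proof
    assume V: "V = {..<length w}"
    have "W = V" if W: "W \<in> \<pi>" for W
    proof -
      obtain x where "x \<in> W" "x < length w" using NC_block[OF assms(1) W] by auto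
      then show ?thesis using NC_disjoint[OF assms(1) W assms(3)] V by auto
    qed
    then have "\<pi> = {V}" using assms(3) by blast
    then show False using assms(2) V by simp
  qed
  then have "card V < card {..<length w}"
    using sub by (intro psubset_card_mono) auto
  then show "length (nths w V) < length w"
    unfolding length_nths eq by simp
  have "length (nths w V) \<noteq> 0"
    unfolding length_nths eq using sub by simp
  then show "nths w V \<noteq> []" by auto
qed

termination t_cumulant
proof (relation "measure (\<lambda>(t,b,w). length w)")
  fix t :: complex and b w \<pi> V
  assume "\<pi> \<in> NC_irr (length w) - {{{..<length w}}}" "V \<in> \<pi>"
  then show "((t, b, nths w V), t, b, w) \<in> measure (\<lambda>(t,b,w). length w)"
    using proper_block_shorter(1)[of \<pi> w V] NC_irr_imp_NC by simp
qed simp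

declare t_cumulant.simps [simp del]

lemma t_cumulant_irr_sum:
  assumes "w \<noteq> []"
  shows "b w = (\<Sum>\<pi>\<in>NC_irr (length w).
     t ^ (card \<pi> - 1) / of_nat (forest_fact \<pi>) * part_ext (t_cumulant t b) \<pi> w)"
proof -
  have mem: "{{..<length w}} \<in> NC_irr (length w)" using single_block_NC_irr assms by blast
  show ?thesis
    using assms
    using forest_fact_singleton[of "{..<length w}"] t_cumulant.simps[of t b w]
    by (subst sum.remove[OF finite_NC_irr mem]) (simp_all add: part_ext_def lessThan_empty_iff)
qed

lemma insertion_scale: "insertion (\<lambda>w. t * c w) f w = t * insertion c f w"
  "insertion c (\<lambda>w. t * f w) w = t * insertion c f w"
  by (simp_all add: insertion_def case_prod_unfold sum_distrib_left mult_ac)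

lemma insertion_pow_scale:
  "(insertion (\<lambda>w. t * c w) ^^ m) f = (\<lambda>w. t ^ m * (insertion c ^^ m) f w)"
proof (induction m)
  case (Suc m)
  have "insertion (\<lambda>w. t * c w) (\<lambda>w. t ^ m * (insertion c ^^ m) f w) w =
      t ^ Suc m * insertion c ((insertion c ^^ m) f) w" for w
    unfolding insertion_scale by simp
  then show ?case unfolding funpow.simps o_apply Suc.IH by (rule ext)
qed simp

lemma insertion_pow_scale_arg: "(insertion c ^^ m) (\<lambda>w. t * f w) = (\<lambda>w. t * (insertion c ^^ m) f w)"
proof (induction m)
  case (Suc m)
  show ?case unfolding funpow.simps o_apply Suc.IH insertion_scale by (rule refl)
qed simp

lemma word_W_t_cumulant:
  fixes b :: "'a list \<Rightarrow> complex" and t :: complex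
  assumes "w \<noteq> []"
  defines "h \<equiv> t_cumulant t b"
  shows "word_W (\<lambda>w. t * h w) h w = b w"
proof -
  let ?n = "length w"
  let ?g = "\<lambda>\<pi>. part_ext h \<pi> w / of_nat (forest_fact \<pi>)"
  have card: "card \<pi> - 1 < ?n \<and> card \<pi> \<noteq> 0" if "\<pi> \<in> NC_irr ?n" for \<pi>
  proof -
    have p: "partition_on {..<?n} \<pi>" using that by (auto simp: NC_irr_def NC_def)
    then have "card \<pi> \<le> card {..<?n}"
    proof (intro card_inj_on_le[where f = Min])
      show "inj_on Min \<pi>"
        using NC_block[OF NC_irr_imp_NC[OF that]] NC_disjoint[OF NC_irr_imp_NC[OF that]]
        by (metis inj_onI Min_in)
      show "Min ` \<pi> \<subseteq> {..<?n}"
        using NC_block[OF NC_irr_imp_NC[OF that]] by (metis Min_in image_subsetI subsetD)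
    qed simp
    moreover have "finite \<pi>" "\<pi> \<noteq> {}"
      using finite_elements[OF _ p] that by (auto simp: NC_irr_def)
    ultimately show ?thesis using assms(1) by (cases "card \<pi>") auto
  qed
  have "(insertion (\<lambda>w. t * h w) ^^ m) h w / fact (m + 1) = t ^ m * irr_sum h m w" for m
    unfolding insertion_pow_scale using insertion_pow_eq_irr_sum[OF assms(1), where h=h and m=m]
    by (simp del: fact_Suc)
  then have "word_W (\<lambda>w. t * h w) h w = (\<Sum>m. t ^ m * irr_sum h m w)"
    by (simp add: word_W_def)
  also have "\<dots> = (\<Sum>m<?n. t ^ m * irr_sum h m w)"
  proof (rule suminf_finite)
    fix m assume "m \<notin> {..<?n}"
    then have "{\<pi>\<in>NC_irr ?n. card \<pi> = Suc m} = {}" using card by fastforce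
    then show "t ^ m * irr_sum h m w = 0" by (simp only: irr_sum_def) simp
  qed simp
  also have "\<dots> = (\<Sum>m<?n. \<Sum>\<pi>\<in>{\<pi>\<in>NC_irr ?n. card \<pi> - 1 = m}. t ^ (card \<pi> - 1) * ?g \<pi>)"
    unfolding irr_sum_def sum_distrib_left
    by (intro sum.cong) (use card in force)+
  also have "\<dots> = (\<Sum>\<pi>\<in>NC_irr ?n. t ^ (card \<pi> - 1) * ?g \<pi>)"
    by (rule sum.group) (use card in auto)
  also have "\<dots> = b w"
    unfolding t_cumulant_irr_sum[OF assms(1), of b t] h_def by simp
  finally show ?thesis .
qed

section \<open>The coproduct against infinitesimal characters\<close>

text \<open>
  The infinitesimal character and the character with given values on nonempty words.  Both vanish on
  lists containing the empty word, whatever the functional does there, since such lists stand for no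
  tensor.
\<close>

definition inf_ext :: "('a list \<Rightarrow> complex) \<Rightarrow> 'a form" where
  "inf_ext a ws = (case ws of [w] \<Rightarrow> if w = [] then 0 else a w | _ \<Rightarrow> 0)"

definition char_ext :: "('a list \<Rightarrow> complex) \<Rightarrow> 'a form" where
  "char_ext x ws = (if [] \<in> set ws then 0 else prod_list (map x ws))"

lemma inf_ext_simps [simp]:
  "inf_ext a [] = 0" "w \<noteq> [] \<Longrightarrow> inf_ext a [w] = a w" "inf_ext a [[]] = 0"
  "inf_ext a (v # w # ws) = 0"
  by (simp_all add: inf_ext_def)

lemma inf_ext_eq_0: "length ws \<noteq> 1 \<Longrightarrow> inf_ext a ws = 0"
  by (cases ws rule: remdups_adj.cases) auto

lemma inf_ext_cong: "(\<And>w. w \<noteq> [] \<Longrightarrow> a w = b w) \<Longrightarrow> inf_ext a = inf_ext b"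
  by (rule ext) (auto simp: inf_ext_def split: list.split)

lemma gaps_full: "gaps w {..<length w} = []"
  by (simp add: gaps_def)

lemma gaps_interval:
  assumes "i < j" "j \<le> length w"
  shows "gaps w ({..<length w} - {i..<j}) = [slice i j w]"
proof -
  have C: "{..<length w} - ({..<length w} - {i..<j}) = {i..<j}" using assms by auto
  have start: "{k \<in> {i..<j}. k = 0 \<or> k - 1 \<notin> {i..<j}} = {i}" using assms by auto
  have run: "{k. i \<le> k \<and> {i..k} \<subseteq> {i..<j}} = {i..<j}" using assms by auto
  show ?thesis
    unfolding gaps_def Let_def C start using assms by (simp add: run nths_interval)
qed

text \<open>
  Every connected component of the complement of \<open>S\<close> contributes its least element as a starting
  point; a second starting point appears as soon as the complement is not an interval.
\<close>

lemma gaps_le_1: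
  assumes "S \<subseteq> {..<length w}" "length (gaps w S) \<le> 1"
  shows "S = {..<length w} \<or> (\<exists>(i,j)\<in>all_cuts (length w). S = {..<length w} - {i..<j})"
proof (cases "S = {..<length w}")
  case False
  define C where "C = {..<length w} - S"
  define St where "St = {i \<in> C. i = 0 \<or> i - 1 \<notin> C}"
  have C: "finite C" "C \<noteq> {}" "S = {..<length w} - C"
    using assms(1) False by (auto simp: C_def)
  have card: "card St \<le> 1"
    using assms(2) unfolding St_def C_def by (simp add: gaps_def Let_def)
  have finSt: "finite St" using C by (simp add: St_def)
  define i where "i = Min C"
  define j where "j = Suc (Max C)"
  have iC: "i \<in> C" using C by (simp add: i_def)
  have "i = 0 \<or> i - 1 \<notin> C"
  proof (rule ccontr)
    assume "\<not> (i = 0 \<or> i - 1 \<notin> C)"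
    then have "i \<le> i - 1" "i \<noteq> 0" using Min_le[OF C(1)] by (auto simp: i_def)
    then show False by simp
  qed
  then have iS: "i \<in> St" using iC by (simp add: St_def)
  have "C = {i..<j}"
  proof (rule ccontr)
    assume "C \<noteq> {i..<j}"
    moreover have "C \<subseteq> {i..<j}" using C by (auto simp: i_def j_def less_Suc_eq_le)
    ultimately obtain x where x: "i \<le> x" "x < j" "x \<notin> C"
      by (metis atLeastLessThan_iff subsetI subset_antisym)
    have MC: "Max C \<in> C" using C by simp
    have xM: "x < Max C" using x MC by (metis j_def le_neq_implies_less less_Suc_eq_le)
    \<comment> \<open>The first element of the complement after the missing position \<open>x\<close> starts a second gap.\<close>
    define y where "y = (LEAST y. x < y \<and> y \<in> C)"
    have y: "x < y" "y \<in> C" using LeastI[of "\<lambda>y. x < y \<and> y \<in> C" "Max C"] xM MC by (auto simp: y_def)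
    have "y - 1 \<notin> C"
    proof
      assume "y - 1 \<in> C"
      moreover have "x < y - 1"
      proof -
        have "y - 1 \<noteq> x" using \<open>y - 1 \<in> C\<close> x(3) by auto
        then show ?thesis using y(1) by linarith
      qed
      ultimately have "y \<le> y - 1"
        using Least_le[of "\<lambda>y. x < y \<and> y \<in> C" "y - 1"] by (simp add: y_def)
      then show False using y(1) by simp
    qed
    then have "y \<in> St" using y by (simp add: St_def)
    moreover have "y \<noteq> i" using y x by simp
    ultimately have "{i,y} \<subseteq> St" "card {i,y} = 2" using iS by auto
    then show False using card card_mono[OF finSt, of "{i,y}"] by simp
  qed
  moreover have "i < j" using Max_ge[OF C(1) iC] by (simp add: j_def)
  moreover have "Max C < length w" using Max_in[OF C(1,2)] unfolding C_def by blast
  then have "j \<le> length w" by (simp add: j_def)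
  ultimately have "(i,j) \<in> all_cuts (length w) \<and> S = {..<length w} - {i..<j}"
    using C(3) by (simp add: all_cuts_def)
  then show ?thesis by blast
qed simp

lemma nths_compl_interval:
  assumes "i < j" "j \<le> length w"
  shows "nths w ({..<length w} - {i..<j}) = excise i j w"
proof -
  have "nths w ({..<length w} - {i..<j}) = nths (excise i j w) {..<length w - (j - i)}"
    using assms by (simp add: image_expand_lessThan[symmetric] nths_expand)
  then show ?thesis using assms by (simp add: length_excise)
qed

lemma inj_on_compl_interval: "inj_on (\<lambda>(i,j). {..<n} - {i..<j}) (all_cuts n)"
proof (rule inj_onI, clarify)
  fix i j i' j' assume a: "(i,j) \<in> all_cuts n" "(i',j') \<in> all_cuts n"
    and eq: "{..<n} - {i..<j} = {..<n} - {i'..<j'}"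
  have "{i..<j} = {..<n} - ({..<n} - {i..<j})" "{i'..<j'} = {..<n} - ({..<n} - {i'..<j'})"
    using a by (auto simp: all_cuts_def)
  then have "{i..<j} = {i'..<j'}" using eq by simp
  then show "i = i' \<and> j = j'"
    using a atLeastLessThan_inj[of i j i' j'] by (auto simp: all_cuts_def)
qed

text \<open>
  If only tensors with at most one factor on the right matter, the coproduct of a word reduces to the
  set of all positions and to the complements of single intervals.
\<close>

lemma sum_coprod_over:
  fixes G :: "'a list list \<Rightarrow> 'a list list \<Rightarrow> complex"
  assumes G: "\<And>u v. 1 < length v \<Longrightarrow> G u v = 0" and "w \<noteq> []"
  shows "(\<Sum>(u,v)\<in>#coprod_over \<S> w. G u v) =
    (if {..<length w} \<in> \<S> then G [w] [] else 0) +
    (\<Sum>(i,j)\<in>{(i,j)\<in>all_cuts (length w). {..<length w} - {i..<j} \<in> \<S>}.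
        G (word_tensor (excise i j w)) [slice i j w])"
proof -
  let ?n = "length w"
  let ?c = "\<lambda>(i,j). {..<?n} - {i..<j}"
  let ?I = "{(i,j)\<in>all_cuts ?n. {..<?n} - {i..<j} \<in> \<S>}"
  let ?g = "\<lambda>S. G (word_tensor (nths w S)) (gaps w S)"
  let ?T = "{S. S = {..<?n} \<and> S \<in> \<S>}"
  have finI: "finite ?I" by (rule finite_subset[OF _ finite_all_cuts[of ?n]]) auto
  have "(\<Sum>(u,v)\<in>#coprod_over \<S> w. G u v) = (\<Sum>S\<in>{S \<in> \<S>. S \<subseteq> {..<?n}}. ?g S)"
    using assms(2) by (simp add: coprod_over_def sum_unfold_sum_mset image_mset.compositionality comp_def)
  also have "\<dots> = (\<Sum>S\<in>?T \<union> ?c ` ?I. ?g S)"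
  proof (rule sum.mono_neutral_right)
    show "finite {S \<in> \<S>. S \<subseteq> {..<?n}}" by (rule finite_subset[of _ "Pow {..<?n}"]) auto
    show "?T \<union> ?c ` ?I \<subseteq> {S \<in> \<S>. S \<subseteq> {..<?n}}" by auto
    show "\<forall>S\<in>{S \<in> \<S>. S \<subseteq> {..<?n}} - (?T \<union> ?c ` ?I). ?g S = 0"
    proof
      fix S assume S: "S \<in> {S \<in> \<S>. S \<subseteq> {..<?n}} - (?T \<union> ?c ` ?I)"
      have "\<not> length (gaps w S) \<le> 1"
      proof
        assume "length (gaps w S) \<le> 1"
        then have "S = {..<?n} \<or> (\<exists>(i,j)\<in>all_cuts ?n. S = {..<?n} - {i..<j})"
          using gaps_le_1 S by blast
        then show False using S by auto
      qed
      then show "?g S = 0" using G by simp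
    qed
  qed
  also have "\<dots> = (\<Sum>S\<in>?T. ?g S) + (\<Sum>S\<in>?c ` ?I. ?g S)"
  proof (rule sum.union_disjoint)
    show "?T \<inter> ?c ` ?I = {}"
    proof -
      have "{..<?n} - {i..<j} \<noteq> {..<?n}" if "(i,j) \<in> all_cuts ?n" for i j
      proof -
        have "i \<in> {..<?n}" "i \<in> {i..<j}" using that by (auto simp: all_cuts_def)
        then show ?thesis by blast
      qed
      then show ?thesis by blast
    qed
  qed (use finI in auto)
  also have "(\<Sum>S\<in>?T. ?g S) = (if {..<?n} \<in> \<S> then G [w] [] else 0)"
  proof (cases "{..<?n} \<in> \<S>")
    case True
    then have "?T = {{..<?n}}" by blast
    then show ?thesis using True assms(2) by (simp add: gaps_full word_tensor_def)
  next
    case False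
    then have "?T = {}" by blast
    then show ?thesis using False by (simp only: sum.empty if_False)
  qed
  also have "(\<Sum>S\<in>?c ` ?I. ?g S) = (\<Sum>(i,j)\<in>?I. G (word_tensor (excise i j w)) [slice i j w])"
  proof -
    have "inj_on ?c ?I" by (rule inj_on_subset[OF inj_on_compl_interval]) auto
    from sum.reindex[OF this, of ?g] show ?thesis
      by (simp only:) (auto simp: all_cuts_def nths_compl_interval gaps_interval intro!: sum.cong)
  qed
  finally show ?thesis .
qed

lemma tensor_mult_empty [simp]: "tensor_mult M {#} = {#}"
  unfolding tensor_mult_def by (induction M) auto

lemma sum_tensor_mult:
  fixes G :: "'a list list \<Rightarrow> 'a list list \<Rightarrow> complex"
  shows "(\<Sum>(u,v)\<in>#tensor_mult M N. G u v) =
    (\<Sum>(u,v)\<in>#M. \<Sum>(u',v')\<in>#N. G (u @ u') (v @ v'))"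
  unfolding tensor_mult_def
  by (induction M) (auto simp: image_mset.compositionality comp_def case_prod_unfold)

lemma coprod_empty_word [simp]: "[] \<in> set ws \<Longrightarrow> coprod ws = {#}"
  by (induction ws) (auto simp: coprod_over_def, simp add: tensor_mult_def)

lemma sum_coprod_trivial:
  fixes G :: "'a list list \<Rightarrow> 'a list list \<Rightarrow> complex"
  assumes "\<And>u v. v \<noteq> [] \<Longrightarrow> G u v = 0"
  shows "(\<Sum>(u,v)\<in>#coprod ws. G u v) = (if [] \<in> set ws then 0 else G ws [])"
  using assms
proof (induction ws arbitrary: G)
  case (Cons w ws)
  show ?case
  proof (cases "[] \<in> set (w # ws)")
    case False
    let ?H = "\<lambda>u v. \<Sum>(u',v')\<in>#coprod ws. G (u @ u') (v @ v')"
    have H0: "?H u v = 0" if "v \<noteq> []" for u v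
      using that Cons.prems by (simp add: case_prod_unfold)
    have "(\<Sum>(u,v)\<in>#coprod (w # ws). G u v) = (\<Sum>(u,v)\<in>#coprod_over UNIV w. ?H u v)"
      by (simp only: coprod.simps sum_tensor_mult)
    also have "\<dots> = ?H [w] [] + (\<Sum>(i,j)\<in>{(i,j)\<in>all_cuts (length w). {..<length w} - {i..<j} \<in> UNIV}.
        ?H (word_tensor (excise i j w)) [slice i j w])"
    proof -
      have "?H u v = 0" if "1 < length v" for u v using that by (intro H0) auto
      moreover have "w \<noteq> []" using False by auto
      ultimately show ?thesis
        using sum_coprod_over[where G="?H" and \<S>=UNIV and w=w] by simp
    qed
    also have "\<dots> = ?H [w] []"
    proof -
      have "(\<Sum>(i,j)\<in>{(i,j)\<in>all_cuts (length w). {..<length w} - {i..<j} \<in> UNIV}.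
        ?H (word_tensor (excise i j w)) [slice i j w]) = 0"
      proof (intro sum.neutral ballI, clarify)
        fix i j show "?H (word_tensor (excise i j w)) [slice i j w] = 0" by (rule H0) simp
      qed
      then show ?thesis by (simp only: add_0_right)
    qed
    also have "\<dots> = G (w # ws) []"
      using Cons.IH[of "\<lambda>u v. G (w # u) v"] Cons.prems False by simp
    finally show ?thesis using False by simp
  next
    case True
    then have "coprod (w # ws) = {#}" by (rule coprod_empty_word)
    then show ?thesis using True by (simp del: coprod.simps)
  qed
qed simp

text \<open>
  An infinitesimal character on the right selects exactly one right tensor factor: either it is cut out of
  the first word and the other words remain untouched, or the first word remains untouched.
\<close>

lemma sum_tensor_mult_inf_ext:
  assumes "w \<noteq> []" "[] \<notin> set ws"
  shows "(\<Sum>(u,v)\<in>#tensor_mult (coprod_over \<S> w) (coprod ws). f u * inf_ext c v) =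
    (if {..<length w} \<in> \<S> then conv (\<lambda>u. f (w # u)) (inf_ext c) ws else 0) +
    (\<Sum>(i,j)\<in>{(i,j)\<in>all_cuts (length w). {..<length w} - {i..<j} \<in> \<S>}.
       f (word_tensor (excise i j w) @ ws) * c (slice i j w))"
proof -
  let ?H = "\<lambda>u v. \<Sum>(u',v')\<in>#coprod ws. f (u @ u') * inf_ext c (v @ v')"
  have H0: "?H u v = 0" if "1 < length v" for u v
    using that by (simp add: case_prod_unfold inf_ext_eq_0)
  have "(\<Sum>(u,v)\<in>#tensor_mult (coprod_over \<S> w) (coprod ws). f u * inf_ext c v) =
     (\<Sum>(u,v)\<in>#coprod_over \<S> w. ?H u v)"
    by (rule sum_tensor_mult)
  also have "\<dots> = (if {..<length w} \<in> \<S> then ?H [w] [] else 0) +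
    (\<Sum>(i,j)\<in>{(i,j)\<in>all_cuts (length w). {..<length w} - {i..<j} \<in> \<S>}.
        ?H (word_tensor (excise i j w)) [slice i j w])"
    using H0 assms(1) by (rule sum_coprod_over)
  also have "?H [w] [] = conv (\<lambda>u. f (w # u)) (inf_ext c) ws"
    by (simp add: conv_def)
  also have "(\<Sum>(i,j)\<in>{(i,j)\<in>all_cuts (length w). {..<length w} - {i..<j} \<in> \<S>}.
        ?H (word_tensor (excise i j w)) [slice i j w]) =
     (\<Sum>(i,j)\<in>{(i,j)\<in>all_cuts (length w). {..<length w} - {i..<j} \<in> \<S>}.
       f (word_tensor (excise i j w) @ ws) * c (slice i j w))"
  proof (intro sum.cong refl, clarify)
    fix i j assume "(i,j) \<in> all_cuts (length w)"
    then have "slice i j w \<noteq> []" by (auto simp: all_cuts_def slice_def)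
    then show "?H (word_tensor (excise i j w)) [slice i j w] =
        f (word_tensor (excise i j w) @ ws) * c (slice i j w)"
      using assms(2) by (subst sum_coprod_trivial) (auto simp: inf_ext_eq_0)
  qed
  finally show ?thesis .
qed

lemma conv_inf_ext_Nil [simp]: "conv f (inf_ext c) [] = 0"
  by (simp add: conv_def)

lemma conv_inf_ext_Cons:
  assumes "w \<noteq> []" "[] \<notin> set ws"
  shows "conv f (inf_ext c) (w # ws) =
     (\<Sum>(i,j)\<in>all_cuts (length w). f (word_tensor (excise i j w) @ ws) * c (slice i j w)) +
     conv (\<lambda>u. f (w # u)) (inf_ext c) ws"
  using sum_tensor_mult_inf_ext[OF assms, where \<S>=UNIV and f=f and c=c] by (simp add: conv_def add.commute)

lemma half_prec_inf_ext_Cons: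
  assumes "w \<noteq> []" "[] \<notin> set ws"
  shows "half_prec f (inf_ext c) (w # ws) = conv (\<lambda>u. f (w # u)) (inf_ext c) ws +
     (\<Sum>(i,j)\<in>{(i,j)\<in>all_cuts (length w). 1 \<le> i}. f (excise i j w # ws) * c (slice i j w))"
proof -
  have "{(i,j)\<in>all_cuts (length w). {..<length w} - {i..<j} \<in> {S. 0 \<in> S}} = {(i,j)\<in>all_cuts (length w). 1 \<le> i}"
    by (auto simp: all_cuts_def)
  then have "half_prec f (inf_ext c) (w # ws) = conv (\<lambda>u. f (w # u)) (inf_ext c) ws +
     (\<Sum>(i,j)\<in>{(i,j)\<in>all_cuts (length w). 1 \<le> i}. f (word_tensor (excise i j w) @ ws) * c (slice i j w))"
    using sum_tensor_mult_inf_ext[OF assms, where \<S>="{S. 0 \<in> S}" and f=f and c=c] assms(1)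
    by (simp add: half_prec_def)
  also have "(\<Sum>(i,j)\<in>{(i,j)\<in>all_cuts (length w). 1 \<le> i}. f (word_tensor (excise i j w) @ ws) * c (slice i j w))
    = (\<Sum>(i,j)\<in>{(i,j)\<in>all_cuts (length w). 1 \<le> i}. f (excise i j w # ws) * c (slice i j w))"
    by (intro sum.cong) (auto simp: word_tensor_def excise_def all_cuts_def)
  finally show ?thesis .
qed

lemma half_succ_inf_ext_Cons:
  assumes "w \<noteq> []" "[] \<notin> set ws"
  shows "half_succ f (inf_ext c) (w # ws) =
     (\<Sum>k=1..length w. f (word_tensor (drop k w) @ ws) * c (take k w))"
proof -
  have "{(i,j)\<in>all_cuts (length w). {..<length w} - {i..<j} \<in> {S. 0 \<notin> S}} = (\<lambda>k. (0,k)) ` {1..length w}"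
    using assms(1) by (auto simp: all_cuts_def image_iff)
  then have "half_succ f (inf_ext c) (w # ws) =
     (\<Sum>(i,j)\<in>(\<lambda>k. (0,k)) ` {1..length w}. f (word_tensor (excise i j w) @ ws) * c (slice i j w))"
    using sum_tensor_mult_inf_ext[OF assms, where \<S>="{S. 0 \<notin> S}" and f=f and c=c] assms(1)
    by (simp add: half_succ_def)
  also have "\<dots> = (\<Sum>k=1..length w. f (word_tensor (drop k w) @ ws) * c (take k w))"
    by (subst sum.reindex) (auto simp: inj_on_def excise_def slice_def)
  finally show ?thesis .
qed

lemma half_empty_word:
  assumes "[] \<in> set ws"
  shows "half_prec f g ws = 0" "half_succ f g ws = 0"
proof -
  obtain w vs where ws: "ws = w # vs" using assms by (cases ws) auto
  have "tensor_mult (coprod_over \<S> w) (coprod vs) = {#}" for \<S>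
    using assms ws by (cases "w = []") (simp_all add: coprod_over_def, simp add: tensor_mult_def)
  then show "half_prec f g ws = 0" "half_succ f g ws = 0"
    by (simp_all add: ws half_prec_def half_succ_def)
qed

lemma conv_empty_word: "[] \<in> set ws \<Longrightarrow> conv f g ws = 0"
  by (simp add: conv_def)

lemma conv_sum:
  "conv (\<lambda>u. \<Sum>m\<in>M. a m * f m u) g ws = (\<Sum>m\<in>M. a m * conv (f m) g ws)"
proof -
  have "(\<Sum>p\<in>#X. (\<Sum>m\<in>M. a m * f m (fst p)) * g (snd p)) = (\<Sum>m\<in>M. a m * (\<Sum>p\<in>#X. f m (fst p) * g (snd p)))" for X
    by (induction X) (simp_all add: sum.distrib distrib_left sum_distrib_right mult.assoc)
  then show ?thesis by (simp add: conv_def case_prod_unfold)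
qed

section \<open>The two exponentials\<close>

lemma conv_power_Nil [simp]: "conv_power (inf_ext c) n [] = (if n = 0 then 1 else 0)"
  by (cases n) (simp_all add: counit_def)

lemma conv_power_empty_word: "[] \<in> set ws \<Longrightarrow> conv_power \<alpha> n ws = 0"
  by (cases n) (auto simp: counit_def conv_empty_word)

lemma pascal_sum:
  fixes X :: "nat \<Rightarrow> nat \<Rightarrow> complex"
  shows "(\<Sum>m\<le>n. of_nat (n choose m) * (X (Suc m) (n - m) + X m (Suc (n - m)))) =
         (\<Sum>m\<le>Suc n. of_nat (Suc n choose m) * X m (Suc n - m))"
proof -
  have top: "n choose Suc n = 0" by (rule binomial_eq_0) simp
  have "(\<Sum>m\<le>Suc n. of_nat (Suc n choose m) * X m (Suc n - m)) =
     X 0 (Suc n) + (\<Sum>m\<le>n. of_nat (n choose m) * X (Suc m) (n - m))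
       + (\<Sum>m\<le>n. of_nat (n choose Suc m) * X (Suc m) (n - m))"
    by (subst sum.atMost_Suc_shift) (simp add: distrib_right sum.distrib)
  also have "X 0 (Suc n) + (\<Sum>m\<le>n. of_nat (n choose m) * X (Suc m) (n - m))
       + (\<Sum>m\<le>n. of_nat (n choose Suc m) * X (Suc m) (n - m)) =
     (\<Sum>m\<le>n. of_nat (n choose m) * X (Suc m) (n - m)) + (\<Sum>m\<le>Suc n. of_nat (n choose m) * X m (Suc n - m))"
    using sum.atMost_Suc_shift[of "\<lambda>m. of_nat (n choose m) * X m (Suc n - m)" n] by simp
  also have "(\<Sum>m\<le>Suc n. of_nat (n choose m) * X m (Suc n - m)) = (\<Sum>m\<le>n. of_nat (n choose m) * X m (Suc (n - m)))"
    by (simp add: top Suc_diff_le)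
  finally show ?thesis by (simp add: distrib_left sum.distrib)
qed

text \<open>
  Infinitesimal characters are primitive, so their convolution powers are expanded over a
  product by the binomial formula.  This makes \<open>exp\<^sup>*\<close> of an infinitesimal character
  multiplicative.
\<close>

lemma conv_power_Cons:
  assumes "w \<noteq> []"
  shows "conv_power (inf_ext c) n (w # ws) =
     (\<Sum>m\<le>n. of_nat (n choose m) * (conv_pow_word c m w * conv_power (inf_ext c) (n - m) ws))"
  using assms
proof (induction n arbitrary: w ws)
  case 0
  then show ?case by (simp add: counit_def word_unit_def)
next
  case (Suc n)
  let ?P = "conv_power (inf_ext c)"
  show ?case
  proof (cases "[] \<in> set ws")
    case True
    then show ?thesis by (simp add: conv_power_empty_word del: conv_power.simps)
  next
    case False
    have IH: "?P n (word_tensor v @ ws) =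
        (\<Sum>m\<le>n. of_nat (n choose m) * (conv_pow_word c m v * ?P (n - m) ws))" for v
    proof (cases "v = []")
      case True
      have "conv_pow_word c m [] = (if m = 0 then 1 else 0)" for m
        using conv_pow_word_vanish[of "[]" m] by (cases "m = 0") (auto simp: word_unit_def)
      then have "(\<Sum>m\<le>n. of_nat (n choose m) * (conv_pow_word c m v * ?P (n - m) ws)) =
          (\<Sum>m\<le>n. if m = 0 then ?P n ws else 0)"
        unfolding True by (intro sum.cong) auto
      then show ?thesis using True by (simp add: word_tensor_def)
    next
      case False
      then show ?thesis using Suc.IH by (simp add: word_tensor_def)
    qed
    have "?P (Suc n) (w # ws) =
       (\<Sum>(i,j)\<in>all_cuts (length w). ?P n (word_tensor (excise i j w) @ ws) * c (slice i j w)) +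
       conv (\<lambda>u. ?P n (w # u)) (inf_ext c) ws"
      using Suc.prems False by (simp add: conv_inf_ext_Cons)
    also have "(\<Sum>(i,j)\<in>all_cuts (length w). ?P n (word_tensor (excise i j w) @ ws) * c (slice i j w)) =
       (\<Sum>m\<le>n. of_nat (n choose m) * (conv_pow_word c (Suc m) w * ?P (n - m) ws))"
      unfolding IH funpow.simps o_apply right_conv_def[of c "conv_pow_word c _" w]
      unfolding case_prod_unfold sum_distrib_left sum_distrib_right
      by (subst sum.swap) (simp add: mult_ac)
    also have "conv (\<lambda>u. ?P n (w # u)) (inf_ext c) ws =
        (\<Sum>m\<le>n. of_nat (n choose m) * (conv_pow_word c m w * ?P (Suc (n - m)) ws))"
      unfolding Suc.IH[OF Suc.prems] mult.assoc[symmetric] conv_sum by simp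
    finally show ?thesis
      using pascal_sum[of n "\<lambda>m k. conv_pow_word c m w * ?P k ws"]
      by (simp only: sum.distrib distrib_left)
  qed
qed

lemma conv_power_vanish: "length (concat ws) < n \<Longrightarrow> conv_power (inf_ext c) n ws = 0"
proof (induction ws arbitrary: n)
  case (Cons w ws)
  show ?case
  proof (cases "w = []")
    case False
    have "conv_pow_word c m w * conv_power (inf_ext c) (n - m) ws = 0" if "m \<le> n" for m
      using Cons that conv_pow_word_vanish[of w m] by (cases "length w < m") auto
    then show ?thesis by (subst conv_power_Cons[OF False]) (auto intro!: sum.neutral)
  qed (simp add: conv_power_empty_word)
qed simp

lemma exp_conv_inf_ext: "exp_conv (inf_ext c) = char_ext (word_exp c)"
proof
  fix ws
  have "(\<lambda>n. conv_power (inf_ext c) n ws / fact n) sums char_ext (word_exp c) ws"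
  proof (induction ws)
    case Nil
    then show ?case using sums_single[of 0 "\<lambda>_. 1 :: complex"] by (simp add: char_ext_def if_distrib[of "\<lambda>x. x / _"] cong: if_cong)
  next
    case (Cons w ws)
    show ?case
    proof (cases "w = []")
      case True
      then show ?thesis by (simp add: conv_power_empty_word char_ext_def)
    next
      case False
      have "(\<lambda>n. \<Sum>m\<le>n. (conv_pow_word c m w / fact m) * (conv_power (inf_ext c) (n - m) ws / fact (n - m)))
         sums ((\<Sum>n. conv_pow_word c n w / fact n) * (\<Sum>n. conv_power (inf_ext c) n ws / fact n))"
        by (rule binomial_convolution_sums[of "length w + length (concat ws)"])
           (simp_all add: conv_power_vanish conv_pow_word_vanish)
      moreover have "(\<Sum>n. conv_power (inf_ext c) n ws / fact n) = char_ext (word_exp c) ws"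
        using Cons.IH by (rule sums_unique[symmetric])
      moreover have "(\<Sum>m\<le>n. (conv_pow_word c m w / fact m) * (conv_power (inf_ext c) (n - m) ws / fact (n - m)))
         = conv_power (inf_ext c) n (w # ws) / fact n" for n
        unfolding conv_power_Cons[OF False] sum_divide_distrib
        by (intro sum.cong refl) (simp add: binomial_fact)
      ultimately have "(\<lambda>n. conv_power (inf_ext c) n (w # ws) / fact n) sums
          (word_exp c w * char_ext (word_exp c) ws)"
        by (simp add: word_exp_def)
      then show ?thesis using False by (simp add: char_ext_def split: if_splits)
    qed
  qed
  then show "exp_conv (inf_ext c) ws = char_ext (word_exp c) ws"
    unfolding exp_conv_def by (rule sums_unique[symmetric])
qed

lemma length_word_tensor: "length (concat (word_tensor w @ ws)) = length w + length (concat ws)"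
  by (simp add: word_tensor_def)

lemma succ_power_empty_word: "[] \<in> set ws \<Longrightarrow> succ_power \<alpha> n ws = 0"
  by (cases n) (auto simp: counit_def half_empty_word)

lemma succ_power_vanish: "length (concat ws) < n \<Longrightarrow> succ_power (inf_ext b) n ws = 0"
proof (induction n arbitrary: ws)
  case (Suc n)
  show ?case
  proof (cases "[] \<in> set ws")
    case False
    show ?thesis
    proof (cases ws)
      case (Cons w vs)
      have "succ_power (inf_ext b) n (word_tensor (drop k w) @ vs) = 0" if "k \<in> {1..length w}" for k
        using that Suc.prems by (intro Suc.IH) (auto simp: length_word_tensor Cons simp del: concat_append)
      moreover have "w \<noteq> []" "[] \<notin> set vs" using False Cons by auto
      ultimately show ?thesis by (simp add: Cons half_succ_inf_ext_Cons)
    qed (simp add: half_succ_def)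
  qed (simp add: half_empty_word)
qed simp

lemma succ_power_sums: "(\<lambda>n. succ_power (inf_ext b) n ws) sums exp_succ (inf_ext b) ws"
  unfolding exp_succ_def
  by (rule summable_sums, rule summable_finite[of "{..length (concat ws)}"])
     (auto simp: succ_power_vanish not_le)

lemma exp_succ_Nil: "exp_succ (inf_ext b) [] = 1"
proof -
  have "succ_power (inf_ext b) n [] = (if n = 0 then 1 else 0)" for n
    by (cases n) (simp_all add: counit_def half_succ_def)
  then have "(\<lambda>n. succ_power (inf_ext b) n []) sums 1"
    using sums_single[of 0 "\<lambda>_. 1 :: complex"] by simp
  then show ?thesis using succ_power_sums sums_unique2 by blast
qed

lemma exp_succ_empty_word: "[] \<in> set ws \<Longrightarrow> exp_succ \<alpha> ws = 0"
  by (simp add: exp_succ_def succ_power_empty_word)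

lemma exp_succ_Cons:
  assumes "w \<noteq> []" "[] \<notin> set ws"
  shows "exp_succ (inf_ext b) (w # ws) =
     (\<Sum>k=1..length w. exp_succ (inf_ext b) (word_tensor (drop k w) @ ws) * b (take k w))"
proof -
  have "(\<lambda>n. \<Sum>k=1..length w. succ_power (inf_ext b) n (word_tensor (drop k w) @ ws) * b (take k w)) sums
     (\<Sum>k=1..length w. exp_succ (inf_ext b) (word_tensor (drop k w) @ ws) * b (take k w))"
    by (intro sums_sum sums_mult2 succ_power_sums)
  then have "(\<lambda>n. succ_power (inf_ext b) (Suc n) (w # ws)) sums
     (\<Sum>k=1..length w. exp_succ (inf_ext b) (word_tensor (drop k w) @ ws) * b (take k w))"
    using assms by (simp add: half_succ_inf_ext_Cons)
  from sums_Suc[OF this] show ?thesis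
    using succ_power_sums[of b "w # ws"] sums_unique2 by (fastforce simp: counit_def)
qed

text \<open>
  Both sides satisfy the recursion \<open>exp_succ_Cons\<close>, which shortens the total length.
\<close>

lemma exp_succ_eq_char_ext:
  assumes "x [] = 1" "\<And>w. w \<noteq> [] \<Longrightarrow> x w = concat_prod b x w"
  shows "exp_succ (inf_ext b) = char_ext x"
proof
  fix ws
  show "exp_succ (inf_ext b) ws = char_ext x ws"
  proof (induction "length (concat ws)" arbitrary: ws rule: less_induct)
    case less
    show ?case
    proof (cases "[] \<in> set ws")
      case True
      then show ?thesis by (simp add: exp_succ_empty_word char_ext_def)
    next
      case False
      show ?thesis
      proof (cases ws)
        case Nil
        then show ?thesis by (simp add: exp_succ_Nil char_ext_def)
      next
        case (Cons w vs)
        have "exp_succ (inf_ext b) (word_tensor (drop k w) @ vs) = x (drop k w) * char_ext x vs"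
          if "k \<in> {1..length w}" for k
        proof -
          have "exp_succ (inf_ext b) (word_tensor (drop k w) @ vs) = char_ext x (word_tensor (drop k w) @ vs)"
            using that by (intro less) (auto simp: Cons length_word_tensor simp del: concat_append)
          then show ?thesis using assms(1) False Cons by (auto simp: char_ext_def word_tensor_def)
        qed
        moreover have "w \<noteq> []" "[] \<notin> set vs" using False Cons by auto
        ultimately have "exp_succ (inf_ext b) ws = concat_prod b x w * char_ext x vs"
          by (simp add: Cons exp_succ_Cons concat_prod_def sum_distrib_left mult_ac)
        then show ?thesis using False assms(2)[of w] by (auto simp: Cons char_ext_def)
      qed
    qed
  qed
qed

lemma exp_succ_inf_ext_inject:
  assumes "exp_succ (inf_ext a) = exp_succ (inf_ext b)" "w \<noteq> []"
  shows "a w = b w"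
  using assms(2)
proof (induction "length w" arbitrary: w rule: less_induct)
  case less
  let ?E = "\<lambda>k. exp_succ (inf_ext b) (word_tensor (drop k w))"
  have split: "{1..length w} = insert (length w) {1..<length w}" using less.prems by (auto simp: Suc_le_eq)
  have "(\<Sum>k=1..length w. ?E k * a (take k w)) = (\<Sum>k=1..length w. ?E k * b (take k w))"
    using exp_succ_Cons[of w "[]" a] exp_succ_Cons[of w "[]" b] assms(1) less.prems by simp
  moreover have "(\<Sum>k\<in>{1..<length w}. ?E k * a (take k w)) = (\<Sum>k\<in>{1..<length w}. ?E k * b (take k w))"
  proof (intro sum.cong refl)
    fix k assume "k \<in> {1..<length w}"
    then show "?E k * a (take k w) = ?E k * b (take k w)"
      using less.hyps[of "take k w"] less.prems by auto
  qed
  ultimately show ?case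
    unfolding split by (simp add: word_tensor_def exp_succ_Nil)
qed

section \<open>The pre-Lie product and the operator W\<close>

text \<open>
  On one word, the summands of \<open>a \<prec> c\<close> whose interval reaches the end of the word cancel
  against \<open>c \<succ> a\<close>.  On two words, both half-products equal the product of the two values; this is
  why their difference is again an infinitesimal character.
\<close>

lemma pre_lie_inf_ext: "pre_lie (inf_ext a) (inf_ext c) = inf_ext (insertion c a)"
proof
  fix ws :: "'a list list"
  consider "ws = []" | "[] \<in> set ws" | w where "ws = [w]" "w \<noteq> []"
    | w vs where "ws = w # vs" "vs \<noteq> []" "[] \<notin> set ws"
  proof (cases ws)
    case (Cons w vs)
    then show ?thesis using that by (cases "[] \<in> set ws"; cases vs) auto
  qed (use that in auto)
  then show "pre_lie (inf_ext a) (inf_ext c) ws = inf_ext (insertion c a) ws"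
  proof cases
    case 1
    then show ?thesis by (simp add: pre_lie_def half_prec_def half_succ_def)
  next
    case 2
    then have "inf_ext (insertion c a) ws = 0" by (auto simp: inf_ext_def split: list.split)
    then show ?thesis using 2 by (simp add: pre_lie_def half_empty_word)
  next
    case 3
    let ?n = "length w"
    \<comment> \<open>\<open>?B\<close> contains the intervals that reach the end of the word; they will cancel.\<close>
    let ?B = "(\<lambda>i. (i, ?n)) ` {1..<?n}"
    have dec: "{(i,j)\<in>all_cuts ?n. 1 \<le> i} = inner_cuts ?n \<union> ?B" "inner_cuts ?n \<inter> ?B = {}"
      by (auto simp: all_cuts_def inner_cuts_def)
    have ne: "excise i j w \<noteq> []" if "(i,j) \<in> {(i,j)\<in>all_cuts ?n. 1 \<le> i}" for i j
      using that by (auto simp: all_cuts_def excise_def)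
    have "half_prec (inf_ext a) (inf_ext c) ws =
        (\<Sum>(i,j)\<in>{(i,j)\<in>all_cuts ?n. 1 \<le> i}. inf_ext a [excise i j w] * c (slice i j w))"
      using half_prec_inf_ext_Cons[of w "[]" "inf_ext a" c] 3 by simp
    also have "\<dots> = (\<Sum>(i,j)\<in>inner_cuts ?n \<union> ?B. a (excise i j w) * c (slice i j w))"
      using ne unfolding dec(1)[symmetric] by (intro sum.cong) auto
    also have "\<dots> = insertion c a w + (\<Sum>(i,j)\<in>?B. a (excise i j w) * c (slice i j w))"
      unfolding insertion_def using dec(2) by (intro sum.union_disjoint) auto
    also have "(\<Sum>(i,j)\<in>?B. a (excise i j w) * c (slice i j w)) = (\<Sum>i=1..<?n. a (take i w) * c (drop i w))"
      by (subst sum.reindex) (auto simp: inj_on_def excise_def slice_def)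
    finally have prec: "half_prec (inf_ext a) (inf_ext c) ws =
        insertion c a w + (\<Sum>i=1..<?n. a (take i w) * c (drop i w))" .
    have split: "{1..?n} = insert ?n {1..<?n}" using 3 by (auto simp: Suc_le_eq)
    have "half_succ (inf_ext c) (inf_ext a) ws =
        (\<Sum>k=1..?n. inf_ext c (word_tensor (drop k w)) * a (take k w))"
      using half_succ_inf_ext_Cons[of w "[]" "inf_ext c" a] 3 by simp
    also have "\<dots> = (\<Sum>i=1..<?n. a (take i w) * c (drop i w))"
      unfolding split by (auto simp: word_tensor_def mult.commute intro!: sum.cong)
    finally show ?thesis using prec 3 by (simp add: pre_lie_def)
  next
    case 4
    then obtain v us where vs: "vs = v # us" "v \<noteq> []" "w \<noteq> []" by (cases vs) auto
    have lin: "conv (\<lambda>u. a w * counit u) (inf_ext c) vs = a w * conv counit (inf_ext c) vs"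
      using conv_sum[where M="{()}" and a="\<lambda>_. a w" and f="\<lambda>_. counit"] by simp
    have "(\<lambda>u. inf_ext a (w # u)) = (\<lambda>u. a w * counit u)"
      using vs(3) by (auto simp: fun_eq_iff inf_ext_def counit_def split: list.split)
    then have "half_prec (inf_ext a) (inf_ext c) ws = a w * conv counit (inf_ext c) vs"
      using 4 vs lin by (simp add: half_prec_inf_ext_Cons case_prod_unfold)
    also have "conv counit (inf_ext c) vs = inf_ext c vs"
    proof -
      have one: "conv_pow_word c 1 v = c v"
      proof -
        have split: "{1..length v} = insert (length v) {1..<length v}" using vs by (auto simp: Suc_le_eq)
        have "concat_prod c word_unit v = c v"
          unfolding concat_prod_def split by (simp add: word_unit_def)
        then show ?thesis by (simp add: right_conv_word_unit)
      qed
      have "conv counit (inf_ext c) vs = conv_power (inf_ext c) (Suc 0) vs" by simp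
      also have "\<dots> = conv_pow_word c 1 v * counit us"
        unfolding vs(1) conv_power_Cons[OF vs(2)] using vs(2) by (simp add: word_unit_def)
      also have "\<dots> = inf_ext c vs"
        unfolding one using vs by (cases us) (simp_all add: counit_def)
      finally show ?thesis .
    qed
    finally have prec: "half_prec (inf_ext a) (inf_ext c) ws = a w * inf_ext c vs" .
    have split: "{1..length w} = insert (length w) {1..<length w}" using vs by (auto simp: Suc_le_eq)
    have "half_succ (inf_ext c) (inf_ext a) ws =
        (\<Sum>k=1..length w. inf_ext c (word_tensor (drop k w) @ vs) * a (take k w))"
      using half_succ_inf_ext_Cons[of w vs "inf_ext c" a] 4 vs by simp
    also have "\<dots> = inf_ext c vs * a w"
      unfolding split using vs(1) by (simp add: word_tensor_def)
    finally show ?thesis using prec 4 vs by (simp add: pre_lie_def)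
  qed
qed

lemma pre_lie_iter_inf_ext: "pre_lie_iter (inf_ext c) n (inf_ext a) = inf_ext ((insertion c ^^ n) a)"
  by (induction n) (simp_all add: pre_lie_inf_ext)

lemma W_op_inf_ext: "W_op (inf_ext c) (inf_ext a) = inf_ext (word_W c a)"
  by (rule ext) (auto simp: W_op_def pre_lie_iter_inf_ext inf_ext_def word_W_def split: list.split)

lemma insertion_pow_cong:
  assumes "\<And>v. v \<noteq> [] \<Longrightarrow> length v < L \<Longrightarrow> a v = a' v \<and> c v = c' v"
  shows "w \<noteq> [] \<Longrightarrow> length w \<le> L \<Longrightarrow> (insertion c ^^ Suc m) a w = (insertion c' ^^ Suc m) a' w"
proof (induction m arbitrary: w)
  case 0
  then show ?case
    unfolding funpow.simps o_apply insertion_def using assms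
    by (auto intro!: sum.cong arg_cong2[where f="(*)"] simp: inner_cuts_def excise_def slice_def)
next
  case (Suc m)
  have "(insertion c ^^ Suc m) a (excise i j w) * c (slice i j w) =
        (insertion c' ^^ Suc m) a' (excise i j w) * c' (slice i j w)" if "(i,j) \<in> inner_cuts (length w)" for i j
  proof -
    have "(insertion c ^^ Suc m) a (excise i j w) = (insertion c' ^^ Suc m) a' (excise i j w)"
      using that Suc.prems by (intro Suc.IH) (auto simp: inner_cuts_def excise_def)
    moreover have "c (slice i j w) = c' (slice i j w)"
      using that Suc.prems assms[of "slice i j w"] by (auto simp: inner_cuts_def slice_def)
    ultimately show ?thesis by simp
  qed
  then show ?case
    unfolding funpow.simps(2)[of "Suc m"] o_apply
    by (subst (1 2) insertion_def) (auto intro!: sum.cong simp del: funpow.simps)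
qed

text \<open>
  Triangularity of \<open>W\<close> with respect to word length: apart from the summand \<open>a w\<close>, both
  arguments of \<open>W\<close> only enter through shorter words.
\<close>

lemma word_W_cong_imp_eq:
  assumes "\<And>v. v \<noteq> [] \<Longrightarrow> length v < length w \<Longrightarrow> a v = a' v \<and> c v = c' v"
    and "w \<noteq> []" "word_W c a w = word_W c' a' w"
  shows "a w = a' w"
proof -
  have "word_W c a w = (\<Sum>n. (insertion c ^^ Suc n) a w / fact (Suc n + 1)) + a w" for c a :: "'a list \<Rightarrow> complex"
    using suminf_split_head[OF sums_summable[OF word_W_sums[of c a w]]]
    by (simp add: word_W_def del: funpow.simps(2) fact_Suc)
  from this[of c a] this[of c' a'] show ?thesis
    using insertion_pow_cong[of "length w" a a' c c' w, OF assms(1) assms(2) order.refl] assms(3)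
    by (simp del: funpow.simps fact_Suc)
qed

lemma word_W_inject:
  assumes "\<And>w. w \<noteq> [] \<Longrightarrow> word_W c a w = word_W c a' w" "w \<noteq> []"
  shows "a w = a' w"
  using assms(2)
  by (induction "length w" arbitrary: w rule: less_induct)
     (rule word_W_cong_imp_eq[where c=c and c'=c], use assms(1) in auto)

lemma word_W_diag_inject:
  assumes "\<And>w. w \<noteq> [] \<Longrightarrow> word_W a a w = word_W a' a' w" "w \<noteq> []"
  shows "a w = a' w"
  using assms(2)
  by (induction "length w" arbitrary: w rule: less_induct)
     (rule word_W_cong_imp_eq[where c=a and c'=a'], use assms(1) in auto)

lemma exp_conv_eq_exp_succ: "exp_conv (inf_ext c) = exp_succ (inf_ext (word_W c c))"
  unfolding exp_conv_inf_ext
  by (rule exp_succ_eq_char_ext[symmetric]) (simp_all add: word_exp_Nil word_exp_recursion)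

section \<open>Sums over non-crossing partitions and their irreducible components\<close>

lemma not_nests_append_components:
  assumes "\<sigma> \<in> NC k" "\<tau> \<in> NC (n - k)" "k \<le> n"
  shows "\<forall>V\<in>\<sigma>. \<forall>W\<in>expand_blocks 0 k \<tau>. \<not> nests V W \<and> \<not> nests W V"
    and "\<sigma> \<inter> expand_blocks 0 k \<tau> = {}"
proof -
  have lo: "\<And>V. V \<in> \<sigma> \<Longrightarrow> V \<subseteq> {..<k} \<and> V \<noteq> {}" using NC_block[OF assms(1)] by blast
  have hi: "\<And>V. V \<in> expand_blocks 0 k \<tau> \<Longrightarrow> V \<subseteq> {k..} \<and> V \<noteq> {}"
    using append_components_NC(2)[OF assms] by blast
  show "\<forall>V\<in>\<sigma>. \<forall>W\<in>expand_blocks 0 k \<tau>. \<not> nests V W \<and> \<not> nests W V"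
  proof (intro ballI conjI notI)
    fix V W assume V: "V \<in> \<sigma>" and W: "W \<in> expand_blocks 0 k \<tau>"
    obtain x where x: "x \<in> V" "x < k" using lo[OF V] by auto
    obtain y where y: "y \<in> W" "k \<le> y" using hi[OF W] by auto
    { assume "nests V W"
      then obtain b where "b \<in> V" "y < b" using y unfolding nests_def by blast
      then show False using lo[OF V] y by auto }
    { assume "nests W V"
      then obtain a where "a \<in> W" "a < x" using x unfolding nests_def by blast
      then show False using hi[OF W] x by auto }
  qed
  show "\<sigma> \<inter> expand_blocks 0 k \<tau> = {}"
  proof (rule ccontr)
    assume "\<sigma> \<inter> expand_blocks 0 k \<tau> \<noteq> {}"
    then obtain V where V: "V \<in> \<sigma>" "V \<in> expand_blocks 0 k \<tau>" by blast
    then obtain x where "x \<in> V" using lo by blast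
    then have "x < k" "k \<le> x" using lo[OF V(1)] hi[OF V(2)] by auto
    then show False by simp
  qed
qed

lemma part_ext_append_components:
  assumes "\<sigma> \<in> NC k" "\<tau> \<in> NC (length w - k)" "k \<le> length w"
  shows "part_ext h (\<sigma> \<union> expand_blocks 0 k \<tau>) w = part_ext h \<sigma> (take k w) * part_ext h \<tau> (drop k w)"
proof -
  have fin: "finite \<sigma>" "finite \<tau>"
    using NC_imp_nc_family assms(1,2) by (auto simp: nc_family_def)
  have lo: "\<And>V. V \<in> \<sigma> \<Longrightarrow> V \<subseteq> {..<k} \<and> V \<noteq> {}" using NC_block[OF assms(1)] by blast
  have "part_ext h (\<sigma> \<union> expand_blocks 0 k \<tau>) w =
     (\<Prod>V\<in>\<sigma>. h (nths w V)) * (\<Prod>V\<in>\<tau>. h (nths w (expand 0 k ` V)))"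
    using fin not_nests_append_components(2)[OF assms] unfolding part_ext_def
    by (subst prod.union_disjoint) (simp_all add: prod.reindex[OF inj_image_strict_mono[OF strict_mono_expand]])
  also have "(\<Prod>V\<in>\<sigma>. h (nths w V)) = part_ext h \<sigma> (take k w)"
    unfolding part_ext_def
  proof (intro prod.cong refl)
    fix V assume "V \<in> \<sigma>"
    then have "nths (drop k w) {j. j + k \<in> V} = []" using lo by (intro nths_eq_Nil) fastforce
    then show "h (nths w V) = h (nths (take k w) V)"
      using nths_append[of "take k w" "drop k w" V] assms(3) by simp
  qed
  also have "(\<Prod>V\<in>\<tau>. h (nths w (expand 0 k ` V))) = part_ext h \<tau> (drop k w)"
    using nths_expand[of 0 k w] assms(3) by (simp add: part_ext_def excise_def)
  finally show ?thesis .
qed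

lemma card_inner_blocks_irr:
  assumes "\<sigma> \<in> NC_irr k"
  shows "card (inner_blocks \<sigma>) = card \<sigma> - 1"
proof -
  have nc: "\<sigma> \<in> NC k" using assms by (rule NC_irr_imp_NC)
  obtain V where V: "V \<in> \<sigma>" "0 \<in> V" "k - 1 \<in> V" using assms by (auto simp: NC_irr_def)
  have "\<not> nests W V" if "W \<in> \<sigma>" for W
    using V(2) unfolding nests_def by (metis not_less_zero)
  then have "outer_blocks \<sigma> = {V}"
    using NC_irr_root[OF nc V] V(1) by (auto simp: outer_blocks_def)
  then show ?thesis
    using V(1) by (simp add: inner_blocks_def)
qed

definition inner_weight :: "complex \<Rightarrow> nat set set \<Rightarrow> complex" where
  "inner_weight t \<pi> = t ^ card (inner_blocks \<pi>) / of_nat (forest_fact \<pi>)"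

lemma inner_weight_append_components:
  assumes "\<sigma> \<in> NC k" "\<tau> \<in> NC (n - k)" "k \<le> n"
  shows "inner_weight t (\<sigma> \<union> expand_blocks 0 k \<tau>) = inner_weight t \<sigma> * inner_weight t \<tau>"
proof -
  note nn = not_nests_append_components[OF assms]
  have fin: "finite \<sigma>" "finite \<tau>"
    using NC_imp_nc_family assms(1,2) by (auto simp: nc_family_def)
  have "inner_blocks (\<sigma> \<union> expand_blocks 0 k \<tau>) = inner_blocks \<sigma> \<union> inner_blocks (expand_blocks 0 k \<tau>)"
    using nn unfolding inner_blocks_def outer_blocks_Un[OF nn(1)] by (auto simp: outer_blocks_def)
  moreover have "card (inner_blocks \<sigma> \<union> inner_blocks (expand_blocks 0 k \<tau>)) =
      card (inner_blocks \<sigma>) + card (inner_blocks (expand_blocks 0 k \<tau>))"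
    using nn(2) fin by (intro card_Un_disjoint) (auto simp: inner_blocks_def)
  ultimately have "card (inner_blocks (\<sigma> \<union> expand_blocks 0 k \<tau>)) = card (inner_blocks \<sigma>) + card (inner_blocks \<tau>)"
    by (simp add: inner_blocks_image_strict_mono[OF strict_mono_expand])
  moreover have "forest_fact (\<sigma> \<union> expand_blocks 0 k \<tau>) = forest_fact \<sigma> * forest_fact \<tau>"
    using forest_fact_Un[OF fin(1) finite_imageI[OF fin(2)] nn(2,1)]
      forest_fact_image_strict_mono[OF strict_mono_expand NC_imp_nc_family[OF assms(2)]] by simp
  ultimately show ?thesis by (simp add: inner_weight_def power_add)
qed

text \<open>
  A sum over non-crossing partitions with a weight that is multiplicative over irreducible
  components satisfies the moment recursion of the corresponding sum over irreducible partitions.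
  This applies to \<open>t\<^bsup>inner\<^esup> / t(\<pi>)!\<close> and to the indicator of the interval partitions.
\<close>

lemma sum_NC_multiplicative:
  fixes c :: "nat set set \<Rightarrow> complex"
  assumes "w \<noteq> []"
    and "\<And>k \<sigma> \<tau>. 1 \<le> k \<Longrightarrow> k \<le> length w \<Longrightarrow> \<sigma> \<in> NC_irr k \<Longrightarrow> \<tau> \<in> NC (length w - k) \<Longrightarrow>
           c (\<sigma> \<union> expand_blocks 0 k \<tau>) = c \<sigma> * c \<tau>"
  shows "(\<Sum>\<pi>\<in>NC (length w). c \<pi> * part_ext h \<pi> w) =
    concat_prod (\<lambda>w. \<Sum>\<pi>\<in>NC_irr (length w). c \<pi> * part_ext h \<pi> w)
      (\<lambda>w. \<Sum>\<pi>\<in>NC (length w). c \<pi> * part_ext h \<pi> w) w"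
proof -
  have "(\<Sum>\<pi>\<in>NC (length w). c \<pi> * part_ext h \<pi> w) =
    (\<Sum>k=1..length w. \<Sum>\<sigma>\<in>NC_irr k. \<Sum>\<tau>\<in>NC (length w - k).
       c (\<sigma> \<union> expand_blocks 0 k \<tau>) * part_ext h (\<sigma> \<union> expand_blocks 0 k \<tau>) w)"
    using assms(1) by (intro sum_NC_first_component) simp
  also have "\<dots> = (\<Sum>k=1..length w. \<Sum>\<sigma>\<in>NC_irr k. \<Sum>\<tau>\<in>NC (length w - k).
       (c \<sigma> * part_ext h \<sigma> (take k w)) * (c \<tau> * part_ext h \<tau> (drop k w)))"
    by (intro sum.cong refl) (simp add: assms(2) part_ext_append_components NC_irr_imp_NC)
  also have "\<dots> = (\<Sum>k=1..length w. (\<Sum>\<sigma>\<in>NC_irr k. c \<sigma> * part_ext h \<sigma> (take k w)) *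
       (\<Sum>\<tau>\<in>NC (length w - k). c \<tau> * part_ext h \<tau> (drop k w)))"
    by (simp only: sum_product)
  finally show ?thesis by (simp add: concat_prod_def min_absorb2)
qed

lemma interval_partitions_append_components:
  assumes "\<sigma> \<in> NC k" "\<tau> \<in> NC (n - k)" "k \<le> n"
  shows "\<sigma> \<union> expand_blocks 0 k \<tau> \<in> interval_partitions n \<longleftrightarrow>
    \<sigma> \<in> interval_partitions k \<and> \<tau> \<in> interval_partitions (n - k)"
proof -
  have "(\<exists>i j. expand 0 k ` V = {i..j}) \<longleftrightarrow> (\<exists>i j. V = {i..j})" if "V \<in> \<tau>" for V
  proof -
    have e: "expand 0 k = (\<lambda>x. x + k)" by (auto simp: expand_def)
    have "V \<noteq> {}" using NC_block[OF assms(2) that] by simp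
    show ?thesis
    proof
      assume "\<exists>i j. V = {i..j}"
      then obtain i j where "V = {i..j}" by blast
      then have "expand 0 k ` V = {i + k..j + k}" unfolding e by simp
      then show "\<exists>i j. expand 0 k ` V = {i..j}" by blast
    next
      assume "\<exists>i j. expand 0 k ` V = {i..j}"
      then obtain i j where ij: "(\<lambda>x. x + k) ` V = {i..j}" unfolding e by blast
      then have "i \<le> j" using \<open>V \<noteq> {}\<close> by (metis atLeastatMost_empty_iff image_is_empty)
      then have "i \<in> (\<lambda>x. x + k) ` V" "j \<in> (\<lambda>x. x + k) ` V" using ij by auto
      then obtain i' j' where "i = i' + k" "j = j' + k" by auto
      then have "(\<lambda>x. x + k) ` V = (\<lambda>x. x + k) ` {i'..j'}" using ij by simp
      moreover have "inj (\<lambda>x. x + k)" by (simp add: inj_on_def)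
      ultimately have "V = {i'..j'}" by (metis inj_image_eq_iff)
      then show "\<exists>i j. V = {i..j}" by blast
    qed
  qed
  then have "(\<forall>V\<in>expand_blocks 0 k \<tau>. \<exists>i j. V = {i..j}) \<longleftrightarrow> (\<forall>V\<in>\<tau>. \<exists>i j. V = {i..j})"
    unfolding ball_simps(9) by (rule ball_cong[OF refl])
  then show ?thesis
    using assms append_components_NC(1)[OF assms] by (simp add: interval_partitions_def ball_Un)
qed

lemma interval_irr:
  assumes "0 < k"
  shows "{\<sigma>\<in>NC_irr k. \<sigma> \<in> interval_partitions k} = {{{..<k}}}"
proof
  have "{..<k} = {0..k - 1}" using assms by auto
  then show "{{{..<k}}} \<subseteq> {\<sigma>\<in>NC_irr k. \<sigma> \<in> interval_partitions k}"
    using single_block_NC_irr[OF assms] NC_irr_imp_NC by (auto simp: interval_partitions_def)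
  show "{\<sigma>\<in>NC_irr k. \<sigma> \<in> interval_partitions k} \<subseteq> {{{..<k}}}"
  proof
    fix \<sigma> assume \<sigma>: "\<sigma> \<in> {\<sigma>\<in>NC_irr k. \<sigma> \<in> interval_partitions k}"
    then have nc: "\<sigma> \<in> NC k" using NC_irr_imp_NC by blast
    obtain V where V: "V \<in> \<sigma>" "0 \<in> V" "k - 1 \<in> V" using \<sigma> by (auto simp: NC_irr_def)
    then obtain i j where ij: "V = {i..j}" using \<sigma> unfolding interval_partitions_def by blast
    have Veq: "V = {..<k}"
    proof
      show "V \<subseteq> {..<k}" using NC_block[OF nc V(1)] by blast
      show "{..<k} \<subseteq> V" using V(2,3) unfolding ij by auto
    qed
    have "W = V" if W: "W \<in> \<sigma>" for W
    proof -
      obtain x where "x \<in> W" "x < k" using NC_block[OF nc W] by blast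
      then show ?thesis using NC_disjoint[OF nc W V(1)] Veq by blast
    qed
    then have "\<sigma> = {V}" using V(1) by blast
    then show "\<sigma> \<in> {{{..<k}}}" using Veq by simp
  qed
qed

definition interval_moment :: "('a list \<Rightarrow> complex) \<Rightarrow> 'a list \<Rightarrow> complex" where
  "interval_moment b w = (\<Sum>\<pi>\<in>interval_partitions (length w). part_ext b \<pi> w)"

lemma interval_moment_Nil: "interval_moment b [] = 1"
proof -
  have "interval_partitions 0 = {{}}" by (auto simp: interval_partitions_def)
  then show ?thesis by (simp add: interval_moment_def part_ext_def)
qed

text \<open>
  The indicator function of the interval partitions is a multiplicative weight, and the only
  irreducible interval partition has a single block.
\<close>

lemma interval_moment_recursion:
  assumes "w \<noteq> []"
  shows "interval_moment b w = concat_prod b (interval_moment b) w"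
proof -
  \<comment> \<open>The weight may depend on \<open>\<pi>\<close> only, so the size of the underlying set is read off from \<open>\<pi>\<close>.\<close>
  let ?c = "\<lambda>\<pi>. if \<pi> \<in> interval_partitions (card (\<Union>\<pi>)) then 1 else 0 :: complex"
  have card: "card (\<Union>\<pi>) = n" if "\<pi> \<in> NC n" for \<pi> n
    using that by (auto simp: NC_def partition_on_def)
  have im: "interval_moment b v = (\<Sum>\<pi>\<in>NC (length v). ?c \<pi> * part_ext b \<pi> v)" for v :: "'a list"
  proof -
    have "interval_moment b v = (\<Sum>\<pi>\<in>NC (length v). if \<pi> \<in> interval_partitions (length v) then part_ext b \<pi> v else 0)"
      unfolding interval_moment_def
      by (rule sum.mono_neutral_cong_left) (auto simp: finite_NC interval_partitions_def)
    also have "\<dots> = (\<Sum>\<pi>\<in>NC (length v). ?c \<pi> * part_ext b \<pi> v)"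
      by (intro sum.cong refl) (simp add: card)
    finally show ?thesis .
  qed
  have bb: "b v = (\<Sum>\<pi>\<in>NC_irr (length v). ?c \<pi> * part_ext b \<pi> v)" if "v \<noteq> []" for v :: "'a list"
  proof -
    have "(\<Sum>\<pi>\<in>NC_irr (length v). ?c \<pi> * part_ext b \<pi> v) =
       (\<Sum>\<pi>\<in>{\<sigma>\<in>NC_irr (length v). \<sigma> \<in> interval_partitions (length v)}. part_ext b \<pi> v)"
      by (rule sum.mono_neutral_cong_right) (auto simp: card[OF NC_irr_imp_NC])
    also have "\<dots> = b v"
      using that by (simp add: interval_irr part_ext_def)
    finally show ?thesis by simp
  qed
  have "interval_moment b w = concat_prod (\<lambda>w. \<Sum>\<pi>\<in>NC_irr (length w). ?c \<pi> * part_ext b \<pi> w)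
      (\<lambda>w. \<Sum>\<pi>\<in>NC (length w). ?c \<pi> * part_ext b \<pi> w) w"
    unfolding im[of w]
  proof (rule sum_NC_multiplicative[OF assms])
    fix k \<sigma> \<tau> assume a: "1 \<le> k" "k \<le> length w" "\<sigma> \<in> NC_irr k" "\<tau> \<in> NC (length w - k)"
    have \<sigma>: "\<sigma> \<in> NC k" using a(3) by (rule NC_irr_imp_NC)
    show "?c (\<sigma> \<union> expand_blocks 0 k \<tau>) = ?c \<sigma> * ?c \<tau>"
      using interval_partitions_append_components[OF \<sigma> a(4,2)]
        card[OF append_components_NC(1)[OF \<sigma> a(4,2)]] card[OF \<sigma>] card[OF a(4)] by simp
  qed
  also have "\<dots> = concat_prod b (interval_moment b) w"
    unfolding concat_prod_def im[symmetric] using assms bb by (intro sum.cong refl) auto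
  finally show ?thesis .
qed

section \<open>Boolean cumulants and moments\<close>

text \<open>
  The moment recursion, solved for the factor with the full word; for the moments of \<open>\<phi>\<close>
  this gives the Boolean cumulants.
\<close>

function concat_root :: "('a list \<Rightarrow> complex) \<Rightarrow> 'a list \<Rightarrow> complex" where
  "concat_root m w = (if w = [] then 0
     else m w - (\<Sum>k\<in>{1..<length w}. concat_root m (take k w) * m (drop k w)))"
  by auto
termination
  by (relation "measure (\<lambda>(m,w). length w)") auto

declare concat_root.simps [simp del]

lemma concat_prod_split_last:
  assumes "w \<noteq> []"
  shows "concat_prod f g w = f w * g [] + (\<Sum>k\<in>{1..<length w}. f (take k w) * g (drop k w))"
proof -
  have "{1..length w} = insert (length w) {1..<length w}" using assms by (auto simp: Suc_le_eq)
  then show ?thesis by (simp add: concat_prod_def)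
qed

lemma concat_root_recursion:
  assumes "m [] = 1" "w \<noteq> []"
  shows "m w = concat_prod (concat_root m) m w"
  using assms by (simp add: concat_prod_split_last concat_root.simps[of m w])

lemma concat_prod_cong:
  assumes "\<And>v. v \<noteq> [] \<Longrightarrow> length v \<le> length w \<Longrightarrow> f v = f' v" "\<And>v. length v < length w \<Longrightarrow> g v = g' v"
  shows "concat_prod f g w = concat_prod f' g' w"
  unfolding concat_prod_def
proof (intro sum.cong refl)
  fix k assume "k \<in> {1..length w}"
  then have "take k w \<noteq> []" "length (take k w) \<le> length w" "length (drop k w) < length w" by auto
  then show "f (take k w) * g (drop k w) = f' (take k w) * g' (drop k w)"
    using assms by simp
qed

lemma concat_recursion_unique:
  assumes "m [] = 1" "m' [] = 1" "\<And>w. w \<noteq> [] \<Longrightarrow> m w = concat_prod b m w"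
    "\<And>w. w \<noteq> [] \<Longrightarrow> m' w = concat_prod b m' w"
  shows "m w = m' w"
proof (induction "length w" arbitrary: w rule: less_induct)
  case less
  show ?case
    using assms concat_prod_cong[of w b b m m'] less by (cases "w = []") auto
qed

lemma concat_factor_unique:
  assumes "m [] = 1" "\<And>w. w \<noteq> [] \<Longrightarrow> m w = concat_prod b m w"
    "\<And>w. w \<noteq> [] \<Longrightarrow> m w = concat_prod b' m w" "w \<noteq> []"
  shows "b w = b' w"
  using assms(4)
proof (induction "length w" arbitrary: w rule: less_induct)
  case less
  have "(\<Sum>k\<in>{1..<length w}. b (take k w) * m (drop k w)) = (\<Sum>k\<in>{1..<length w}. b' (take k w) * m (drop k w))"
    using less by (intro sum.cong refl arg_cong2[where f="(*)"]) auto
  then show ?case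
    using assms(2,3)[OF less.prems] assms(1) by (simp add: concat_prod_split_last[OF less.prems])
qed

lemma boolean_cumulant_eq_concat_root:
  fixes \<phi> :: "'a::ring_1 \<Rightarrow> complex"
  assumes "\<phi> 1 = 1"
  shows "boolean_cumulant \<phi> = concat_root (\<lambda>w. \<phi> (prod_list w))"
proof -
  let ?m = "\<lambda>w. \<phi> (prod_list w)"
  let ?b = "concat_root ?m"
  have m1: "?m [] = 1" using assms by simp
  have "interval_moment ?b w = ?m w" for w
    by (rule concat_recursion_unique[where b = ?b])
       (use m1 interval_moment_Nil interval_moment_recursion concat_root_recursion[of ?m] in auto)
  then have ex: "?b [] = 0 \<and> (\<forall>xs. xs \<noteq> [] \<longrightarrow> ?m xs = (\<Sum>\<pi>\<in>interval_partitions (length xs). part_ext ?b \<pi> xs))"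
    by (simp add: interval_moment_def concat_root.simps)
  show ?thesis
    unfolding boolean_cumulant_def
  proof (rule the_equality)
    show "?b [] = 0 \<and> (\<forall>xs. xs \<noteq> [] \<longrightarrow> ?m xs = (\<Sum>\<pi>\<in>interval_partitions (length xs). part_ext ?b \<pi> xs))"
      by (rule ex)
    fix b :: "'a list \<Rightarrow> complex"
    assume b: "b [] = 0 \<and> (\<forall>xs. xs \<noteq> [] \<longrightarrow> ?m xs = (\<Sum>\<pi>\<in>interval_partitions (length xs). part_ext b \<pi> xs))"
    then have im: "interval_moment b w = ?m w" for w
      using m1 interval_moment_Nil by (cases "w = []") (simp_all add: interval_moment_def)
    have "?m w = concat_prod b ?m w" if "w \<noteq> []" for w
      using interval_moment_recursion[OF that, of b] im by (simp add: concat_prod_def)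
    then have "b w = ?b w" if "w \<noteq> []" for w
      using concat_factor_unique[of ?m b ?b] m1 concat_root_recursion[of ?m] that by blast
    then show "b = ?b"
      using b ex by (metis ext)
  qed
qed

lemma moment_NC_sum:
  assumes "m [] = 1" "\<And>w. w \<noteq> [] \<Longrightarrow> m w = concat_prod b m w"
  shows "m w = (\<Sum>\<pi>\<in>NC (length w). inner_weight t \<pi> * part_ext (t_cumulant t b) \<pi> w)"
proof (rule concat_recursion_unique[where b=b and m=m])
  let ?h = "t_cumulant t b"
  let ?M = "\<lambda>w. \<Sum>\<pi>\<in>NC (length w). inner_weight t \<pi> * part_ext ?h \<pi> w"
  show "?M [] = 1" by (simp add: inner_weight_def part_ext_def inner_blocks_def)
  fix w :: "'a list" assume w: "w \<noteq> []"
  have "?M w = concat_prod (\<lambda>w. \<Sum>\<pi>\<in>NC_irr (length w). inner_weight t \<pi> * part_ext ?h \<pi> w) ?M w"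
    by (rule sum_NC_multiplicative[OF w]) (use inner_weight_append_components NC_irr_imp_NC in blast)
  also have "\<dots> = concat_prod b ?M w"
  proof (rule concat_prod_cong)
    fix v :: "'a list" assume "v \<noteq> []"
    from t_cumulant_irr_sum[OF this, of b t]
    show "(\<Sum>\<pi>\<in>NC_irr (length v). inner_weight t \<pi> * part_ext ?h \<pi> v) = b v"
      by (simp add: inner_weight_def card_inner_blocks_irr)
  qed simp
  finally show "?M w = concat_prod b ?M w" .
qed (use assms in auto)

section \<open>Multilinearity\<close>

definition multilinear :: "(complex \<Rightarrow> 'a::ring_1 \<Rightarrow> 'a) \<Rightarrow> ('a list \<Rightarrow> complex) \<Rightarrow> bool" where
  "multilinear scale a \<longleftrightarrow> (\<forall>xs ys. Vector_Spaces.linear scale (*) (\<lambda>x. a (xs @ [x] @ ys)))"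

lemma linear_complex_iff:
  assumes "vector_space scale"
  shows "Vector_Spaces.linear scale (*) f \<longleftrightarrow>
    (\<forall>x y. f (x + y) = f x + f y) \<and> (\<forall>c x. f (scale c x) = c * (f x :: complex))"
proof -
  have "vector_space ((*) :: complex \<Rightarrow> complex \<Rightarrow> complex)"
    by unfold_locales (auto simp: algebra_simps)
  then show ?thesis using assms by (simp add: Vector_Spaces.linear_iff)
qed

lemma linear_zero_function: "vector_space scale \<Longrightarrow> Vector_Spaces.linear scale (*) (\<lambda>x. 0 :: complex)"
  by (simp add: linear_complex_iff)

lemma linear_scaled_function:
  assumes "vector_space scale" "Vector_Spaces.linear scale (*) f"
  shows "Vector_Spaces.linear scale (*) (\<lambda>x. c * f x :: complex)"
  using assms by (simp add: linear_complex_iff algebra_simps)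

lemma linear_diff_functions:
  assumes "vector_space scale" "Vector_Spaces.linear scale (*) f" "Vector_Spaces.linear scale (*) g"
  shows "Vector_Spaces.linear scale (*) (\<lambda>x. f x - g x :: complex)"
  using assms by (simp add: linear_complex_iff algebra_simps)

lemma linear_sum_functions:
  assumes "vector_space scale" "\<And>i. i \<in> I \<Longrightarrow> Vector_Spaces.linear scale (*) (f i)"
  shows "Vector_Spaces.linear scale (*) (\<lambda>x. \<Sum>i\<in>I. f i x :: complex)"
  using assms by (simp add: linear_complex_iff sum.distrib sum_distrib_left)

lemma multilinear_concat_root:
  fixes scale :: "complex \<Rightarrow> 'a::ring_1 \<Rightarrow> 'a"
  assumes vs: "vector_space scale" and m: "multilinear scale m"
  shows "multilinear scale (concat_root m)"
proof -
  have "Vector_Spaces.linear scale (*) (\<lambda>x. concat_root m (xs @ [x] @ ys))" for xs ys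
  proof (induction "length xs + length ys" arbitrary: xs ys rule: less_induct)
    case less
    let ?n = "Suc (length xs + length ys)"
    have "Vector_Spaces.linear scale (*)
       (\<lambda>x. concat_root m (take k (xs @ [x] @ ys)) * m (drop k (xs @ [x] @ ys)))"
      if k: "k \<in> {1..<?n}" for k
    proof (cases "k \<le> length xs")
      case True
      then have "(\<lambda>x. concat_root m (take k (xs @ [x] @ ys)) * m (drop k (xs @ [x] @ ys))) =
          (\<lambda>x. concat_root m (take k xs) * m (drop k xs @ [x] @ ys))" by simp
      then show ?thesis
        using linear_scaled_function[OF vs] m by (simp add: multilinear_def)
    next
      case False
      then obtain l where l: "k = Suc (length xs + l)" by (metis add_Suc_right less_imp_Suc_add not_le)
      have "(\<lambda>x. concat_root m (take k (xs @ [x] @ ys)) * m (drop k (xs @ [x] @ ys))) =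
          (\<lambda>x. m (drop l ys) * concat_root m (xs @ [x] @ take l ys))"
        unfolding l by (simp add: mult.commute)
      moreover have "Vector_Spaces.linear scale (*) (\<lambda>x. concat_root m (xs @ [x] @ take l ys))"
        using k l by (intro less) auto
      ultimately show ?thesis using linear_scaled_function[OF vs] by simp
    qed
    then have "Vector_Spaces.linear scale (*) (\<lambda>x. m (xs @ [x] @ ys) -
       (\<Sum>k\<in>{1..<?n}. concat_root m (take k (xs @ [x] @ ys)) * m (drop k (xs @ [x] @ ys))))"
      using m by (intro linear_diff_functions[OF vs] linear_sum_functions[OF vs]) (auto simp: multilinear_def)
    moreover have "concat_root m (xs @ [x] @ ys) = m (xs @ [x] @ ys) -
       (\<Sum>k\<in>{1..<?n}. concat_root m (take k (xs @ [x] @ ys)) * m (drop k (xs @ [x] @ ys)))" for x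
      by (subst concat_root.simps) simp
    ultimately show ?case by presburger
  qed
  then show ?thesis by (simp add: multilinear_def)
qed

text \<open>
  A letter occurs in exactly one block, so only one factor of \<open>h\<^sub>\<pi>\<close> depends on it.  Linearity of
  \<open>h\<close> is only required for words as short as the blocks, as needed for induction on the length.
\<close>

lemma linear_part_ext:
  fixes scale :: "complex \<Rightarrow> 'a::ring_1 \<Rightarrow> 'a"
  assumes vs: "vector_space scale" and \<pi>: "\<pi> \<in> NC (Suc (length xs + length ys))"
    and h: "\<And>V us vs. V \<in> \<pi> \<Longrightarrow> length us + length vs < card V \<Longrightarrow>
              Vector_Spaces.linear scale (*) (\<lambda>x. h (us @ [x] @ vs))"
  shows "Vector_Spaces.linear scale (*) (\<lambda>x. \<Prod>V\<in>\<pi>. h (nths (xs @ [x] @ ys) V))"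
proof -
  let ?p = "length xs"
  obtain V where V: "V \<in> \<pi>" "?p \<in> V" using NC_cover[OF \<pi>, of ?p] by auto
  have fin: "finite \<pi>" using NC_imp_nc_family[OF \<pi>] by (simp add: nc_family_def)
  define T where "T W = {j. j + Suc ?p \<in> W}" for W
  have n: "nths (xs @ [x] @ ys) W = nths xs W @ (if ?p \<in> W then [x] else []) @ nths ys (T W)" for x W
    by (simp add: nths_append nths_Cons T_def)
  have "(\<Prod>W\<in>\<pi>. h (nths (xs @ [x] @ ys) W)) =
     (\<Prod>W\<in>\<pi> - {V}. h (nths xs W @ nths ys (T W))) * h (nths xs V @ [x] @ nths ys (T V))" for x
  proof -
    have "?p \<notin> W" if "W \<in> \<pi> - {V}" for W
      using NC_disjoint[OF \<pi> _ V(1), of W] V(2) that by blast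
    then show ?thesis
      unfolding prod.remove[OF fin V(1)] n using V(2) by (simp add: mult.commute)
  qed
  moreover have len: "length (nths xs V) + length (nths ys (T V)) < card V"
  proof -
    have "length (nths (xs @ [undefined] @ ys) V) = card {i. i < Suc (?p + length ys) \<and> i \<in> V}"
      by (simp add: length_nths)
    also have "{i. i < Suc (?p + length ys) \<and> i \<in> V} = V" using NC_block[OF \<pi> V(1)] by auto
    finally show ?thesis unfolding n using V(2) by simp
  qed
  ultimately show ?thesis
    using linear_scaled_function[OF vs h[OF V(1) len]] by simp
qed

lemma multilinear_t_cumulant:
  fixes scale :: "complex \<Rightarrow> 'a::ring_1 \<Rightarrow> 'a"
  assumes vs: "vector_space scale" and b: "multilinear scale b"
  shows "multilinear scale (t_cumulant t b)"
proof -
  let ?h = "t_cumulant t b"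
  have "Vector_Spaces.linear scale (*) (\<lambda>x. ?h (xs @ [x] @ ys))" for xs ys
  proof (induction "length xs + length ys" arbitrary: xs ys rule: less_induct)
    case less
    let ?n = "Suc (length xs + length ys)"
    have "Vector_Spaces.linear scale (*) (\<lambda>x. \<Prod>V\<in>\<pi>. ?h (nths (xs @ [x] @ ys) V))"
      if \<pi>: "\<pi> \<in> NC_irr ?n - {{{..<?n}}}" for \<pi>
    proof (rule linear_part_ext[OF vs])
      show nc: "\<pi> \<in> NC ?n" using \<pi> NC_irr_imp_NC by blast
      fix V and us ws :: "'a list" assume V: "V \<in> \<pi>" and l: "length us + length ws < card V"
      have "length (nths (xs @ [0] @ ys) V) < length (xs @ [0] @ ys)"
        using nc \<pi> V by (intro proper_block_shorter(1)[of \<pi>]) auto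
      moreover have "{i. i < ?n \<and> i \<in> V} = V" using NC_block[OF nc V] by auto
      ultimately have "card V < ?n" by (simp add: length_nths)
      then show "Vector_Spaces.linear scale (*) (\<lambda>x. ?h (us @ [x] @ ws))"
        using l by (intro less) simp
    qed
    then have "Vector_Spaces.linear scale (*) (\<lambda>x. b (xs @ [x] @ ys) -
       (\<Sum>\<pi>\<in>NC_irr ?n - {{{..<?n}}}. t ^ (card \<pi> - 1) / of_nat (forest_fact \<pi>) *
           (\<Prod>V\<in>\<pi>. ?h (nths (xs @ [x] @ ys) V))))"
      using b by (intro linear_diff_functions[OF vs] linear_sum_functions[OF vs] linear_scaled_function[OF vs]) (auto simp: multilinear_def)
    moreover have "?h (xs @ [x] @ ys) = b (xs @ [x] @ ys) -
       (\<Sum>\<pi>\<in>NC_irr ?n - {{{..<?n}}}. t ^ (card \<pi> - 1) / of_nat (forest_fact \<pi>) *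
           (\<Prod>V\<in>\<pi>. ?h (nths (xs @ [x] @ ys) V)))" for x
      by (subst t_cumulant.simps) simp
    ultimately show ?case by presburger
  qed
  then show ?thesis by (simp add: multilinear_def)
qed

lemma multilinear_scale:
  assumes "vector_space scale" "multilinear scale a"
  shows "multilinear scale (\<lambda>w. c * a w)"
  using assms linear_scaled_function unfolding multilinear_def by blast

section \<open>Identification of the t-monotone cumulants\<close>

lemma inf_ext_in_inf_characters:
  fixes scale :: "complex \<Rightarrow> 'a::ring_1 \<Rightarrow> 'a"
  assumes vs: "vector_space scale" and a: "multilinear scale a"
  shows "inf_ext a \<in> inf_characters scale"
proof -
  have "Vector_Spaces.linear scale (*) (\<lambda>x. inf_ext a (us @ [xs @ [x] @ ys] @ ws))" for us xs ys ws
  proof (cases "us = [] \<and> ws = []")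
    case True
    then show ?thesis using a by (simp add: multilinear_def)
  next
    case False
    then have "inf_ext a (us @ [xs @ [x] @ ys] @ ws) = 0" for x
      by (intro inf_ext_eq_0) auto
    then show ?thesis using linear_zero_function[OF vs] by simp
  qed
  moreover have "inf_ext a ws = 0" if "[] \<in> set ws" for ws
    using that by (auto simp: inf_ext_def split: list.split)
  ultimately show ?thesis
    by (auto simp: inf_characters_def linear_form_def inf_ext_eq_0)
qed

lemma inf_characters_eq_inf_ext:
  assumes "\<alpha> \<in> inf_characters scale"
  shows "\<alpha> = inf_ext (\<lambda>w. \<alpha> [w])"
proof
  fix ws
  have 0: "\<alpha> [] = 0" "\<alpha> [[]] = 0" "\<And>ws. 2 \<le> length ws \<Longrightarrow> \<alpha> ws = 0"
    using assms by (auto simp: inf_characters_def linear_form_def)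
  then show "\<alpha> ws = inf_ext (\<lambda>w. \<alpha> [w]) ws"
    by (auto simp: inf_ext_def split: list.split)
qed

lemma inj_on_inf_characters:
  fixes scale :: "complex \<Rightarrow> 'a::ring_1 \<Rightarrow> 'a"
  assumes "\<And>a b w. F (inf_ext a) = F (inf_ext b) \<Longrightarrow> w \<noteq> [] \<Longrightarrow> a w = b w"
  shows "inj_on F (inf_characters scale)"
proof (rule inj_onI)
  fix \<alpha> \<beta> assume "\<alpha> \<in> inf_characters scale" "\<beta> \<in> inf_characters scale" and eq: "F \<alpha> = F \<beta>"
  then have ab: "\<alpha> = inf_ext (\<lambda>w. \<alpha> [w])" "\<beta> = inf_ext (\<lambda>w. \<beta> [w])"
    using inf_characters_eq_inf_ext by blast+
  have "inf_ext (\<lambda>w. \<alpha> [w]) = inf_ext (\<lambda>w. \<beta> [w])"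
    by (rule inf_ext_cong, rule assms) (use eq ab in auto)
  then show "\<alpha> = \<beta>" using ab by simp
qed

lemma inf_ext_eq_imp: "inf_ext a = inf_ext b \<Longrightarrow> w \<noteq> [] \<Longrightarrow> a w = b w"
  by (metis inf_ext_simps(2))

lemma log_succ_eq:
  fixes scale :: "complex \<Rightarrow> 'a::ring_1 \<Rightarrow> 'a"
  assumes "vector_space scale" "multilinear scale b"
  shows "log_succ scale (exp_succ (inf_ext b)) = inf_ext b"
  unfolding log_succ_def
  by (rule the_inv_into_f_f[OF inj_on_inf_characters inf_ext_in_inf_characters[OF assms]])
     (rule exp_succ_inf_ext_inject)

text \<open>
  By \<open>exp\<^sup>*(\<gamma>) = \<E>\<^sub>\<succ>(W\<^sub>\<gamma>(\<gamma>))\<close>, injectivity of \<open>exp\<^sup>*\<close> reduces to that of \<open>\<E>\<^sub>\<succ>\<close> and of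
  \<open>\<gamma> \<mapsto> W\<^sub>\<gamma>(\<gamma>)\<close>.
\<close>

lemma log_conv_eq:
  fixes scale :: "complex \<Rightarrow> 'a::ring_1 \<Rightarrow> 'a"
  assumes "vector_space scale" "multilinear scale c"
  shows "log_conv scale (exp_conv (inf_ext c)) = inf_ext c"
  unfolding log_conv_def
proof (rule the_inv_into_f_f[OF inj_on_inf_characters inf_ext_in_inf_characters[OF assms]])
  fix a b :: "'a list \<Rightarrow> complex" and w :: "'a list" assume eq: "exp_conv (inf_ext a) = exp_conv (inf_ext b)" and w: "w \<noteq> []"
  have "word_W a a v = word_W b b v" if "v \<noteq> []" for v
    using exp_succ_inf_ext_inject[OF eq[unfolded exp_conv_eq_exp_succ] that] .
  then show "a w = b w" using word_W_diag_inject w by blast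
qed

lemma c_monotone_eq:
  fixes scale :: "complex \<Rightarrow> 'a::ring_1 \<Rightarrow> 'a"
  assumes "vector_space scale" "multilinear scale b" "multilinear scale c" "multilinear scale h"
    and "\<And>w. w \<noteq> [] \<Longrightarrow> word_W c h w = b w"
  shows "c_monotone_inf_character scale (exp_succ (inf_ext b)) (exp_conv (inf_ext c)) = inf_ext h"
proof -
  have "inj_on (W_op (inf_ext c)) (inf_characters scale)"
  proof (rule inj_on_inf_characters)
    fix a b :: "'a list \<Rightarrow> complex" and w :: "'a list" assume eq: "W_op (inf_ext c) (inf_ext a) = W_op (inf_ext c) (inf_ext b)"
      and w: "w \<noteq> []"
    have "word_W c a v = word_W c b v" if "v \<noteq> []" for v
      using inf_ext_eq_imp[OF eq[unfolded W_op_inf_ext] that] .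
    then show "a w = b w" using word_W_inject w by blast
  qed
  moreover have "W_op (inf_ext c) (inf_ext h) = inf_ext b"
    unfolding W_op_inf_ext by (rule inf_ext_cong) (rule assms(5))
  ultimately show ?thesis
    unfolding c_monotone_inf_character_def log_conv_eq[OF assms(1,3)] log_succ_eq[OF assms(1,2)]
    using the_inv_into_f_eq inf_ext_in_inf_characters[OF assms(1,4)] by metis
qed

context nc_prob_space
begin

abbreviation moment :: "'a list \<Rightarrow> complex" where
  "moment w \<equiv> \<phi> (prod_list w)"

abbreviation bool_word :: "'a list \<Rightarrow> complex" where
  "bool_word \<equiv> concat_root moment"

lemma moment_recursion: "w \<noteq> [] \<Longrightarrow> moment w = concat_prod bool_word moment w"
  using concat_root_recursion[of moment w] unital by simp

lemma vector_space_scale: "vector_space scale"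
  using linear_\<phi> by (simp add: Vector_Spaces.linear_iff)

lemma multilinear_moment: "multilinear scale moment"
  using linear_\<phi> unfolding multilinear_def linear_complex_iff[OF vector_space_scale]
  by (simp add: algebra_simps scale_mult_left scale_mult_right)

lemma character_of_eq: "character_of scale \<phi> = char_ext moment"
  unfolding character_of_def
proof (rule the_equality)
  have "Vector_Spaces.linear scale (*) (\<lambda>x. char_ext moment (us @ [xs @ [x] @ ys] @ ws))" for us xs ys ws
  proof (cases "[] \<in> set us \<union> set ws")
    case True
    then show ?thesis using linear_zero_function[OF vector_space_scale] by (simp add: char_ext_def)
  next
    case False
    have "(\<lambda>x. char_ext moment (us @ [xs @ [x] @ ys] @ ws)) =
        (\<lambda>x. (char_ext moment us * char_ext moment ws) * moment (xs @ [x] @ ys))"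
      using False by (auto simp: char_ext_def mult_ac)
    then show ?thesis
      using linear_scaled_function[OF vector_space_scale] multilinear_moment by (simp add: multilinear_def)
  qed
  then show "char_ext moment \<in> characters scale \<and> (\<forall>w. w \<noteq> [] \<longrightarrow> char_ext moment [w] = moment w)"
    by (simp add: characters_def linear_form_def char_ext_def)
next
  fix \<Phi> :: "'a form"
  assume *: "\<Phi> \<in> characters scale \<and> (\<forall>w. w \<noteq> [] \<longrightarrow> \<Phi> [w] = moment w)"
  then have mult: "\<Phi> (us @ ws) = \<Phi> us * \<Phi> ws" and one: "\<Phi> [] = 1" and z: "[] \<in> set ws \<Longrightarrow> \<Phi> ws = 0" for us ws
    by (auto simp: characters_def linear_form_def)
  show "\<Phi> = char_ext moment"
  proof
    fix ws show "\<Phi> ws = char_ext moment ws"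
    proof (induction ws)
      case (Cons w ws)
      then show ?case
        using mult[of "[w]" ws] z[of "w # ws"] * by (cases "w = []") (auto simp: char_ext_def)
    qed (simp add: one char_ext_def)
  qed
qed

text \<open>
  With \<open>c = th\<close>, the recursion for \<open>h\<close> gives \<open>W\<^sub>c(h) = b\<close> and \<open>W\<^sub>c(c) = tb\<close>.  The latter
  identifies \<open>c\<close> as the logarithm of \<open>\<Phi>\<^sub>t\<close>, and then the former identifies \<open>h\<close> as \<open>P(\<Phi>, \<Phi>\<^sub>t)\<close>.
\<close>

lemma t_monotone_cumulant_eq:
  "t_monotone_cumulant scale \<phi> t = t_cumulant (complex_of_real t) bool_word"
proof -
  note vs = vector_space_scale
  let ?t = "complex_of_real t"
  let ?h = "t_cumulant ?t bool_word"
  let ?c = "\<lambda>w. ?t * ?h w"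
  have mb: "multilinear scale bool_word"
    using multilinear_concat_root[OF vs multilinear_moment] .
  have mh: "multilinear scale ?h" using multilinear_t_cumulant[OF vs mb] .
  have mc: "multilinear scale ?c" using multilinear_scale[OF vs mh] .
  have char: "char_ext moment = exp_succ (inf_ext bool_word)"
    by (rule exp_succ_eq_char_ext[symmetric, OF _ moment_recursion]) (simp_all add: unital)
  have W: "word_W ?c ?h w = bool_word w" if "w \<noteq> []" for w
    using word_W_t_cumulant[OF that] .
  have "word_W ?c ?c w = ?t * bool_word w" if "w \<noteq> []" for w
  proof -
    have "word_W ?c ?c w = ?t * word_W ?c ?h w"
      unfolding word_W_def insertion_pow_scale_arg
      using suminf_mult[OF sums_summable[OF word_W_sums[of ?c ?h w]], of ?t] by (simp add: mult_ac)
    then show ?thesis using W[OF that] by simp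
  qed
  then have eq: "exp_succ (inf_ext (\<lambda>w. ?t * bool_word w)) = exp_conv (inf_ext ?c)"
    unfolding exp_conv_eq_exp_succ using inf_ext_cong[of "\<lambda>w. ?t * bool_word w" "word_W ?c ?c"] by simp
  have "(\<lambda>ws. ?t * inf_ext bool_word ws) = inf_ext (\<lambda>w. ?t * bool_word w)"
    by (auto simp: inf_ext_def fun_eq_iff split: list.split)
  then have "exp_succ (\<lambda>ws. ?t * log_succ scale (character_of scale \<phi>) ws) = exp_conv (inf_ext ?c)"
    unfolding character_of_eq char log_succ_eq[OF vs mb] using eq by simp
  then have "t_monotone_cumulant scale \<phi> t w = inf_ext ?h [w]" for w
    unfolding t_monotone_cumulant_def Let_def
    using c_monotone_eq[OF vs mb mc mh W] by (simp add: character_of_eq char)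
  moreover have "?h [] = 0" by (simp add: t_cumulant.simps)
  ultimately show ?thesis by (auto simp: inf_ext_def fun_eq_iff)
qed

end

theorem theorem7p8:
  fixes scale :: "complex \<Rightarrow> 'a::ring_1 \<Rightarrow> 'a"
    and \<phi> :: "'a \<Rightarrow> complex" and t :: real and n :: nat and xs :: "'a list"
  assumes "nc_prob_space scale \<phi>"
    and "t \<in> {0..1}"
    and "n \<ge> 1" and "length xs = n"
  shows "boolean_cumulant \<phi> xs =
           (\<Sum>\<pi>\<in>NC_irr n.
              complex_of_real (t ^ (card \<pi> - 1) / real (forest_factorial (nesting_forest \<pi>)))
                * part_ext (t_monotone_cumulant scale \<phi> t) \<pi> xs) \<and>
         \<phi> (prod_list xs) =
           (\<Sum>\<pi>\<in>NC n.
              complex_of_real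
                (t ^ card (inner_blocks \<pi>) / real (forest_factorial (nesting_forest \<pi>)))
                * part_ext (t_monotone_cumulant scale \<phi> t) \<pi> xs)"
proof -
  interpret nc_prob_space scale \<phi> by (rule assms(1))
  have ne: "xs \<noteq> []" using assms(3,4) by auto
  have "moment xs = (\<Sum>\<pi>\<in>NC (length xs). inner_weight t \<pi> * part_ext (t_cumulant t bool_word) \<pi> xs)"
    by (rule moment_NC_sum[OF _ moment_recursion]) (simp_all add: unital)
  then show ?thesis
    using t_cumulant_irr_sum[OF ne, of bool_word "complex_of_real t"]
    unfolding t_monotone_cumulant_eq boolean_cumulant_eq_concat_root[where \<phi>=\<phi>, OF unital] assms(4)
    by (simp add: inner_weight_def)
qed

end
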